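(* Let $\alpha_1,\alpha_2,\gamma_1,\gamma_2,\Gamma$ be real constants with $\Gamma>0$, $\alpha_1\neq 0$ and $\frac{2\alpha_2}{3\alpha_1}\notin\mathbf{Z}$. Let real numbers $s,s_1$ satisfy $1\le s_1\le s<s_1+1$. Then there exists $u_0\in H^s(\mathbf{T})$ such that for no $T>0$ does the Cauchy problem $$\partial_t u=\alpha_1\partial_x^3u+i\alpha_2\partial_x^2u+i\gamma_1|u|^2u+\gamma_2\partial_x(|u|^2u)-i\Gamma u\,\partial_x(|u|^2),\quad x\in\mathbf{T},\qquad u(0,\cdot)=u_0,$$ have a solution $u\in C([0,T];H^{s_1}(\mathbf{T}))$ on $[0,T]$, and for no $T>0$ does it have a solution $u\in C([-T,0];H^{s_1}(\mathbf{T}))$ on $[-T,0]$.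
   Context: Notation: $\mathbf{T}=\mathbf{R}/2\pi\mathbf{Z}$; functions are complex-valued; $\hat f(k)=\frac1{\sqrt{2\pi}}\int_{\mathbf{T}}e^{-ikx}f(x)\,dx$ for $k\in\mathbf{Z}$; $\langle\xi\rangle=1+|\xi|$; $\|f\|_{H^s}=\|\langle k\rangle^s\hat f(k)\|_{\ell^2(\mathbf{Z})}$. Notion of solution: Let $T>0$, $s\ge0$, $u_0\in H^s(\mathbf{T})$. A function $u$ is a solution of the Cauchy problem on $[0,T)$ if $u\in L^\infty_{loc}([0,T);H^s(\mathbf{T}))\cap L^3_{loc}([0,T)\times\mathbf{T})$, $\partial_x(|u|^2)\in L^1_{loc}([0,T);H^{-s}(\mathbf{T}))$, and for every $\phi\in C_0^\infty([0,T)\times\mathbf{T})$, $$-\int_0^T\!\!\int_{\mathbf{T}}u\,\partial_t\phi\,dx\,dt-\int_{\mathbf{T}}u_0\phi(0,\cdot)\,dx=\int_0^T\!\!\int_{\mathbf{T}}\big[u(-\alpha_1\partial_x^3\phi+i\alpha_2\partial_x^2\phi)+|u|^2u(i\gamma_1\phi-\gamma_2\partial_x\phi)\big]dx\,dt-i\Gamma\int_0^T\langle\partial_x(|u|^2)(t),u(t)\phi(t)\rangle_{H^{-s},H^s}\,dt .$$ A function $u$ is a solution on the closed interval $[0,T]$ if $u\in C([0,T];H^{s}(\mathbf{T}))$ for some $s>1/2$ and $u|_{[0,T)}$ is a solution on $[0,T)$, that is, $u|_{[0,T)}\in L^\infty_{loc}([0,T);H^s(\mathbf{T}))\cap L^3_{loc}([0,T)\times\mathbf{T})$,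 $\partial_x(|u|^2)\in L^1_{loc}([0,T);H^{-s}(\mathbf{T}))$, and the displayed integral identity holds for every $\phi\in C_0^\infty([0,T)\times\mathbf{T})$. Solutions on $(-T,0]$ and $[-T,0]$ are defined in a similar manner (with test functions in $C_0^\infty((-T,0]\times\mathbf{T})$, time integrals over $(-T,0)$, and the term $-\int_{\mathbf{T}}u_0\phi(0,\cdot)\,dx$ replaced by $+\int_{\mathbf{T}}u_0\phi(0,\cdot)\,dx$). *)

theory Defs
  imports "HOL-Analysis.Analysis"
begin

text \<open>
  Functions on the torus \<open>\<real>/2\<pi>\<int>\<close> are \<open>2\<pi>\<close>-periodic functions on the reals, integrated over
  \<open>[0, 2\<pi>]\<close>. Classes of functions modulo null sets are represented by Borel functions;
  every class contains one.
\<close>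

abbreviation torus :: "real set" where
  "torus \<equiv> {0..2 * pi}"

definition periodic :: "(real \<Rightarrow> complex) \<Rightarrow> bool" where
  "periodic f \<longleftrightarrow> (\<forall>x. f (x + 2 * pi) = f x)"

definition fourier :: "(real \<Rightarrow> complex) \<Rightarrow> int \<Rightarrow> complex" where
  "fourier f k =
     1 / complex_of_real (sqrt (2 * pi)) *
     (LINT x:torus|lborel. exp (- \<i> * of_int k * of_real x) * f x)"

definition japanese :: "real \<Rightarrow> real" where
  "japanese \<xi> = 1 + \<bar>\<xi>\<bar>"

text \<open>
  A distribution on the torus is given by its sequence of Fourier coefficients. The next two
  definitions describe \<open>H\<^sup>s\<close> and its norm in these terms, for every real \<open>s\<close>.
\<close>

definition sobolev_seq :: "real \<Rightarrow> (int \<Rightarrow> complex) \<Rightarrow> bool" where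
  "sobolev_seq s a \<longleftrightarrow>
     (\<lambda>k. (japanese (of_int k) powr s * cmod (a k))\<^sup>2) summable_on UNIV"

definition sobolev_seq_norm :: "real \<Rightarrow> (int \<Rightarrow> complex) \<Rightarrow> real" where
  "sobolev_seq_norm s a =
     sqrt (\<Sum>\<^sub>\<infinity>k. (japanese (of_int k) powr s * cmod (a k))\<^sup>2)"

text \<open>
  \<open>H\<^sup>s\<close> as a space of functions; to be used for \<open>s \<ge> 0\<close> only, where \<open>H\<^sup>s \<subseteq> L\<^sup>2\<close>.
\<close>

definition sobolev :: "real \<Rightarrow> (real \<Rightarrow> complex) set" where
  "sobolev s = {f. periodic f \<and> f \<in> borel_measurable borel \<and>
     set_integrable lborel torus (\<lambda>x. (cmod (f x))\<^sup>2) \<and> sobolev_seq s (fourier f)}"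

definition sobolev_norm :: "real \<Rightarrow> (real \<Rightarrow> complex) \<Rightarrow> real" where
  "sobolev_norm s f = sobolev_seq_norm s (fourier f)"

text \<open>The bilinear (not sesquilinear) duality extending \<open>(f, g) \<mapsto> \<integral> f g dx\<close>, by Parseval.\<close>

definition dual_pairing :: "(int \<Rightarrow> complex) \<Rightarrow> (int \<Rightarrow> complex) \<Rightarrow> complex" where
  "dual_pairing a b = (\<Sum>\<^sub>\<infinity>k. a k * b (- k))"

text \<open>The Fourier coefficients of the distributional derivative of \<open>\<bar>f\<bar>\<^sup>2\<close>.\<close>

definition deriv_abs_sq :: "(real \<Rightarrow> complex) \<Rightarrow> int \<Rightarrow> complex" where
  "deriv_abs_sq f k = \<i> * of_int k * fourier (\<lambda>x. complex_of_real ((cmod (f x))\<^sup>2)) k"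

text \<open>
  Functions of time and space are written \<open>u t x\<close>; only the values for \<open>t\<close> in a given interval
  \<open>I\<close> matter. As \<open>H\<^sup>s\<close> is separable, strong measurability in time amounts to measurability of
  all the Fourier coefficients.
\<close>

definition Linf_loc_sobolev :: "real set \<Rightarrow> real \<Rightarrow> (real \<Rightarrow> real \<Rightarrow> complex) \<Rightarrow> bool" where
  "Linf_loc_sobolev I s u \<longleftrightarrow>
     (\<forall>k. set_borel_measurable lborel I (\<lambda>t. fourier (u t) k)) \<and>
     (\<forall>K. compact K \<and> K \<subseteq> I \<longrightarrow>
        (\<exists>C. AE t in lborel. t \<in> K \<longrightarrow> u t \<in> sobolev s \<and> sobolev_norm s (u t) \<le> C))"

definition L1_loc_sobolev_seq :: "real set \<Rightarrow> real \<Rightarrow> (real \<Rightarrow> int \<Rightarrow> complex) \<Rightarrow> bool" where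
  "L1_loc_sobolev_seq I s a \<longleftrightarrow>
     (\<forall>k. set_borel_measurable lborel I (\<lambda>t. a t k)) \<and>
     (AE t in lborel. t \<in> I \<longrightarrow> sobolev_seq s (a t)) \<and>
     (\<forall>K. compact K \<and> K \<subseteq> I \<longrightarrow> set_integrable lborel K (\<lambda>t. sobolev_seq_norm s (a t)))"

definition L3_loc :: "real set \<Rightarrow> (real \<Rightarrow> real \<Rightarrow> complex) \<Rightarrow> bool" where
  "L3_loc I u \<longleftrightarrow>
     (\<forall>t\<in>I. periodic (u t)) \<and>
     set_borel_measurable lborel (I \<times> UNIV) (\<lambda>(t, x). u t x) \<and>
     (\<forall>K. compact K \<and> K \<subseteq> I \<longrightarrow>
        set_integrable lborel (K \<times> torus) (\<lambda>(t, x). (cmod (u t x)) ^ 3))"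

definition C_sobolev :: "real set \<Rightarrow> real \<Rightarrow> (real \<Rightarrow> real \<Rightarrow> complex) set" where
  "C_sobolev J s = {u. (\<forall>t\<in>J. u t \<in> sobolev s) \<and>
     (\<forall>t\<in>J. ((\<lambda>\<tau>. sobolev_norm s (\<lambda>x. u \<tau> x - u t x)) \<longlongrightarrow> 0) (at t within J))}"

text \<open>
  \<open>D i j\<close> is the partial derivative of order \<open>i\<close> in time and \<open>j\<close> in space. Time derivatives
  are taken within \<open>I\<close>, hence are one-sided at an endpoint belonging to \<open>I\<close>.
\<close>

definition smooth_on_strip :: "real set \<Rightarrow> (real \<Rightarrow> real \<Rightarrow> complex) \<Rightarrow> bool" where
  "smooth_on_strip I \<phi> \<longleftrightarrow>
     (\<exists>D :: nat \<Rightarrow> nat \<Rightarrow> real \<Rightarrow> real \<Rightarrow> complex.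
        (\<forall>t\<in>I. \<forall>x. D 0 0 t x = \<phi> t x) \<and>
        (\<forall>i j. continuous_on (I \<times> UNIV) (\<lambda>(t, x). D i j t x) \<and>
          (\<forall>t\<in>I. \<forall>x.
             ((\<lambda>\<tau>. D i j \<tau> x) has_vector_derivative D (Suc i) j t x) (at t within I) \<and>
             (D i j t has_vector_derivative D i (Suc j) t x) (at x))))"

definition test_functions :: "real set \<Rightarrow> (real \<Rightarrow> real \<Rightarrow> complex) set" where
  "test_functions I = {\<phi>. (\<forall>t\<in>I. periodic (\<phi> t)) \<and> smooth_on_strip I \<phi> \<and>
     (\<exists>K. compact K \<and> K \<subseteq> I \<and> (\<forall>t\<in>I - K. \<forall>x. \<phi> t x = 0))}"

definition dt :: "real set \<Rightarrow> (real \<Rightarrow> real \<Rightarrow> complex) \<Rightarrow> real \<Rightarrow> real \<Rightarrow> complex" where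
  "dt I \<phi> t x = vector_derivative (\<lambda>\<tau>. \<phi> \<tau> x) (at t within I)"

definition dx :: "(real \<Rightarrow> real \<Rightarrow> complex) \<Rightarrow> real \<Rightarrow> real \<Rightarrow> complex" where
  "dx \<phi> t x = vector_derivative (\<phi> t) (at x)"

text \<open>
  The weak form of
  \<open>\<partial>\<^sub>t u = \<alpha>1 \<partial>\<^sub>x\<^sup>3 u + i \<alpha>2 \<partial>\<^sub>x\<^sup>2 u + i \<gamma>1 \<bar>u\<bar>\<^sup>2 u + \<gamma>2 \<partial>\<^sub>x(\<bar>u\<bar>\<^sup>2 u) - i \<Gamma> u \<partial>\<^sub>x(\<bar>u\<bar>\<^sup>2)\<close>
  with \<open>u(0) = u0\<close>. The sign \<open>\<epsilon>\<close> of the boundary term at time \<open>0\<close> is \<open>-1\<close> for \<open>I = [0,T)\<close>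
  and \<open>1\<close> for \<open>I = (-T,0]\<close>.
\<close>

definition weak_identity ::
  "real \<Rightarrow> real \<Rightarrow> real \<Rightarrow> real \<Rightarrow> real \<Rightarrow> real set \<Rightarrow> real \<Rightarrow>
   (real \<Rightarrow> complex) \<Rightarrow> (real \<Rightarrow> real \<Rightarrow> complex) \<Rightarrow> (real \<Rightarrow> real \<Rightarrow> complex) \<Rightarrow> bool" where
  "weak_identity \<alpha>1 \<alpha>2 \<gamma>1 \<gamma>2 \<Gamma> I \<epsilon> u0 u \<phi> \<longleftrightarrow>
     - (LINT t:I|lborel. LINT x:torus|lborel. u t x * dt I \<phi> t x)
       + complex_of_real \<epsilon> * (LINT x:torus|lborel. u0 x * \<phi> 0 x)
     = (LINT t:I|lborel. LINT x:torus|lborel.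
          u t x * (- complex_of_real \<alpha>1 * (dx ^^ 3) \<phi> t x
                   + \<i> * complex_of_real \<alpha>2 * (dx ^^ 2) \<phi> t x)
          + complex_of_real ((cmod (u t x))\<^sup>2) * u t x *
              (\<i> * complex_of_real \<gamma>1 * \<phi> t x - complex_of_real \<gamma>2 * dx \<phi> t x))
       - \<i> * complex_of_real \<Gamma> *
          (LINT t:I|lborel. dual_pairing (deriv_abs_sq (u t)) (fourier (\<lambda>x. u t x * \<phi> t x)))"

definition solution_on ::
  "real \<Rightarrow> real \<Rightarrow> real \<Rightarrow> real \<Rightarrow> real \<Rightarrow> real set \<Rightarrow> real \<Rightarrow> real \<Rightarrow>
   (real \<Rightarrow> complex) \<Rightarrow> (real \<Rightarrow> real \<Rightarrow> complex) \<Rightarrow> bool" where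
  "solution_on \<alpha>1 \<alpha>2 \<gamma>1 \<gamma>2 \<Gamma> I \<epsilon> s u0 u \<longleftrightarrow>
     0 \<le> s \<and> u0 \<in> sobolev s \<and>
     Linf_loc_sobolev I s u \<and> L3_loc I u \<and>
     L1_loc_sobolev_seq I (- s) (\<lambda>t. deriv_abs_sq (u t)) \<and>
     (\<forall>\<phi>\<in>test_functions I. weak_identity \<alpha>1 \<alpha>2 \<gamma>1 \<gamma>2 \<Gamma> I \<epsilon> u0 u \<phi>)"

definition forward_solution ::
  "real \<Rightarrow> real \<Rightarrow> real \<Rightarrow> real \<Rightarrow> real \<Rightarrow> real \<Rightarrow>
   (real \<Rightarrow> complex) \<Rightarrow> (real \<Rightarrow> real \<Rightarrow> complex) \<Rightarrow> bool" where
  "forward_solution \<alpha>1 \<alpha>2 \<gamma>1 \<gamma>2 \<Gamma> T u0 u \<longleftrightarrow>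
     (\<exists>\<sigma>>1/2. u \<in> C_sobolev {0..T} \<sigma> \<and> solution_on \<alpha>1 \<alpha>2 \<gamma>1 \<gamma>2 \<Gamma> {0..<T} (-1) \<sigma> u0 u)"

definition backward_solution ::
  "real \<Rightarrow> real \<Rightarrow> real \<Rightarrow> real \<Rightarrow> real \<Rightarrow> real \<Rightarrow>
   (real \<Rightarrow> complex) \<Rightarrow> (real \<Rightarrow> real \<Rightarrow> complex) \<Rightarrow> bool" where
  "backward_solution \<alpha>1 \<alpha>2 \<gamma>1 \<gamma>2 \<Gamma> T u0 u \<longleftrightarrow>
     (\<exists>\<sigma>>1/2. u \<in> C_sobolev {-T..0} \<sigma> \<and> solution_on \<alpha>1 \<alpha>2 \<gamma>1 \<gamma>2 \<Gamma> {-T<..0} 1 \<sigma> u0 u)"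

end

theory Submission
  imports Defs
begin

text \<open>
  On Fourier coefficients the equation reads
  \<open>a\<^sub>k' = \<i> \<omega>\<^sub>k a\<^sub>k + (2\<pi>)\<inverse> \<Sum> w a\<^sub>l cnj a\<^sub>-\<^sub>m a\<^sub>n\<close>, the sum running over
  \<open>l + m + n = k\<close>. The condition on \<open>\<alpha>1, \<alpha>2\<close> says that the phase vanishes only if \<open>l = k\<close> or
  \<open>n = k\<close>, and these resonant terms contribute \<open>\<rho>\<^sub>k a\<^sub>k\<close> with
  \<open>Re \<rho>\<^sub>k = (2\<pi>)\<inverse> \<Gamma> (k \<parallel>u\<parallel>\<^sup>2 + O(1))\<close>: the equation is of Cauchy-Riemann type. Forward in time,
  the coefficients with large \<open>k > 0\<close> can only stay bounded if
  \<open>a\<^sub>k(0) = - \<integral> exp (- \<integral> \<rho>\<^sub>k) (nonresonant terms)\<close> up to an exponentially small error. A normal form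
  reduction (division by the phase and integration by parts) gains a derivative in the nonresonant
  terms, so \<open>a\<^sub>k(0) = O(k\<^sup>-\<^sup>s\<^sup>1\<^sup>-\<^sup>1)\<close>. Reflection \<open>(t, k) \<mapsto> (-t, -k)\<close> with complex conjugation
  gives the same bound for \<open>k < 0\<close> from a solution backward in time. Lacunary data in \<open>H\<^sup>s\<close>,
  \<open>s < s1 + 1\<close>, violate both bounds.
\<close>

section \<open>Weighted sequence spaces\<close>

text \<open>The obstacle is that the cubic term costs a derivative: for \<open>u\<close> in
  \<open>H^s1\<close> it lies only in \<open>H^(s1 - 1)\<close>, and damping alone would return the
  decay k^(-s1) that is known anyway. The normal form helps because the weight is at most of the
  size of the sum of three frequency gaps, while the phase is of the size of their product; the
  quotient is the kernel \<open>ker\<close>, which keeps the reciprocals of two gaps. The boundary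
  terms then contain three \<open>H^s1\<close> factors and gain a full power of k from the kernel.
  The remaining time integral contains a factor in \<open>H^(s1 - 1)\<close> and is only of size
  k^(-s1); there the last power comes from integrating the damping, whose rate is proportional to k.

  No conservation law enters: the rate needs a lower bound for one coefficient, which continuity
  gives for a short time, and the frequencies above k, which contribute with the wrong sign, cost at
  most the square of an \<open>H^1\<close> bound, uniformly in k. Infinite sums are never
  differentiated in time: the normal form is made on finite sets of frequencies, and dominated
  convergence removes the truncation error.\<close>

definition sum_le :: "('a \<Rightarrow> real) \<Rightarrow> real \<Rightarrow> bool" where
  "sum_le f C \<longleftrightarrow> (\<forall>F. finite F \<longrightarrow> sum f F \<le> C)"

definition jp :: "int \<Rightarrow> real" where
  "jp j = japanese (of_int j)"

text \<open>\<open>X\<close> is any bound for the \<open>H^s\<close> norm and not the norm itself,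
  so constants can be rounded up freely. The sign condition allows roots to be taken, since only
  \<open>X^2\<close> occurs in the sum.\<close>

definition sob_le :: "real \<Rightarrow> (int \<Rightarrow> complex) \<Rightarrow> real \<Rightarrow> bool" where
  "sob_le s x X \<longleftrightarrow> 0 \<le> X \<and> sum_le (\<lambda>j. (jp j powr s * cmod (x j))\<^sup>2) (X\<^sup>2)"

lemma sum_leD: "sum_le f C \<Longrightarrow> finite F \<Longrightarrow> sum f F \<le> C"
  by (simp add: sum_le_def)

lemma sum_le_nonneg: "sum_le f C \<Longrightarrow> 0 \<le> C"
  using sum_leD[of f C "{}"] by simp

lemma sum_le_point: "sum_le f C \<Longrightarrow> f i \<le> C"
  using sum_leD[of f C "{i}"] by simp

lemma sum_le_mono:
  assumes "sum_le g D" "\<And>i. f i \<le> g i" "D \<le> C"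
  shows "sum_le f C"
  using assms unfolding sum_le_def by (meson order_trans sum_mono)

lemma sum_le_add: "sum_le f C \<Longrightarrow> sum_le g D \<Longrightarrow> sum_le (\<lambda>i. f i + g i) (C + D)"
  unfolding sum_le_def by (auto simp: sum.distrib intro: add_mono)

lemma sum_le_cmult: "sum_le f C \<Longrightarrow> 0 \<le> c \<Longrightarrow> sum_le (\<lambda>i. c * f i) (c * C)"
  unfolding sum_le_def by (auto simp: sum_distrib_left[symmetric] intro: mult_left_mono)

lemma sum_le_reindex:
  assumes "sum_le f C" "inj h" shows "sum_le (\<lambda>i. f (h i)) C"
  unfolding sum_le_def
proof (intro allI impI)
  fix F :: "'b set" assume "finite F"
  have "(\<Sum>i\<in>F. f (h i)) = sum f (h ` F)"
    by (subst sum.reindex) (use assms(2) in \<open>auto intro: inj_on_subset\<close>)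
  also have "\<dots> \<le> C" using assms(1) \<open>finite F\<close> by (intro sum_leD) auto
  finally show "(\<Sum>i\<in>F. f (h i)) \<le> C" .
qed

text \<open>Bounds on all finite partial sums carry summability and the bound together. Double sums
  then need no Fubini theorem: a finite set of pairs is enlarged to a rectangle.\<close>

lemma sum_le_pairI:
  assumes nn: "\<And>i j. 0 \<le> f i j" and f: "\<And>i. sum_le (f i) (g i)" and g: "sum_le g C"
  shows "sum_le (\<lambda>(i, j). f i j) C"
  unfolding sum_le_def
proof (intro allI impI)
  fix F :: "('a \<times> 'b) set" assume F: "finite F"
  have "(\<Sum>(i, j)\<in>F. f i j) \<le> (\<Sum>(i, j)\<in>fst ` F \<times> snd ` F. f i j)"
    using F nn by (intro sum_mono2) (force simp: image_iff)+
  also have "\<dots> = (\<Sum>i\<in>fst ` F. \<Sum>j\<in>snd ` F. f i j)"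
    by (simp add: sum.cartesian_product)
  also have "\<dots> \<le> (\<Sum>i\<in>fst ` F. g i)"
    using F f by (intro sum_mono sum_leD) auto
  also have "\<dots> \<le> C" using F g by (intro sum_leD) auto
  finally show "(\<Sum>(i, j)\<in>F. f i j) \<le> C" .
qed

lemma sum_le_Cauchy_Schwarz:
  assumes "sum_le (\<lambda>i. (f i)\<^sup>2) (X\<^sup>2)" "sum_le (\<lambda>i. (g i)\<^sup>2) (Y\<^sup>2)" "0 \<le> X" "0 \<le> Y"
  shows "sum_le (\<lambda>i. f i * g i) (X * Y)"
  unfolding sum_le_def
proof (intro allI impI)
  fix F :: "'a set" assume F: "finite F"
  have "(\<Sum>i\<in>F. f i * g i) \<le> (\<Sum>i\<in>F. \<bar>f i\<bar> * \<bar>g i\<bar>)"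
    by (intro sum_mono) (metis abs_ge_self abs_mult)
  also have "\<dots> \<le> L2_set f F * L2_set g F" by (rule L2_set_mult_ineq)
  also have "L2_set f F \<le> X" unfolding L2_set_def
    using assms F by (metis real_le_lsqrt real_sqrt_le_iff real_sqrt_unique sum_leD)
  also have "L2_set g F \<le> Y" unfolding L2_set_def
    using assms F by (metis real_le_lsqrt real_sqrt_le_iff real_sqrt_unique sum_leD)
  finally show "(\<Sum>i\<in>F. f i * g i) \<le> X * Y" 
    using assms by (simp add: mult_left_mono mult_right_mono)
qed

lemma sum_le_summable:
  fixes f :: "'a \<Rightarrow> 'b :: banach"
  assumes "sum_le (\<lambda>i. norm (f i)) C"
  shows "f summable_on A" "(\<lambda>i. norm (f i)) summable_on A" "norm (infsum f A) \<le> C"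
proof -
  have *: "sum (\<lambda>i. norm (f i)) F \<le> C" if "finite F" for F using assms that by (rule sum_leD)
  show a: "(\<lambda>i. norm (f i)) summable_on A"
    by (intro nonneg_bdd_above_summable_on bdd_aboveI[of _ C]) (auto intro: *)
  then show "f summable_on A" by (rule abs_summable_summable)
  show "norm (infsum f A) \<le> C"
    using norm_infsum_bound[of f A] infsum_le_finite_sums[OF a, of C] * a by fastforce
qed

lemma has_sum_finite_sum:
  fixes f :: "'a \<Rightarrow> 'b \<Rightarrow> 'c :: {topological_comm_monoid_add, t2_space}"
  assumes "finite F" "\<And>i. i \<in> F \<Longrightarrow> (f i has_sum s i) A"
  shows "((\<lambda>j. \<Sum>i\<in>F. f i j) has_sum (\<Sum>i\<in>F. s i)) A"
  using assms by (induction rule: finite_induct) (auto intro!: has_sum_add has_sum_0)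

lemma sum_le_infsum:
  assumes nn: "\<And>i j. 0 \<le> f i j" and f: "sum_le (\<lambda>(i, j). f i j) C"
  shows "sum_le (\<lambda>i. \<Sum>\<^sub>\<infinity>j. f i j) C"
  unfolding sum_le_def
proof (intro allI impI)
  fix F :: "'a set" assume F: "finite F"
  have *: "sum_le (f i) C" for i
    using sum_le_reindex[OF f, of "Pair i"] by (auto simp: inj_def)
  have s: "f i summable_on UNIV" for i
    using sum_le_summable(1)[of "f i" C] nn * by simp
  have "(\<Sum>i\<in>F. \<Sum>\<^sub>\<infinity>j. f i j) = (\<Sum>\<^sub>\<infinity>j. \<Sum>i\<in>F. f i j)"
    using has_sum_finite_sum[OF F, of f UNIV "\<lambda>i. \<Sum>\<^sub>\<infinity>j. f i j"] s
    by (simp add: infsumI)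
  also have "\<dots> \<le> C"
  proof (rule infsum_le_finite_sums)
    show "(\<lambda>j. \<Sum>i\<in>F. f i j) summable_on UNIV" 
      using has_sum_finite_sum[OF F, of f UNIV "\<lambda>i. \<Sum>\<^sub>\<infinity>j. f i j"] s
      by (auto simp: summable_on_def)
    fix G :: "'b set" assume G: "finite G"
    have "(\<Sum>j\<in>G. \<Sum>i\<in>F. f i j) = (\<Sum>(i, j)\<in>F \<times> G. f i j)"
      by (subst sum.swap) (simp add: sum.cartesian_product)
    also have "\<dots> \<le> C" using F G f by (intro sum_leD) auto
    finally show "(\<Sum>j\<in>G. \<Sum>i\<in>F. f i j) \<le> C" .
  qed
  finally show "(\<Sum>i\<in>F. \<Sum>\<^sub>\<infinity>j. f i j) \<le> C" .
qed

lemma infsum_upper: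
  assumes "sum_le f C" "\<And>i. 0 \<le> f i"
  shows "sum_le f (infsum f UNIV)"
  unfolding sum_le_def
proof (intro allI impI)
  fix F :: "'a set" assume "finite F"
  have "f summable_on UNIV" using sum_le_summable(1)[of f C] assms by simp
  then show "sum f F \<le> infsum f UNIV"
    using \<open>finite F\<close> assms(2) by (intro finite_sum_le_infsum) auto
qed

section \<open>The bracket weight and embeddings of H^1\<close>

lemma jp_ge_1 [simp]: "1 \<le> jp j" and jp_pos [simp]: "0 < jp j" and jp_nn [simp]: "0 \<le> jp j"
  by (auto simp: jp_def japanese_def)

lemma jp_nonzero [simp]: "jp j \<noteq> 0"
  by (metis jp_pos less_irrefl)

lemma jp_minus [simp]: "jp (- j) = jp j"
  by (simp add: jp_def japanese_def)

lemma jp_add: "jp (i + j) \<le> jp i + jp j"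
  by (auto simp: jp_def japanese_def)

lemma inverse_jp_l2: "sum_le (\<lambda>j. (1 / jp j)\<^sup>2) (2\<^sup>2)"
proof -
  have N: "sum_le (\<lambda>n::nat. (1 / (1 + real n))\<^sup>2) 2"
    unfolding sum_le_def
  proof (intro allI impI)
    fix F :: "nat set" assume "finite F"
    then obtain N where N: "F \<subseteq> {..<N}" by (meson finite_nat_iff_bounded)
    \<comment> \<open>\<open>1 / N\<close> is subtracted so that the induction closes: the next
      summand is at most \<open>1 / N - 1 / (N + 1)\<close>.\<close>
    have "(\<Sum>n<N. (1 / (1 + real n))\<^sup>2) \<le> 2 - (if N = 0 then 0 else 1 / real N)"
    proof (induction N)
      case (Suc N)
      have "(1 / (1 + real N))\<^sup>2 \<le> 1 / real N - 1 / real (Suc N)" if "N > 0"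
        using that by (simp add: power2_eq_square divide_simps)
      then show ?case using Suc by (cases "N = 0") (auto simp: add_ac)
    qed auto
    also have "\<dots> \<le> 2" by simp
    finally show "(\<Sum>n\<in>F. (1 / (1 + real n))\<^sup>2) \<le> 2"
      using N by (smt (verit) finite_lessThan sum_mono2 zero_le_power2)
  qed
  show ?thesis unfolding sum_le_def
  proof (intro allI impI)
    fix F :: "int set" assume F: "finite F"
    let ?f = "\<lambda>j. (1 / jp j)\<^sup>2"
    have "sum ?f F = sum ?f {j\<in>F. 0 \<le> j} + sum ?f {j\<in>F. j < 0}"
      using F by (subst sum.union_disjoint[symmetric]) (auto intro!: sum.cong)
    also have "sum ?f {j\<in>F. 0 \<le> j} = sum (\<lambda>n. (1 / (1 + real n))\<^sup>2) (nat ` {j\<in>F. 0 \<le> j})"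
      by (subst sum.reindex) (auto simp: inj_on_def jp_def japanese_def intro!: sum.cong)
    also have "\<dots> \<le> 2" using F by (intro sum_leD[OF N]) auto
    also have "sum ?f {j\<in>F. j < 0} = sum (\<lambda>n. (1 / (1 + real n))\<^sup>2) ((\<lambda>j. nat (- j)) ` {j\<in>F. j < 0})"
      by (subst sum.reindex) (auto simp: inj_on_def jp_def japanese_def intro!: sum.cong)
    also have "\<dots> \<le> 2" using F by (intro sum_leD[OF N]) auto
    finally show "sum ?f F \<le> 2\<^sup>2" by simp
  qed
qed

lemma inverse_jp_shift: "sum_le (\<lambda>j. (1 / jp (k - j))\<^sup>2) (2\<^sup>2)" "sum_le (\<lambda>j. (1 / jp (k + j))\<^sup>2) (2\<^sup>2)"
  using sum_le_reindex[OF inverse_jp_l2, of "\<lambda>j. k - j"] sum_le_reindex[OF inverse_jp_l2, of "\<lambda>j. k + j"]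
  by (auto simp: inj_def)

lemma sob_le_mono: "sob_le s x X \<Longrightarrow> r \<le> s \<Longrightarrow> X \<le> Y \<Longrightarrow> sob_le r x Y"
  unfolding sob_le_def
  by (elim conjE, intro conjI, simp, erule sum_le_mono)
     (simp_all add: power_mono mult_right_mono powr_mono)

lemma sob_le_point:
  assumes "sob_le s x X" shows "jp j powr s * cmod (x j) \<le> X" "cmod (x j) \<le> X * jp j powr - s"
proof -
  show "jp j powr s * cmod (x j) \<le> X"
    using sum_le_point[of "\<lambda>j. (jp j powr s * cmod (x j))\<^sup>2" _ j] assms
    unfolding sob_le_def by (auto intro: power2_le_imp_le)
  then show "cmod (x j) \<le> X * jp j powr - s"
    by (simp add: powr_minus pos_le_divide_eq mult.commute flip: divide_inverse)
qed

lemma sob_le_l2: "sob_le 1 x X \<Longrightarrow> sum_le (\<lambda>j. (jp j * cmod (x j))\<^sup>2) (X\<^sup>2)"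
  by (simp add: sob_le_def)

text \<open>Cauchy-Schwarz against \<open>1 / jp j\<close>, whose \<open>l^2\<close> norm is at most
  2: the Fourier series of an \<open>H^1\<close> function converges absolutely.\<close>

lemma sob_le_l1:
  assumes "sob_le 1 x X" shows "sum_le (\<lambda>j. cmod (x j)) (2 * X)"
proof -
  have "sum_le (\<lambda>j. 1 / jp j * (jp j * cmod (x j))) (2 * X)"
    by (rule sum_le_Cauchy_Schwarz[OF inverse_jp_l2 sob_le_l2[OF assms]])
       (use assms in \<open>auto simp: sob_le_def\<close>)
  then show ?thesis by (rule sum_le_mono) (auto simp: field_simps)
qed

text \<open>By \<open>jp k \<le> jp (k - j) + jp j\<close>, the weight at k is paid either by the
  denominator or by the derivative on \<open>x\<close>. Divided by \<open>jp k\<close>, this is the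
  source of the gained power of k.\<close>

lemma sob_le_weighted:
  assumes "sob_le 1 x X" shows "sum_le (\<lambda>j. jp k / jp (k - j) * cmod (x j)) (4 * X)"
proof -
  have "sum_le (\<lambda>j. 1 / jp (k - j) * (jp j * cmod (x j)) + cmod (x j)) (2 * X + 2 * X)"
    by (intro sum_le_add sum_le_Cauchy_Schwarz inverse_jp_shift sob_le_l2 sob_le_l1 assms)
       (use assms in \<open>auto simp: sob_le_def\<close>)
  then show ?thesis
  proof (rule sum_le_mono)
    fix j
    have "jp k \<le> jp (k - j) + jp j" using jp_add[of "k - j" j] by simp
    then have "jp k / jp (k - j) \<le> jp j / jp (k - j) + 1" by (simp add: field_simps)
    from mult_right_mono[OF this, of "cmod (x j)"]
    show "jp k / jp (k - j) * cmod (x j) \<le> 1 / jp (k - j) * (jp j * cmod (x j)) + cmod (x j)"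
      by (simp add: algebra_simps)
  qed simp
qed

section \<open>Trilinear estimates\<close>

text \<open>With A = \<open>jp (k - l)\<close>, B = \<open>jp (l + m)\<close>, C =
  \<open>jp (k - m)\<close> this is (A + B + C) / (A B C), the majorant of weight over phase. The
  three gaps separate k from the frequencies l, k - l - m and m, so the kernel is symmetric in
  these.\<close>

definition ker :: "int \<Rightarrow> int \<Rightarrow> int \<Rightarrow> real" where
  "ker k l m = 1 / (jp (k - l) * jp (k - m)) + 1 / (jp (k - m) * jp (l + m)) + 1 / (jp (k - l) * jp (l + m))"

definition tri :: "int \<Rightarrow> (int \<Rightarrow> int \<Rightarrow> complex) \<Rightarrow> (int \<Rightarrow> complex) \<Rightarrow> (int \<Rightarrow> complex) \<Rightarrow> (int \<Rightarrow> complex) \<Rightarrow> complex" where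
  "tri k w x y z = (\<Sum>\<^sub>\<infinity>(l, m). w l m * (x l * y m * z (k - l - m)))"

lemma ker_nonneg [simp]: "0 \<le> ker k l m"
  by (simp add: ker_def)

lemma ker_swap: "ker k m l = ker k l m"
  by (simp add: ker_def add.commute mult.commute)

text \<open>Exchanges the second frequency with the third; together with \<open>ker_swap\<close>
  this gives all permutations.\<close>

lemma ker_rotate: "ker k l (k - l - m) = ker k l m"
  by (simp add: ker_def add.commute mult.commute)

lemma sum_le_swap: "sum_le (\<lambda>(l, m). f l m) C \<Longrightarrow> sum_le (\<lambda>(l, m). f m l) C"
  using sum_le_reindex[of "\<lambda>(l, m). f l m" C "\<lambda>(l, m). (m, l)"] by (auto simp: inj_def case_prod_unfold)

lemma sum_le_rotate:
  fixes f :: "int \<Rightarrow> int \<Rightarrow> real"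
  shows "sum_le (\<lambda>(l, m). f l m) C \<Longrightarrow> sum_le (\<lambda>(l, m). f l (k - l - m)) C"
  using sum_le_reindex[of "\<lambda>(l, m). f l m" C "\<lambda>(l, m). (l, k - l - m)"]
  by (auto simp: inj_def case_prod_unfold prod_eq_iff)

lemma sum_le_prod:
  assumes "sum_le f A" "sum_le g B" "\<And>i. 0 \<le> f i" "\<And>i. 0 \<le> g i"
  shows "sum_le (\<lambda>(i, j). f i * g j) (A * B)"
proof (rule sum_le_pairI)
  show "sum_le (\<lambda>j. f i * g j) (f i * B)" for i
    using assms by (intro sum_le_cmult)
  show "sum_le (\<lambda>i. f i * B) (A * B)"
    using sum_le_cmult[OF assms(1) sum_le_nonneg[OF assms(2)]] by (simp add: mult.commute)
qed (use assms in auto)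

lemma ker_le1: "ker k l m \<le> 2 / jp (k - l) + 1 / jp (k - m)"
proof -
  have "1 / (jp i * jp j) \<le> 1 / jp i" for i j
    using mult_left_mono[of 1 "jp j" "jp i"] by (intro divide_left_mono) auto
  from this[of "k - l" "k - m"] this[of "k - l" "l + m"] this[of "k - m" "l + m"]
  show ?thesis by (simp add: ker_def)
qed

lemma ker_le2: "ker k l m \<le> 2 / jp (k - l) + 1 / jp (l + m)"
  using ker_le1[of k l "k - l - m"] by (simp add: ker_rotate add.commute)

text \<open>Each term of \<open>ker\<close> retains a factor \<open>1 / jp (k - l)\<close> or
  \<open>1 / jp (k - m)\<close>, which \<open>sob_le_weighted\<close> converts into
  \<open>1 / jp k\<close>; the other sum converges absolutely.\<close>

lemma ker_h1_h1:
  assumes "sob_le 1 x X" "sob_le 1 y Y"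
  shows "sum_le (\<lambda>(l, m). ker k l m * (cmod (x l) * cmod (y m))) (24 * X * Y / jp k)"
proof -
  have XY: "0 \<le> X" "0 \<le> Y" using assms by (auto simp: sob_le_def)
  have 1: "sum_le (\<lambda>(l, m). jp k / jp (k - l) * cmod (x l) * cmod (y m)) (4 * X * (2 * Y))"
    using assms by (intro sum_le_prod sob_le_weighted sob_le_l1) auto
  have 2: "sum_le (\<lambda>(l, m). cmod (x l) * (jp k / jp (k - m) * cmod (y m))) (2 * X * (4 * Y))"
    using assms by (intro sum_le_prod sob_le_weighted sob_le_l1) auto
  have "sum_le (\<lambda>i. 2 * (case i of (l, m) \<Rightarrow> jp k / jp (k - l) * cmod (x l) * cmod (y m)) +
       (case i of (l, m) \<Rightarrow> cmod (x l) * (jp k / jp (k - m) * cmod (y m))))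
       (2 * (4 * X * (2 * Y)) + 2 * X * (4 * Y))"
    by (intro sum_le_add sum_le_cmult 1 2) auto
  from sum_le_cmult[OF this, of "1 / jp k"]
  show ?thesis
  proof (rule sum_le_mono)
    fix i :: "int \<times> int"
    obtain l m where i: "i = (l, m)" by force
    have "ker k l m * (cmod (x l) * cmod (y m)) \<le> (2 / jp (k - l) + 1 / jp (k - m)) * (cmod (x l) * cmod (y m))"
      by (intro mult_right_mono ker_le1) auto
    also have "\<dots> = 1 / jp k * (2 * (jp k / jp (k - l) * cmod (x l) * cmod (y m)) + cmod (x l) * (jp k / jp (k - m) * cmod (y m)))"
      by (simp add: field_simps)
    finally show "(case i of (l, m) \<Rightarrow> ker k l m * (cmod (x l) * cmod (y m))) \<le> 1 / jp k *
       (2 * (case i of (l, m) \<Rightarrow> jp k / jp (k - l) * cmod (x l) * cmod (y m)) +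
       (case i of (l, m) \<Rightarrow> cmod (x l) * (jp k / jp (k - m) * cmod (y m))))"
      by (simp add: i)
  qed (use XY in auto)
qed

text \<open>\<open>x\<close> is only square summable, so the retained kernel factor must depend on
  l: \<open>ker_le2\<close> leaves \<open>1 / jp (k - l)\<close> or \<open>1 / jp (l + m)\<close>,
  both in \<open>l^2\<close> with respect to l. Nothing remains for a gain in k.\<close>

lemma ker_l2_h1:
  assumes "sob_le 0 x X" "sob_le 1 y Y"
  shows "sum_le (\<lambda>(l, m). ker k l m * (cmod (x l) * cmod (y m))) (12 * X * Y)"
proof -
  have XY: "0 \<le> X" "0 \<le> Y" using assms by (auto simp: sob_le_def)
  have x2: "sum_le (\<lambda>l. (cmod (x l))\<^sup>2) (X\<^sup>2)"
    using assms(1) by (simp add: sob_le_def)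
  have "sum_le (\<lambda>l. 1 / jp (k - l) * cmod (x l)) (2 * X)"
    using XY by (intro sum_le_Cauchy_Schwarz inverse_jp_shift x2) auto
  then have 1: "sum_le (\<lambda>(l, m). 1 / jp (k - l) * cmod (x l) * cmod (y m)) (2 * X * (2 * Y))"
    using assms by (intro sum_le_prod sob_le_l1) auto
  have "sum_le (\<lambda>(m, l). cmod (y m) * (1 / jp (m + l) * cmod (x l))) (2 * X * (2 * Y))"
  proof (rule sum_le_pairI)
    fix m
    have "sum_le (\<lambda>l. 1 / jp (m + l) * cmod (x l)) (2 * X)"
      using XY by (intro sum_le_Cauchy_Schwarz inverse_jp_shift x2) auto
    then show "sum_le (\<lambda>l. cmod (y m) * (1 / jp (m + l) * cmod (x l))) (cmod (y m) * (2 * X))"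
      by (intro sum_le_cmult) auto
    show "sum_le (\<lambda>m. cmod (y m) * (2 * X)) (2 * X * (2 * Y))"
      using sum_le_cmult[OF sob_le_l1[OF assms(2)], of "2 * X"] XY by (simp add: mult_ac)
  qed auto
  then have 2: "sum_le (\<lambda>(l, m). cmod (y m) * (1 / jp (m + l) * cmod (x l))) (2 * X * (2 * Y))"
    by (rule sum_le_swap)
  have "sum_le (\<lambda>i. 2 * (case i of (l, m) \<Rightarrow> 1 / jp (k - l) * cmod (x l) * cmod (y m)) +
       (case i of (l, m) \<Rightarrow> cmod (y m) * (1 / jp (m + l) * cmod (x l))))
       (2 * (2 * X * (2 * Y)) + 2 * X * (2 * Y))"
    by (intro sum_le_add sum_le_cmult 1 2) auto
  then show ?thesis
  proof (rule sum_le_mono)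
    fix i :: "int \<times> int"
    obtain l m where i: "i = (l, m)" by force
    have "ker k l m * (cmod (x l) * cmod (y m)) \<le> (2 / jp (k - l) + 1 / jp (l + m)) * (cmod (x l) * cmod (y m))"
      by (intro mult_right_mono ker_le2) auto
    then show "(case i of (l, m) \<Rightarrow> ker k l m * (cmod (x l) * cmod (y m))) \<le>
       2 * (case i of (l, m) \<Rightarrow> 1 / jp (k - l) * cmod (x l) * cmod (y m)) +
       (case i of (l, m) \<Rightarrow> cmod (y m) * (1 / jp (m + l) * cmod (x l)))"
      by (simp add: i field_simps)
  qed (use XY in auto)
qed

lemma sob_le_point_large:
  assumes "sob_le s x X" "0 \<le> s" "jp k \<le> 3 * jp l"
  shows "cmod (x l) \<le> X * (3 powr s * jp k powr - s)"
proof -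
  have "jp k powr s \<le> (3 * jp l) powr s" using assms by (intro powr_mono2) auto
  also have "\<dots> = 3 powr s * jp l powr s" by (simp add: powr_mult)
  finally have "jp l powr - s \<le> 3 powr s * jp k powr - s"
    by (simp add: powr_minus divide_simps)
  then have "X * jp l powr - s \<le> X * (3 powr s * jp k powr - s)"
    using assms by (intro mult_left_mono) (auto simp: sob_le_def)
  then show ?thesis using sob_le_point(2)[OF assms(1), of l] by linarith
qed

lemma jp_third: "jp k \<le> 3 * jp l \<or> jp k \<le> 3 * jp m \<or> jp k \<le> 3 * jp (k - l - m)"
  using jp_add[of l "k - l"] jp_add[of m "k - l - m"] by (smt (verit) add_diff_cancel_left' diff_add_cancel add.commute)

text \<open>
  As \<open>k = l + m + (k - l - m)\<close>, one of the three frequencies is comparable to \<open>k\<close> or larger;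
  it is estimated pointwise and the kernel is summed over the other two.
\<close>

lemma ker_split:
  assumes "\<And>l. jp k \<le> 3 * jp l \<Longrightarrow> cmod (x l) \<le> A" "\<And>l. jp k \<le> 3 * jp l \<Longrightarrow> cmod (y l) \<le> B"
    "\<And>l. jp k \<le> 3 * jp l \<Longrightarrow> cmod (z l) \<le> D" and nn: "0 \<le> A" "0 \<le> B" "0 \<le> D"
    and s: "sum_le (\<lambda>(l, m). ker k l m * (cmod (y l) * cmod (z m))) A'"
      "sum_le (\<lambda>(l, m). ker k l m * (cmod (x l) * cmod (z m))) B'"
      "sum_le (\<lambda>(l, m). ker k l m * (cmod (x l) * cmod (y m))) D'"
  shows "sum_le (\<lambda>(l, m). ker k l m * (cmod (x l) * cmod (y m) * cmod (z (k - l - m)))) (A * A' + B * B' + D * D')"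
proof -
  let ?a = "\<lambda>l m. ker k l m * (cmod (y m) * cmod (z (k - l - m)))"
  let ?b = "\<lambda>l m. ker k l m * (cmod (x l) * cmod (z (k - l - m)))"
  let ?d = "\<lambda>l m. ker k l m * (cmod (x l) * cmod (y m))"
  have a: "sum_le (\<lambda>(l, m). ?a l m) A'"
  proof -
    \<comment> \<open>The factors of \<open>?a\<close> stand at m and k - l - m, so
      \<open>s(1)\<close> is reached by exchanging l with m and rotating; the kernel is invariant
      under both.\<close>
    have "?a = (\<lambda>l m. ker k m (k - m - l) * (cmod (y m) * cmod (z (k - m - l))))"
    proof (intro ext)
      fix l m
      have "k - m - l = k - l - m" by simp
      then show "?a l m = ker k m (k - m - l) * (cmod (y m) * cmod (z (k - m - l)))"
        using ker_rotate[of k m l] ker_swap[of k l m] by metis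
    qed
    then show ?thesis using sum_le_swap[OF sum_le_rotate[OF s(1), of k]] by simp
  qed
  have b: "sum_le (\<lambda>(l, m). ?b l m) B'"
    using sum_le_rotate[OF s(2), of k] by (simp add: ker_rotate)
  have "sum_le (\<lambda>i. A * (case i of (l, m) \<Rightarrow> ?a l m) + B * (case i of (l, m) \<Rightarrow> ?b l m)
      + D * (case i of (l, m) \<Rightarrow> ?d l m)) (A * A' + B * B' + D * D')"
    by (intro sum_le_add sum_le_cmult a b s nn)
  then show ?thesis
  proof (rule sum_le_mono)
    fix i :: "int \<times> int"
    obtain l m where i: "i = (l, m)" by force
    let ?n = "k - l - m"
    have nn': "0 \<le> A * ?a l m" "0 \<le> B * ?b l m" "0 \<le> D * ?d l m" using nn by auto
    consider "jp k \<le> 3 * jp l" | "jp k \<le> 3 * jp m" | "jp k \<le> 3 * jp ?n" using jp_third by blast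
    then have "ker k l m * (cmod (x l) * cmod (y m) * cmod (z ?n)) \<le> A * ?a l m + B * ?b l m + D * ?d l m"
    proof cases
      case 1
      from mult_right_mono[OF assms(1)[OF this], of "?a l m"] show ?thesis using nn' by (simp add: mult_ac)
    next
      case 2
      from mult_right_mono[OF assms(2)[OF this], of "?b l m"] show ?thesis using nn' by (simp add: mult_ac)
    next
      case 3
      from mult_right_mono[OF assms(3)[OF this], of "?d l m"] show ?thesis using nn' by (simp add: mult_ac)
    qed
    then show "(case i of (l, m) \<Rightarrow> ker k l m * (cmod (x l) * cmod (y m) * cmod (z (k - l - m))))
      \<le> A * (case i of (l, m) \<Rightarrow> ?a l m) + B * (case i of (l, m) \<Rightarrow> ?b l m) + D * (case i of (l, m) \<Rightarrow> ?d l m)"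
      by (simp add: i)
  qed simp
qed

text \<open>The large frequency supplies \<open>jp k powr - s\<close> pointwise, and the other two
  factors supply \<open>1 / jp k\<close> through \<open>ker_h1_h1\<close>; 72 is three times
  24.\<close>

lemma ker_tri_smooth:
  assumes "sob_le s x X" "sob_le s y Y" "sob_le s z Z" "1 \<le> s"
  shows "sum_le (\<lambda>(l, m). ker k l m * (cmod (x l) * cmod (y m) * cmod (z (k - l - m))))
    (72 * 3 powr s * (X * Y * Z) * jp k powr (- s - 1))"
proof -
  have nn: "0 \<le> X" "0 \<le> Y" "0 \<le> Z" using assms by (auto simp: sob_le_def)
  have h: "sob_le 1 x X" "sob_le 1 y Y" "sob_le 1 z Z" using assms by (auto intro: sob_le_mono)
  let ?c = "3 powr s * jp k powr - s"
  have "jp k powr - s / jp k = jp k powr (- s - 1)"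
    by (simp add: powr_diff)
  then have "X * ?c * (24 * Y * Z / jp k) + Y * ?c * (24 * X * Z / jp k) + Z * ?c * (24 * X * Y / jp k)
     = 72 * 3 powr s * (X * Y * Z) * jp k powr (- s - 1)"
    by (simp flip: \<open>jp k powr - s / jp k = jp k powr (- s - 1)\<close>)
  moreover have "sum_le (\<lambda>(l, m). ker k l m * (cmod (x l) * cmod (y m) * cmod (z (k - l - m))))
      (X * ?c * (24 * Y * Z / jp k) + Y * ?c * (24 * X * Z / jp k) + Z * ?c * (24 * X * Y / jp k))"
    using assms nn by (intro ker_split ker_h1_h1 h) (auto intro: sob_le_point_large)
  ultimately show ?thesis by simp
qed

text \<open>One factor has a derivative less. If it carries the large frequency, it loses one power
  of \<open>jp k\<close>, which \<open>ker_h1_h1\<close> restores; otherwise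
  \<open>ker_l2_h1\<close> applies, without gain.\<close>

lemma ker_tri_rough:
  assumes "sob_le (s - 1) x X" "sob_le s y Y" "sob_le s z Z" "1 \<le> s"
  shows "sum_le (\<lambda>(l, m). ker k l m * (cmod (x l) * cmod (y m) * cmod (z (k - l - m))))
    (48 * 3 powr s * (X * Y * Z) * jp k powr - s)"
proof -
  have nn: "0 \<le> X" "0 \<le> Y" "0 \<le> Z" using assms by (auto simp: sob_le_def)
  have h: "sob_le 0 x X" "sob_le 1 y Y" "sob_le 1 z Z" using assms by (auto intro: sob_le_mono)
  let ?c = "3 powr s * jp k powr - s" and ?d = "3 powr (s - 1) * jp k powr - (s - 1)"
  have x: "cmod (x l) \<le> X * ?d" if "jp k \<le> 3 * jp l" for l
    using assms(1) _ that by (rule sob_le_point_large) (use assms(4) in simp)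
  have 1: "jp k powr - (s - 1) / jp k = jp k powr - s"
    by (simp add: powr_diff powr_minus field_simps)
  have 2: "3 powr (s - 1) = 3 powr s / (3::real)" by (simp add: powr_diff)
  have "?d / jp k = 3 powr (s - 1) * (jp k powr - (s - 1) / jp k)" by simp
  then have d: "?d / jp k = ?c / 3" unfolding 1 2 by simp
  have "X * e * (24 * Y * Z / j) = 24 * (X * Y * Z) * (e / j)" for e j :: real by simp
  from this[of ?d "jp k", unfolded d]
  have "X * ?d * (24 * Y * Z / jp k) + Y * ?c * (12 * X * Z) + Z * ?c * (12 * X * Y)
     = 32 * (X * Y * Z) * ?c" by algebra
  \<comment> \<open>The three cases add up to 24 / 3 + 12 + 12 = 32; the constant is rounded
    up.\<close>
  also have "\<dots> \<le> 48 * (X * Y * Z) * ?c" using nn by (intro mult_right_mono) auto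
  finally have "X * ?d * (24 * Y * Z / jp k) + Y * ?c * (12 * X * Z) + Z * ?c * (12 * X * Y)
     \<le> 48 * 3 powr s * (X * Y * Z) * jp k powr - s" by (simp only: mult_ac)
  moreover have "sum_le (\<lambda>(l, m). ker k l m * (cmod (x l) * cmod (y m) * cmod (z (k - l - m))))
      (X * ?d * (24 * Y * Z / jp k) + Y * ?c * (12 * X * Z) + Z * ?c * (12 * X * Y))"
    using assms nn by (intro ker_split ker_h1_h1 ker_l2_h1 h) (auto intro: x sob_le_point_large simp del: minus_diff_eq)
  ultimately show ?thesis using sum_le_mono by blast
qed

section \<open>Convergence and regularity of the trilinear sums\<close>

lemma tri_sum_le:
  assumes "sob_le 1 x X" "sob_le 1 y Y" "sob_le 1 z Z" "0 \<le> K"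
    "\<And>l m. cmod (w l m) \<le> K * jp (l + m)"
  shows "sum_le (\<lambda>(l, m). cmod (w l m * (x l * y m * z (k - l - m)))) (2 * K * (X * Y * Z))"
proof -
  have nn: "0 \<le> X" "0 \<le> Y" "0 \<le> Z" using assms by (auto simp: sob_le_def)
  have "sum_le (\<lambda>(n, l). cmod (z n) * ((jp l * cmod (x l)) * (jp (k - n - l) * cmod (y (k - n - l))))) (2 * Z * (X * Y))"
  proof (rule sum_le_pairI)
    fix n
    have "sum_le (\<lambda>l. (jp (k - n - l) * cmod (y (k - n - l)))\<^sup>2) (Y\<^sup>2)"
      using sum_le_reindex[OF sob_le_l2[OF assms(2)], of "\<lambda>l. k - n - l"] by (auto simp: inj_def)
    then show "sum_le (\<lambda>l. cmod (z n) * ((jp l * cmod (x l)) * (jp (k - n - l) * cmod (y (k - n - l))))) (cmod (z n) * (X * Y))"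
      using nn by (intro sum_le_cmult sum_le_Cauchy_Schwarz sob_le_l2 assms) auto
    show "sum_le (\<lambda>n. cmod (z n) * (X * Y)) (2 * Z * (X * Y))"
      using sum_le_cmult[OF sob_le_l1[OF assms(3)], of "X * Y"] nn by (simp add: mult_ac)
  qed auto
  from sum_le_cmult[OF this, of K]
  have "sum_le (\<lambda>(n, l). K * (cmod (z n) * ((jp l * cmod (x l)) * (jp (k - n - l) * cmod (y (k - n - l)))))) (2 * K * (X * Y * Z))"
    using assms(4) by (simp add: case_prod_unfold mult_ac)
  from sum_le_rotate[OF sum_le_swap[OF this], of k]
  have "sum_le (\<lambda>(l, m). K * (cmod (z (k - l - m)) * ((jp l * cmod (x l)) * (jp m * cmod (y m))))) (2 * K * (X * Y * Z))"
    by simp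
  then show ?thesis
  proof (rule sum_le_mono)
    fix i :: "int \<times> int"
    obtain l m where i: "i = (l, m)" by force
    \<comment> \<open>The derivative in the weight is distributed over two factors, which enter
      Cauchy-Schwarz with their \<open>H^1\<close> bounds; the third factor is absolutely
      summable.\<close>
    have "jp (l + m) \<le> jp l * jp m"
      using abs_triangle_ineq[of "real_of_int l" "real_of_int m"]
        mult_nonneg_nonneg[of "\<bar>real_of_int l\<bar>" "\<bar>real_of_int m\<bar>"]
      unfolding jp_def japanese_def of_int_add distrib_left distrib_right
      by linarith
    then have "cmod (w l m) \<le> K * (jp l * jp m)"
      using assms(4,5) by (meson mult_left_mono order_trans)
    from mult_right_mono[OF this, of "cmod (x l * y m * z (k - l - m))"]
    show "(case i of (l, m) \<Rightarrow> cmod (w l m * (x l * y m * z (k - l - m))))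
      \<le> (case i of (l, m) \<Rightarrow> K * (cmod (z (k - l - m)) * ((jp l * cmod (x l)) * (jp m * cmod (y m)))))"
      by (simp add: i norm_mult mult_ac)
  qed simp
qed

text \<open>Cauchy-Schwarz for \<open>f * sqrt (g * h)\<close> against \<open>sqrt (g * h)\<close>:
  the square of the convolution is at most \<open>B * D\<close> times the convolution of
  \<open>f^2\<close>, \<open>g\<close> and \<open>h\<close>, which is summable. The bounds
  \<open>N\<close> stand in for the infinite sums, so that they can be added inside
  \<open>sum_le\<close>.\<close>

lemma Young_l2_l1_l1:
  fixes f g h :: "int \<Rightarrow> real"
  assumes f: "sum_le (\<lambda>l. (f l)\<^sup>2) (A\<^sup>2)" and g: "sum_le g B" and h: "sum_le h D"
    and nn: "\<And>l. 0 \<le> f l" "\<And>l. 0 \<le> g l" "\<And>l. 0 \<le> h l" "0 \<le> A"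
  obtains N where "\<And>k. 0 \<le> N k" "\<And>k. sum_le (\<lambda>(l, m). f l * g m * h (k - l - m)) (N k)"
    "sum_le (\<lambda>k. (N k)\<^sup>2) ((A * B * D)\<^sup>2)"
proof -
  have BD: "0 \<le> B" "0 \<le> D" using g h by (auto intro: sum_le_nonneg)
  let ?t = "\<lambda>k (l, m). (f l)\<^sup>2 * g m * h (k - l - m)"
  have "sum_le (\<lambda>((l, m), n). (f l)\<^sup>2 * g m * h n) (A\<^sup>2 * B * D)"
    using sum_le_prod[OF sum_le_prod[OF f g] h] nn by (auto simp: case_prod_unfold)
  from sum_le_reindex[OF this, of "\<lambda>(k, (l, m)). ((l, m), k - l - m)"]
  have t: "sum_le (\<lambda>(k, i). ?t k i) (A\<^sup>2 * B * D)"
    by (auto simp: inj_def case_prod_unfold prod_eq_iff)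
  define P where "P = (\<lambda>k. \<Sum>\<^sub>\<infinity>i. ?t k i)"
  have P: "sum_le P (A\<^sup>2 * B * D)" unfolding P_def
    by (rule sum_le_infsum[OF _ t]) (use nn in auto)
  have tk: "sum_le (?t k) (P k)" for k unfolding P_def
  proof (rule infsum_upper)
    show "sum_le (?t k) (A\<^sup>2 * B * D)"
      using sum_le_reindex[OF t, of "Pair k"] by (auto simp: inj_def)
  qed (use nn in auto)
  then have Pnn: "0 \<le> P k" for k by (rule sum_le_nonneg)
  define N where "N = (\<lambda>k. sqrt (P k) * sqrt (B * D))"
  show thesis
  proof
    show "0 \<le> N k" for k using Pnn BD by (simp add: N_def)
    show "sum_le (\<lambda>(l, m). f l * g m * h (k - l - m)) (N k)" for k
    proof -
      let ?u = "\<lambda>(l, m). f l * sqrt (g m * h (k - l - m))" and ?v = "\<lambda>(l, m). sqrt (g m * h (k - l - m))"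
      have gh: "sum_le (\<lambda>(m, n). g m * h n) (B * D)" using g h nn by (intro sum_le_prod)
      have "sum_le (\<lambda>(l, m). g m * h (k - l - m)) (B * D)"
        using sum_le_reindex[OF gh, of "\<lambda>(l, m). (m, k - l - m)"]
        by (auto simp: inj_def case_prod_unfold prod_eq_iff)
      moreover have "(\<lambda>i. (?v i)\<^sup>2) = (\<lambda>(l, m). g m * h (k - l - m))" using nn by auto
      ultimately have v: "sum_le (\<lambda>i. (?v i)\<^sup>2) ((sqrt (B * D))\<^sup>2)" using BD by simp
      have "(\<lambda>i. (?u i)\<^sup>2) = ?t k" using nn by (auto simp: power_mult_distrib)
      then have u: "sum_le (\<lambda>i. (?u i)\<^sup>2) ((sqrt (P k))\<^sup>2)" using tk[of k] Pnn by simp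
      have "sum_le (\<lambda>i. ?u i * ?v i) (N k)" unfolding N_def
        by (rule sum_le_Cauchy_Schwarz[OF u v]) (use Pnn BD in auto)
      then show ?thesis
      proof (rule sum_le_mono)
        fix i :: "int \<times> int"
        obtain l m where i: "i = (l, m)" by force
        have "sqrt (g m * h (k - l - m)) * sqrt (g m * h (k - l - m)) = g m * h (k - l - m)"
          using nn by simp
        then show "(case i of (l, m) \<Rightarrow> f l * g m * h (k - l - m)) \<le> ?u i * ?v i"
          by (simp add: i mult.assoc)
      qed simp
    qed
    have "(\<lambda>k. (N k)\<^sup>2) = (\<lambda>k. B * D * P k)" using Pnn BD by (auto simp: N_def power_mult_distrib)
    then show "sum_le (\<lambda>k. (N k)\<^sup>2) ((A * B * D)\<^sup>2)"
      using sum_le_cmult[OF P, of "B * D"] BD by (simp add: power2_eq_square mult_ac)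
  qed
qed

text \<open>Every bracket on the left is at most three times the largest of the three frequency
  brackets. The order s - 1 of the target norm and the one derivative in the weight make s together,
  and \<open>1 \<le> s\<close> keeps the power monotone.\<close>

lemma tri_weight_bound:
  assumes "1 \<le> s"
  shows "jp k powr (s - 1) * (jp k + jp (l + m)) \<le> 2 * 3 powr s * (jp l powr s + jp m powr s + jp (k - l - m) powr s)"
proof -
  define M where "M = max (jp l) (max (jp m) (jp (k - l - m)))"
  have M: "jp l \<le> M" "jp m \<le> M" "jp (k - l - m) \<le> M" "0 < M"
    by (auto simp: M_def less_max_iff_disj)
  have k: "jp k \<le> 3 * M"
    using jp_third[of k l m] M by linarith
  have lm: "jp (l + m) \<le> 3 * M"
    using jp_add[of l m] M by linarith
  have "jp k powr (s - 1) * (jp k + jp (l + m)) \<le> (3 * M) powr (s - 1) * (2 * (3 * M))"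
    using k lm assms by (intro mult_mono powr_mono2) auto
  also have "\<dots> = 2 * ((3 * M) powr (s - 1) * (3 * M) powr 1)" using M by simp
  also have "\<dots> = 2 * (3 * M) powr s" by (subst powr_add[symmetric]) simp
  also have "\<dots> = 2 * 3 powr s * M powr s" using M by (simp add: powr_mult)
  also have "M powr s \<le> jp l powr s + jp m powr s + jp (k - l - m) powr s"
    by (auto simp: M_def max_def intro: add_nonneg_nonneg)
  finally show ?thesis by simp
qed

lemma sob_le_tri:
  assumes x: "sob_le s x X" and y: "sob_le s y Y" and z: "sob_le s z Z" and "1 \<le> s" "0 \<le> K"
    and w: "\<And>k l m. cmod (w k l m) \<le> K * (jp k + jp (l + m))"
  shows "sob_le (s - 1) (\<lambda>k. tri k (w k) x y z) (24 * 3 powr s * K * (X * Y * Z))"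
proof -
  have nn: "0 \<le> X" "0 \<le> Y" "0 \<le> Z" using x y z by (auto simp: sob_le_def)
  have h: "sob_le 1 x X" "sob_le 1 y Y" "sob_le 1 z Z" using assms by (auto intro: sob_le_mono)
  have l2: "sum_le (\<lambda>l. (jp l powr s * cmod (x l))\<^sup>2) (X\<^sup>2)" "sum_le (\<lambda>l. (jp l powr s * cmod (y l))\<^sup>2) (Y\<^sup>2)"
    "sum_le (\<lambda>l. (jp l powr s * cmod (z l))\<^sup>2) (Z\<^sup>2)" using x y z by (auto simp: sob_le_def)
  \<comment> \<open>Each of \<open>N1\<close>, \<open>N2\<close>, \<open>N3\<close> puts the weight
    of order s on another factor, which takes the \<open>l^2\<close> slot of Young's inequality,
    while the other two are summable.\<close>
  obtain N1 where N1: "\<And>k. 0 \<le> N1 k" "\<And>k. sum_le (\<lambda>(l, m). jp l powr s * cmod (x l) * cmod (y m) * cmod (z (k - l - m))) (N1 k)"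
    "sum_le (\<lambda>k. (N1 k)\<^sup>2) ((X * (2 * Y) * (2 * Z))\<^sup>2)"
    by (rule Young_l2_l1_l1[OF l2(1) sob_le_l1[OF h(2)] sob_le_l1[OF h(3)]]) (use nn in auto)
  obtain N2 where N2: "\<And>k. 0 \<le> N2 k" "\<And>k. sum_le (\<lambda>(m, l). jp m powr s * cmod (y m) * cmod (x l) * cmod (z (k - m - l))) (N2 k)"
    "sum_le (\<lambda>k. (N2 k)\<^sup>2) ((Y * (2 * X) * (2 * Z))\<^sup>2)"
    by (rule Young_l2_l1_l1[OF l2(2) sob_le_l1[OF h(1)] sob_le_l1[OF h(3)]]) (use nn in auto)
  obtain N3 where N3: "\<And>k. 0 \<le> N3 k" "\<And>k. sum_le (\<lambda>(n, l). jp n powr s * cmod (z n) * cmod (x l) * cmod (y (k - n - l))) (N3 k)"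
    "sum_le (\<lambda>k. (N3 k)\<^sup>2) ((Z * (2 * X) * (2 * Y))\<^sup>2)"
    by (rule Young_l2_l1_l1[OF l2(3) sob_le_l1[OF h(1)] sob_le_l1[OF h(2)]]) (use nn in auto)
  define c where "c = 2 * 3 powr s * K"
  have c: "0 \<le> c" using assms by (simp add: c_def)
  have tri: "jp k powr (s - 1) * cmod (tri k (w k) x y z) \<le> c * (N1 k + N2 k + N3 k)" for k
  proof -
    let ?a = "\<lambda>l m. jp l powr s * cmod (x l) * cmod (y m) * cmod (z (k - l - m))"
    let ?b = "\<lambda>l m. jp m powr s * cmod (y m) * cmod (x l) * cmod (z (k - l - m))"
    let ?d = "\<lambda>l m. jp (k - l - m) powr s * cmod (z (k - l - m)) * cmod (x l) * cmod (y m)"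
    have b: "sum_le (\<lambda>(l, m). ?b l m) (N2 k)"
      using sum_le_swap[OF N2(2)[of k]] by (simp add: diff_diff_eq add.commute)
    have "sum_le (\<lambda>(l, m). ?d l (m)) (N3 k)"
      using sum_le_rotate[OF sum_le_swap[OF N3(2)[of k]], of k] by simp
    from sum_le_cmult[OF sum_le_add[OF sum_le_add[OF N1(2)[of k] b] this] c]
    have *: "sum_le (\<lambda>i. cmod (case i of (l, m) \<Rightarrow> of_real (jp k powr (s - 1)) * (w k l m * (x l * y m * z (k - l - m))))) (c * (N1 k + N2 k + N3 k))"
    proof (rule sum_le_mono)
      fix i :: "int \<times> int"
      obtain l m where i: "i = (l, m)" by force
      let ?n = "k - l - m"
      let ?xyz = "cmod (x l) * cmod (y m) * cmod (z ?n)"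
      have "cmod (case i of (l, m) \<Rightarrow> of_real (jp k powr (s - 1)) * (w k l m * (x l * y m * z (k - l - m))))
         = jp k powr (s - 1) * cmod (w k l m) * ?xyz" by (simp add: i norm_mult)
      also have "\<dots> \<le> jp k powr (s - 1) * (K * (jp k + jp (l + m))) * ?xyz"
        by (intro mult_right_mono mult_left_mono w) auto
      also have "\<dots> = K * (jp k powr (s - 1) * (jp k + jp (l + m))) * ?xyz" by simp
      also have "\<dots> \<le> K * (2 * 3 powr s * (jp l powr s + jp m powr s + jp ?n powr s)) * ?xyz"
        using tri_weight_bound[OF \<open>1 \<le> s\<close>] \<open>0 \<le> K\<close> by (intro mult_right_mono mult_left_mono) auto
      also have "\<dots> = c * (?a l m + ?b l m + ?d l m)" by (simp add: c_def algebra_simps)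
      finally show "cmod (case i of (l, m) \<Rightarrow> of_real (jp k powr (s - 1)) * (w k l m * (x l * y m * z (k - l - m))))
         \<le> c * ((case i of (l, m) \<Rightarrow> ?a l m) + (case i of (l, m) \<Rightarrow> ?b l m) + (case i of (l, m) \<Rightarrow> ?d l m))"
        by (simp add: i)
    qed simp
    have "(\<Sum>\<^sub>\<infinity>i. case i of (l, m) \<Rightarrow> of_real (jp k powr (s - 1)) * (w k l m * (x l * y m * z (k - l - m))))
       = of_real (jp k powr (s - 1)) * tri k (w k) x y z"
      unfolding tri_def by (subst infsum_cmult_right'[symmetric]) (simp add: case_prod_unfold)
    with sum_le_summable(3)[OF *, of UNIV] show ?thesis by (simp add: norm_mult)
  qed
  \<comment> \<open>The square of a sum of three is at most three times the sum of the squares, and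
    each Young bound is \<open>4 * (X * Y * Z)\<close>; the total is 3 * 3 * 16 = 12^2.\<close>
  have "sum_le (\<lambda>k. c\<^sup>2 * 3 * ((N1 k)\<^sup>2 + (N2 k)\<^sup>2 + (N3 k)\<^sup>2))
     (c\<^sup>2 * 3 * ((X * (2 * Y) * (2 * Z))\<^sup>2 + (Y * (2 * X) * (2 * Z))\<^sup>2 + (Z * (2 * X) * (2 * Y))\<^sup>2))"
    by (intro sum_le_cmult sum_le_add N1 N2 N3) simp
  then have "sum_le (\<lambda>k. (jp k powr (s - 1) * cmod (tri k (w k) x y z))\<^sup>2) ((12 * c * (X * Y * Z))\<^sup>2)"
  proof (rule sum_le_mono)
    fix k
    have "(jp k powr (s - 1) * cmod (tri k (w k) x y z))\<^sup>2 \<le> (c * (N1 k + N2 k + N3 k))\<^sup>2"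
      using tri[of k] by (intro power_mono) auto
    also have "\<dots> = c\<^sup>2 * (N1 k + N2 k + N3 k)\<^sup>2" by (simp add: power_mult_distrib)
    also have "(N1 k + N2 k + N3 k)\<^sup>2 \<le> 3 * ((N1 k)\<^sup>2 + (N2 k)\<^sup>2 + (N3 k)\<^sup>2)"
      using zero_le_power2[of "N1 k - N2 k"] zero_le_power2[of "N2 k - N3 k"] zero_le_power2[of "N1 k - N3 k"]
      by (simp add: power2_eq_square algebra_simps)
    finally show "(jp k powr (s - 1) * cmod (tri k (w k) x y z))\<^sup>2 \<le> c\<^sup>2 * 3 * ((N1 k)\<^sup>2 + (N2 k)\<^sup>2 + (N3 k)\<^sup>2)"
      by (simp add: mult_left_mono mult.assoc)
  qed (simp add: power2_eq_square algebra_simps)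
  then show ?thesis using nn assms(5) by (simp add: sob_le_def c_def mult_ac)
qed

text \<open>Telescoping: the three arguments are exchanged one at a time, at a cost of
  \<open>2 * K * X^2 * e\<close> each.\<close>

lemma tri_diff_bound:
  assumes x: "sob_le 1 x X" "sob_le 1 x' X" "sob_le 1 (\<lambda>j. x j - x' j) e"
    and y: "sob_le 1 y X" "sob_le 1 y' X" "sob_le 1 (\<lambda>j. y j - y' j) e"
    and z: "sob_le 1 z X" "sob_le 1 z' X" "sob_le 1 (\<lambda>j. z j - z' j) e"
    and w: "0 \<le> K" "\<And>l m. cmod (w l m) \<le> K * jp (l + m)"
  shows "cmod (tri k w x y z - tri k w x' y' z') \<le> 6 * K * X\<^sup>2 * e"
proof -
  let ?t = "\<lambda>x y z i. case i of (l, m) \<Rightarrow> w l m * (x l * y m * z (k - l - m))"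
  have 1: "sum_le (\<lambda>i. norm (?t x y z i)) (2 * K * (A * B * D))" if "sob_le 1 x A" "sob_le 1 y B" "sob_le 1 z D" for x y z A B D
    using tri_sum_le[OF that w, of k] by (simp add: case_prod_unfold)
  have s: "?t x y z summable_on UNIV" if "sob_le 1 x A" "sob_le 1 y B" "sob_le 1 z D" for x y z A B D
    using sum_le_summable(1)[OF 1[OF that]] .
  have b: "cmod (tri k w x y z) \<le> 2 * K * (A * B * D)" if "sob_le 1 x A" "sob_le 1 y B" "sob_le 1 z D" for x y z A B D
    using sum_le_summable(3)[OF 1[OF that], of UNIV] by (simp add: tri_def)
  have "tri k w x y z = tri k w (\<lambda>j. x j - x' j) y z + tri k w x' y z"
    unfolding tri_def
    by (subst infsum_add[symmetric, OF s[OF x(3) y(1) z(1)] s[OF x(2) y(1) z(1)]])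
       (auto intro!: infsum_cong simp: algebra_simps)
  moreover have "tri k w x' y z = tri k w x' (\<lambda>j. y j - y' j) z + tri k w x' y' z"
    unfolding tri_def
    by (subst infsum_add[symmetric, OF s[OF x(2) y(3) z(1)] s[OF x(2) y(2) z(1)]])
       (auto intro!: infsum_cong simp: algebra_simps)
  moreover have "tri k w x' y' z = tri k w x' y' (\<lambda>j. z j - z' j) + tri k w x' y' z'"
    unfolding tri_def
    by (subst infsum_add[symmetric, OF s[OF x(2) y(2) z(3)] s[OF x(2) y(2) z(2)]])
       (auto intro!: infsum_cong simp: algebra_simps)
  ultimately have "tri k w x y z - tri k w x' y' z' = tri k w (\<lambda>j. x j - x' j) y z + tri k w x' (\<lambda>j. y j - y' j) z
      + tri k w x' y' (\<lambda>j. z j - z' j)"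
    by simp
  also have "cmod (\<dots>) \<le> 2 * K * (e * X * X) + 2 * K * (X * e * X) + 2 * K * (X * X * e)"
    by (intro norm_triangle_le add_mono b x y z) 
  finally show ?thesis by (simp add: power2_eq_square algebra_simps)
qed

section \<open>The resonant structure\<close>

text \<open>The Fourier coefficients of the complex conjugate function, see
  \<open>cnj_series\<close>.\<close>

definition refl_cnj :: "(int \<Rightarrow> complex) \<Rightarrow> int \<Rightarrow> complex" where
  "refl_cnj x = (\<lambda>j. cnj (x (- j)))"

definition unit_seq :: "int \<Rightarrow> int \<Rightarrow> complex" where
  "unit_seq k = (\<lambda>j. if j = k then 1 else 0)"

lemma sob_le_refl_cnj: "sob_le s x X \<Longrightarrow> sob_le s (refl_cnj x) X"
  unfolding sob_le_def refl_cnj_def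
  using sum_le_reindex[of "\<lambda>j. (jp j powr s * cmod (x j))\<^sup>2" "X\<^sup>2" uminus] by auto

lemma sob_le_upd: "sob_le s x X \<Longrightarrow> sob_le s (x(k := 0)) X"
  unfolding sob_le_def by (auto elim!: sum_le_mono)

lemma sob_le_unit_seq: "sob_le 1 (unit_seq k) (jp k)"
  unfolding sob_le_def
proof (intro conjI)
  show "sum_le (\<lambda>j. (jp j powr 1 * cmod (unit_seq k j))\<^sup>2) ((jp k)\<^sup>2)"
    unfolding sum_le_def
  proof (intro allI impI)
    fix F :: "int set" assume F: "finite F"
    have "(\<Sum>j\<in>F. (jp j powr 1 * cmod (unit_seq k j))\<^sup>2) = (\<Sum>j\<in>F. if j = k then (jp k)\<^sup>2 else 0)"
      by (intro sum.cong) (auto simp: unit_seq_def)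
    also have "\<dots> \<le> (jp k)\<^sup>2" using F by simp
    finally show "(\<Sum>j\<in>F. (jp j powr 1 * cmod (unit_seq k j))\<^sup>2) \<le> (jp k)\<^sup>2" .
  qed
qed simp

text \<open>Continuity into \<open>H^1\<close> expressed by bounds. A uniform bound is included
  because \<open>continuous_on_tri\<close> takes one constant for the whole of
  \<open>I\<close>.\<close>

definition h1_continuous_on :: "real set \<Rightarrow> (real \<Rightarrow> int \<Rightarrow> complex) \<Rightarrow> bool" where
  "h1_continuous_on I x \<longleftrightarrow> (\<exists>X. \<forall>t\<in>I. sob_le 1 (x t) X) \<and>
     (\<forall>t\<in>I. \<forall>e>0. \<exists>d>0. \<forall>\<tau>\<in>I. \<bar>\<tau> - t\<bar> < d \<longrightarrow> sob_le 1 (\<lambda>j. x \<tau> j - x t j) e)"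

lemma sob_le_0: "0 \<le> X \<Longrightarrow> sob_le s (\<lambda>j. 0) X"
  by (auto simp: sob_le_def sum_le_def)

lemma h1_continuous_on_const: "sob_le 1 x X \<Longrightarrow> h1_continuous_on I (\<lambda>t. x)"
  unfolding h1_continuous_on_def
  by (intro conjI exI[of _ X] ballI allI impI exI[of _ "1::real"]) (auto intro!: sob_le_0)

lemma h1_continuous_on_refl_cnj:
  assumes "h1_continuous_on I x" shows "h1_continuous_on I (\<lambda>t. refl_cnj (x t))"
proof -
  have "sob_le 1 (\<lambda>j. refl_cnj x j - refl_cnj y j) e" if "sob_le 1 (\<lambda>j. x j - y j) e" for x y e
    using sob_le_refl_cnj[OF that] by (simp add: refl_cnj_def)
  then show ?thesis using assms unfolding h1_continuous_on_def by (meson sob_le_refl_cnj)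
qed

lemma h1_continuous_on_upd:
  assumes "h1_continuous_on I x" shows "h1_continuous_on I (\<lambda>t. (x t)(k := 0))"
proof -
  have "sob_le 1 (\<lambda>j. (x(k := 0)) j - (y(k := 0)) j) e" if "sob_le 1 (\<lambda>j. x j - y j) e" for x y e
  proof -
    have "(\<lambda>j. (x(k := 0)) j - (y(k := 0)) j) = (\<lambda>j. x j - y j)(k := 0)" by auto
    then show ?thesis using sob_le_upd[OF that] by metis
  qed
  then show ?thesis using assms unfolding h1_continuous_on_def by (meson sob_le_upd)
qed

lemma h1_continuous_on_component:
  assumes "h1_continuous_on I x" shows "continuous_on I (\<lambda>t. x t j)"
proof (rule continuous_onI)
  fix t e assume "t \<in> I" "0 < (e::real)"
  then obtain d where d: "d > 0" "\<And>\<tau>. \<tau> \<in> I \<Longrightarrow> \<bar>\<tau> - t\<bar> < d \<Longrightarrow> sob_le 1 (\<lambda>j. x \<tau> j - x t j) e"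
    using assms unfolding h1_continuous_on_def by meson
  have "cmod (x \<tau> j - x t j) \<le> e" if "sob_le 1 (\<lambda>j. x \<tau> j - x t j) e" for \<tau>
  proof -
    have "1 * cmod (x \<tau> j - x t j) \<le> jp j * cmod (x \<tau> j - x t j)" by (intro mult_right_mono) auto
    then show ?thesis using sob_le_point(1)[OF that, of j] by simp
  qed
  then show "\<exists>d>0. \<forall>\<tau>\<in>I. dist \<tau> t < d \<longrightarrow> dist (x \<tau> j) (x t j) \<le> e"
    using d by (auto simp: dist_norm)
qed

lemma continuous_on_tri:
  assumes x: "h1_continuous_on I x" and y: "h1_continuous_on I y" and z: "h1_continuous_on I z"
    and w: "0 \<le> K" "\<And>l m. cmod (w l m) \<le> K * jp (l + m)"
  shows "continuous_on I (\<lambda>t. tri k w (x t) (y t) (z t))"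
proof (rule continuous_onI)
  fix t e assume t: "t \<in> I" and e: "0 < (e::real)"
  obtain X Y Z where "\<And>t. t \<in> I \<Longrightarrow> sob_le 1 (x t) X" "\<And>t. t \<in> I \<Longrightarrow> sob_le 1 (y t) Y" "\<And>t. t \<in> I \<Longrightarrow> sob_le 1 (z t) Z"
    using x y z unfolding h1_continuous_on_def by metis
  then obtain M where M: "\<And>t. t \<in> I \<Longrightarrow> sob_le 1 (x t) M" "\<And>t. t \<in> I \<Longrightarrow> sob_le 1 (y t) M" "\<And>t. t \<in> I \<Longrightarrow> sob_le 1 (z t) M"
    using sob_le_mono[OF _ order_refl, of _ _ _ "max X (max Y Z)"] by (metis max.cobounded1 max.cobounded2 max.coboundedI2)
  define e' where "e' = e / (6 * K * M\<^sup>2 + 1)"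
  have pos: "6 * K * M\<^sup>2 + 1 > 0" using w(1) by (simp add: add_nonneg_pos)
  then have e': "e' > 0" using e by (simp add: e'_def)
  obtain d1 where d1: "d1 > 0" "\<And>\<tau>. \<tau> \<in> I \<Longrightarrow> \<bar>\<tau> - t\<bar> < d1 \<Longrightarrow> sob_le 1 (\<lambda>j. x \<tau> j - x t j) e'"
    using x t e' unfolding h1_continuous_on_def by meson
  obtain d2 where d2: "d2 > 0" "\<And>\<tau>. \<tau> \<in> I \<Longrightarrow> \<bar>\<tau> - t\<bar> < d2 \<Longrightarrow> sob_le 1 (\<lambda>j. y \<tau> j - y t j) e'"
    using y t e' unfolding h1_continuous_on_def by meson
  obtain d3 where d3: "d3 > 0" "\<And>\<tau>. \<tau> \<in> I \<Longrightarrow> \<bar>\<tau> - t\<bar> < d3 \<Longrightarrow> sob_le 1 (\<lambda>j. z \<tau> j - z t j) e'"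
    using z t e' unfolding h1_continuous_on_def by meson
  show "\<exists>d>0. \<forall>\<tau>\<in>I. dist \<tau> t < d \<longrightarrow> dist (tri k w (x \<tau>) (y \<tau>) (z \<tau>)) (tri k w (x t) (y t) (z t)) \<le> e"
  proof (intro exI[of _ "min d1 (min d2 d3)"] conjI ballI impI)
    fix \<tau> assume \<tau>: "\<tau> \<in> I" "dist \<tau> t < min d1 (min d2 d3)"
    have "cmod (tri k w (x \<tau>) (y \<tau>) (z \<tau>) - tri k w (x t) (y t) (z t)) \<le> 6 * K * M\<^sup>2 * e'"
      using \<tau> t d1 d2 d3 by (intro tri_diff_bound M w) (auto simp: dist_norm)
    also have "\<dots> \<le> (6 * K * M\<^sup>2 + 1) * e'" using e' by (intro mult_right_mono) auto
    also have "\<dots> = e" using pos by (simp add: e'_def)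
    finally show "dist (tri k w (x \<tau>) (y \<tau>) (z \<tau>)) (tri k w (x t) (y t) (z t)) \<le> e"
      by (simp add: dist_norm)
  qed (use d1 d2 d3 in auto)
qed

lemma tri_unit_left:
  "tri k w (unit_seq k) y z = (\<Sum>\<^sub>\<infinity>m. w k m * (y m * z (- m)))"
proof -
  have "tri k w (unit_seq k) y z = (\<Sum>\<^sub>\<infinity>(l, m)\<in>range (Pair k). w l m * (unit_seq k l * y m * z (k - l - m)))"
    unfolding tri_def by (rule infsum_cong_neutral) (auto simp: unit_seq_def)
  also have "\<dots> = (\<Sum>\<^sub>\<infinity>m. w k m * (y m * z (- m)))"
    by (subst infsum_reindex) (auto simp: inj_def unit_seq_def o_def)
  finally show ?thesis .
qed

lemma tri_unit_right:
  "tri k w x y (unit_seq k) = (\<Sum>\<^sub>\<infinity>l. w l (- l) * (x l * y (- l)))"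
proof -
  have "tri k w x y (unit_seq k) = (\<Sum>\<^sub>\<infinity>(l, m)\<in>range (\<lambda>l. (l, - l)). w l m * (x l * y m * unit_seq k (k - l - m)))"
    unfolding tri_def by (rule infsum_cong_neutral) (auto simp: unit_seq_def image_iff)
  also have "\<dots> = (\<Sum>\<^sub>\<infinity>l. w l (- l) * (x l * y (- l)))"
    by (subst infsum_reindex) (auto simp: inj_def unit_seq_def o_def)
  finally show ?thesis .
qed

text \<open>In the first and third slots \<open>x\<close> is split into its component at k and
  \<open>x(k := 0)\<close>. The first resonant term keeps the full \<open>x\<close> in its third
  slot, so that the summand with both frequencies equal to k is counted once.\<close>

lemma tri_resonant_split:
  assumes h: "sob_le 1 x X" "sob_le 1 y Y" "0 \<le> K" "\<And>l m. cmod (w l m) \<le> K * jp (l + m)"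
  shows "tri k w x y x = x k * (tri k w (unit_seq k) y x + tri k w (x(k := 0)) y (unit_seq k))
     + tri k w (x(k := 0)) y (x(k := 0))"
proof -
  let ?t = "\<lambda>x y z i. case i of (l, m) \<Rightarrow> w l m * (x l * y m * z (k - l - m))"
  have s: "?t x y z summable_on UNIV" if "sob_le 1 x A" "sob_le 1 y B" "sob_le 1 z D" for x y z A B D
    using sum_le_summable(1)[OF tri_sum_le[OF that h(3,4), of k, unfolded case_prod_unfold]]
    by (simp add: case_prod_unfold)
  have lin: "(\<Sum>\<^sub>\<infinity>i. x k * f i + x k * g i + h i) = x k * (\<Sum>\<^sub>\<infinity>i. f i) + x k * (\<Sum>\<^sub>\<infinity>i. g i) + (\<Sum>\<^sub>\<infinity>i. h i)"
    if "f summable_on UNIV" "g summable_on UNIV" "h summable_on UNIV" for f g h :: "int \<times> int \<Rightarrow> complex"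
    using that by (simp add: infsum_add infsum_cmult_right' summable_on_cmult_right summable_on_add)
  let ?b = "x(k := 0)"
  note b = sob_le_upd[OF h(1), of k]
  note s1 = s[OF sob_le_unit_seq h(2) h(1)] and s2 = s[OF b h(2) sob_le_unit_seq] and s3 = s[OF b h(2) b]
  have "tri k w x y x = (\<Sum>\<^sub>\<infinity>i. x k * ?t (unit_seq k) y x i + x k * ?t ?b y (unit_seq k) i + ?t ?b y ?b i)"
    unfolding tri_def by (intro infsum_cong) (auto simp: unit_seq_def algebra_simps)
  also have "\<dots> = x k * (\<Sum>\<^sub>\<infinity>i. ?t (unit_seq k) y x i) + x k * (\<Sum>\<^sub>\<infinity>i. ?t ?b y (unit_seq k) i) + (\<Sum>\<^sub>\<infinity>i. ?t ?b y ?b i)"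
    by (rule lin[OF s1 s2 s3])
  finally show ?thesis by (simp add: tri_def algebra_simps)
qed

section \<open>Phase, weight and their quotient\<close>

definition dispersion :: "real \<Rightarrow> real \<Rightarrow> int \<Rightarrow> real" where
  "dispersion \<alpha>1 \<alpha>2 k = - (\<alpha>1 * of_int k ^ 3 + \<alpha>2 * of_int k ^ 2)"

text \<open>The three frequencies are \<open>l + m + (k - l - m) = k\<close>; the conjugated factor enters as
  \<open>refl_cnj x\<close>, so that \<open>m\<close> stands for minus its frequency and \<open>tri\<close> is symmetric.\<close>

definition weight :: "real \<Rightarrow> real \<Rightarrow> real \<Rightarrow> int \<Rightarrow> int \<Rightarrow> int \<Rightarrow> complex" where
  "weight \<gamma>1 \<gamma>2 \<Gamma> k l m = Complex (\<Gamma> * of_int (l + m)) (\<gamma>1 + \<gamma>2 * of_int k)"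

definition cubic :: "real \<Rightarrow> real \<Rightarrow> real \<Rightarrow> (int \<Rightarrow> complex) \<Rightarrow> int \<Rightarrow> complex" where
  "cubic \<gamma>1 \<gamma>2 \<Gamma> x k = of_real (1 / (2 * pi)) * tri k (weight \<gamma>1 \<gamma>2 \<Gamma> k) x (refl_cnj x) x"

lemma weight_bound: "cmod (weight \<gamma>1 \<gamma>2 \<Gamma> k l m) \<le> (\<bar>\<gamma>1\<bar> + \<bar>\<gamma>2\<bar> + \<bar>\<Gamma>\<bar>) * (jp k + jp (l + m))"
  (is "_ \<le> ?K * _")
proof -
  have "cmod (weight \<gamma>1 \<gamma>2 \<Gamma> k l m) \<le> \<bar>\<Gamma> * of_int (l + m)\<bar> + \<bar>\<gamma>1 + \<gamma>2 * of_int k\<bar>"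
    using cmod_le by (metis weight_def complex.sel)
  also have "\<dots> \<le> \<bar>\<Gamma>\<bar> * jp (l + m) + (\<bar>\<gamma>1\<bar> + \<bar>\<gamma>2\<bar>) * jp k"
  proof (intro add_mono)
    show "\<bar>\<Gamma> * of_int (l + m)\<bar> \<le> \<bar>\<Gamma>\<bar> * jp (l + m)"
      unfolding abs_mult by (intro mult_left_mono) (auto simp: jp_def japanese_def)
    have "\<bar>\<gamma>1 + \<gamma>2 * of_int k\<bar> \<le> \<bar>\<gamma>1\<bar> + \<bar>\<gamma>2\<bar> * \<bar>of_int k\<bar>" by (metis abs_mult abs_triangle_ineq)
    also have "\<dots> \<le> (\<bar>\<gamma>1\<bar> + \<bar>\<gamma>2\<bar>) * jp k" by (simp add: jp_def japanese_def algebra_simps)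
    finally show "\<bar>\<gamma>1 + \<gamma>2 * of_int k\<bar> \<le> (\<bar>\<gamma>1\<bar> + \<bar>\<gamma>2\<bar>) * jp k" .
  qed
  also have "\<dots> \<le> ?K * jp (l + m) + ?K * jp k"
    by (rule add_mono; rule mult_right_mono) auto
  finally show ?thesis by (simp add: algebra_simps)
qed

text \<open>For fixed k the factor \<open>jp k\<close> may go into the constant; this is the shape
  that \<open>tri_sum_le\<close> and \<open>continuous_on_tri\<close> require.\<close>

lemma weight_bound': "cmod (weight \<gamma>1 \<gamma>2 \<Gamma> k l m) \<le> (2 * (\<bar>\<gamma>1\<bar> + \<bar>\<gamma>2\<bar> + \<bar>\<Gamma>\<bar>) * jp k) * jp (l + m)"
  (is "_ \<le> (2 * ?K * _) * _")
proof -
  have "jp k \<le> jp k * jp (l + m)" "jp (l + m) \<le> jp k * jp (l + m)"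
    using mult_left_mono[of 1 "jp (l + m)" "jp k"] mult_right_mono[of 1 "jp k" "jp (l + m)"] by auto
  then have "jp k + jp (l + m) \<le> 2 * (jp k * jp (l + m))" by linarith
  then have "?K * (jp k + jp (l + m)) \<le> ?K * (2 * (jp k * jp (l + m)))"
    by (rule mult_left_mono) auto
  then show ?thesis using weight_bound[of \<gamma>1 \<gamma>2 \<Gamma> k l m] by (simp add: algebra_simps)
qed

text \<open>For purely cubic dispersion the phase is \<open>3 * \<alpha>1\<close> times the product
  of the three gaps k - l, l + m and k - m; the quadratic part only shifts the last factor.\<close>

lemma phase_factor:
  "dispersion \<alpha>1 \<alpha>2 l - dispersion \<alpha>1 \<alpha>2 (- m) + dispersion \<alpha>1 \<alpha>2 (k - l - m) - dispersion \<alpha>1 \<alpha>2 k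
   = of_int (k - l) * of_int (l + m) * (3 * \<alpha>1 * of_int (k - m) + 2 * \<alpha>2)"
  by (simp add: dispersion_def algebra_simps power2_eq_square power3_eq_cube)

text \<open>The expression is \<open>3 * \<alpha>1 * (n + \<theta>)\<close> with \<theta> not an
  integer: the distance \<eta> of \<theta> from the integers bounds it below for every n, and linear
  growth takes over for large n.\<close>

lemma nonresonant_lower_bound:
  assumes "\<alpha>1 \<noteq> 0" "2 * \<alpha>2 / (3 * \<alpha>1) \<notin> \<int>"
  obtains \<delta> where "\<delta> > 0" "\<And>n. \<delta> * jp n \<le> \<bar>3 * \<alpha>1 * of_int n + 2 * \<alpha>2\<bar>"
proof -
  define \<theta> where "\<theta> = 2 * \<alpha>2 / (3 * \<alpha>1)"
  define \<eta> where "\<eta> = min (frac \<theta>) (1 - frac \<theta>)"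
  have \<eta>: "\<eta> > 0" "\<eta> \<le> 1" using assms(2) frac_lt_1[of \<theta>] by (auto simp: \<eta>_def \<theta>_def min_def)
  have 1: "\<eta> \<le> \<bar>of_int n + \<theta>\<bar>" for n :: int
  proof (cases "n + \<lfloor>\<theta>\<rfloor> \<ge> 0")
    case True
    then have "real_of_int (n + \<lfloor>\<theta>\<rfloor>) \<ge> 0" by (simp only: of_int_0_le_iff)
    then show ?thesis by (auto simp: \<eta>_def frac_def min_def)
  next
    case False
    then have "real_of_int (n + \<lfloor>\<theta>\<rfloor>) \<le> real_of_int (- 1)" by (simp only: of_int_le_iff)
    then show ?thesis by (auto simp: \<eta>_def frac_def min_def)
  qed
  \<comment> \<open>From \<open>jp n \<le> 1 + |\<theta>| + |n + \<theta>|\<close>, multiplied by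
    \<eta>: the first part is bounded by \<open>\<eta> \<le> |n + \<theta>|\<close> and the last one
    by \<open>\<eta> \<le> 1\<close>, which gives
    \<open>(2 + |\<theta>|) * |n + \<theta>|\<close>.\<close>
  define \<delta> where "\<delta> = 3 * \<bar>\<alpha>1\<bar> * (\<eta> / (2 + \<bar>\<theta>\<bar>))"
  show thesis
  proof
    show "\<delta> > 0" using assms(1) \<eta> by (simp add: \<delta>_def)
    fix n
    have "\<eta> * jp n \<le> \<eta> * (1 + \<bar>\<theta>\<bar> + \<bar>of_int n + \<theta>\<bar>)"
      using \<eta> by (intro mult_left_mono) (auto simp: jp_def japanese_def)
    also have "\<dots> = \<eta> * (1 + \<bar>\<theta>\<bar>) + \<eta> * \<bar>of_int n + \<theta>\<bar>" by (simp add: algebra_simps)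
    also have "\<dots> \<le> \<bar>of_int n + \<theta>\<bar> * (1 + \<bar>\<theta>\<bar>) + 1 * \<bar>of_int n + \<theta>\<bar>"
      using \<eta> 1[of n] by (intro add_mono mult_right_mono) auto
    finally have "\<eta> * jp n \<le> \<bar>of_int n + \<theta>\<bar> * (2 + \<bar>\<theta>\<bar>)" by (simp add: algebra_simps)
    then have "\<eta> / (2 + \<bar>\<theta>\<bar>) * jp n \<le> \<bar>of_int n + \<theta>\<bar>" by (simp add: pos_divide_le_eq)
    then have "\<delta> * jp n \<le> 3 * \<bar>\<alpha>1\<bar> * \<bar>of_int n + \<theta>\<bar>"
      unfolding \<delta>_def mult.assoc by (intro mult_left_mono) auto
    also have "\<dots> = \<bar>3 * \<alpha>1 * of_int n + 2 * \<alpha>2\<bar>"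
    proof -
      have "3 * \<alpha>1 * of_int n + 2 * \<alpha>2 = 3 * \<alpha>1 * (of_int n + \<theta>)"
        using assms(1) by (simp add: \<theta>_def field_simps)
      then show ?thesis by (simp add: abs_mult)
    qed
    finally show "\<delta> * jp n \<le> \<bar>3 * \<alpha>1 * of_int n + 2 * \<alpha>2\<bar>" .
  qed
qed

text \<open>The gaps add up to 2 k, so their brackets together control the weight, and the phase is
  bounded below by the product of these brackets. Replacing the absolute values of the two nonzero
  integers k - l and l + m by their brackets costs a factor 2 each, and the weight another 2, hence
  8.\<close>

lemma weight_over_phase:
  assumes \<delta>: "\<delta> > 0" "\<And>n. \<delta> * jp n \<le> \<bar>3 * \<alpha>1 * of_int n + 2 * \<alpha>2\<bar>" and "l \<noteq> k" "l + m \<noteq> 0"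
  defines "\<Phi> \<equiv> of_int (k - l) * of_int (l + m) * (3 * \<alpha>1 * of_int (k - m) + 2 * \<alpha>2)"
  shows "\<Phi> \<noteq> 0" "cmod (weight \<gamma>1 \<gamma>2 \<Gamma> k l m) / \<bar>\<Phi>\<bar> \<le> 8 * (\<bar>\<gamma>1\<bar> + \<bar>\<gamma>2\<bar> + \<bar>\<Gamma>\<bar>) / \<delta> * ker k l m"
proof -
  have half: "jp j / 2 \<le> \<bar>of_int j\<bar>" if "j \<noteq> 0" for j
    using that by (auto simp: jp_def japanese_def)
  let ?K = "\<bar>\<gamma>1\<bar> + \<bar>\<gamma>2\<bar> + \<bar>\<Gamma>\<bar>"
  let ?D = "jp (k - l) * jp (l + m) * jp (k - m)"
  have D: "0 < ?D" by simp
  have "jp (k - l) / 2 * (jp (l + m) / 2) * (\<delta> * jp (k - m)) \<le> \<bar>\<Phi>\<bar>"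
    unfolding \<Phi>_def abs_mult using assms by (intro mult_mono half \<delta>(2)) (auto simp: less_imp_le)
  then have \<Phi>: "\<delta> / 4 * ?D \<le> \<bar>\<Phi>\<bar>" by (simp add: mult_ac)
  have "0 < \<delta> / 4 * ?D" using \<delta>(1) by simp
  with \<Phi> show "\<Phi> \<noteq> 0" by auto
  have "jp k \<le> jp (k - l) + jp (l + m) + jp (k - m)"
    by (auto simp: jp_def japanese_def)
  then have "jp k + jp (l + m) \<le> 2 * (jp (k - l) + jp (l + m) + jp (k - m))"
    using jp_pos[of "k - l"] jp_pos[of "k - m"] jp_pos[of "l + m"] by argo
  then have "?K * (jp k + jp (l + m)) \<le> ?K * (2 * (jp (k - l) + jp (l + m) + jp (k - m)))"
    by (intro mult_left_mono) auto
  then have w: "cmod (weight \<gamma>1 \<gamma>2 \<Gamma> k l m) \<le> ?K * (2 * (jp (k - l) + jp (l + m) + jp (k - m)))"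
    using weight_bound[of \<gamma>1 \<gamma>2 \<Gamma> k l m] by linarith
  have "cmod (weight \<gamma>1 \<gamma>2 \<Gamma> k l m) / \<bar>\<Phi>\<bar> \<le> ?K * (2 * (jp (k - l) + jp (l + m) + jp (k - m))) / (\<delta> / 4 * ?D)"
    using w \<Phi> \<open>0 < \<delta> / 4 * ?D\<close> by (intro frac_le) auto
  also have "\<dots> = 8 * ?K / \<delta> * ((jp (k - l) + jp (l + m) + jp (k - m)) / ?D)"
    using \<delta>(1) by (simp add: field_simps)
  also have "(jp (k - l) + jp (l + m) + jp (k - m)) / ?D = ker k l m"
    by (simp add: ker_def field_simps)
  finally show "cmod (weight \<gamma>1 \<gamma>2 \<Gamma> k l m) / \<bar>\<Phi>\<bar> \<le> 8 * ?K / \<delta> * ker k l m" .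
qed

section \<open>Coefficient systems and the normal form\<close>

lemma sob_le_cmod_mono:
  assumes "sob_le s x X" "\<And>j. cmod (y j) \<le> cmod (x j)" shows "sob_le s y X"
  using assms unfolding sob_le_def by (auto elim!: sum_le_mono intro!: power_mono mult_left_mono)

text \<open>By the symmetry of the kernel, the factor of lower regularity may stand in any
  slot.\<close>

lemma ker_tri_rough2:
  assumes "sob_le s x X" "sob_le (s - 1) y Y" "sob_le s z Z" "1 \<le> s"
  shows "sum_le (\<lambda>(l, m). ker k l m * (cmod (x l) * cmod (y m) * cmod (z (k - l - m))))
    (48 * 3 powr s * (X * Y * Z) * jp k powr - s)"
proof -
  have "(\<lambda>l m. ker k l m * (cmod (x l) * cmod (y m) * cmod (z (k - l - m))))
    = (\<lambda>l m. ker k m l * (cmod (y m) * cmod (x l) * cmod (z (k - m - l))))"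
    by (intro ext) (simp add: ker_swap[of k] diff_diff_eq add.commute)
  then show ?thesis
    using sum_le_swap[OF ker_tri_rough[OF assms(2,1,3,4), of k]] by (simp add: mult_ac)
qed

lemma ker_tri_rough3:
  assumes "sob_le s x X" "sob_le s y Y" "sob_le (s - 1) z Z" "1 \<le> s"
  shows "sum_le (\<lambda>(l, m). ker k l m * (cmod (x l) * cmod (y m) * cmod (z (k - l - m))))
    (48 * 3 powr s * (X * Y * Z) * jp k powr - s)"
proof -
  have "(\<lambda>l m. ker k l m * (cmod (x l) * cmod (y m) * cmod (z (k - l - m))))
    = (\<lambda>l m. ker k l (k - l - m) * (cmod (x l) * cmod (z (k - l - m)) * cmod (y (k - l - (k - l - m)))))"
    by (intro ext) (simp add: ker_rotate)
  then show ?thesis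
    using sum_le_rotate[OF ker_tri_rough2[OF assms(1,3,2,4), of k], of k] by (simp add: mult_ac)
qed

text \<open>One summand is kept and all others are replaced by the bound \<open>H\<close> of their
  negative parts. The kept summand will be the one at frequency \<open>j0\<close>.\<close>

lemma infsum_lower:
  fixes f h :: "'a \<Rightarrow> real"
  assumes f: "f summable_on UNIV" and h: "sum_le h H" "\<And>i. 0 \<le> h i" and low: "\<And>i. - h i \<le> f i"
  shows "f i - H \<le> infsum f UNIV"
proof -
  have hs: "h summable_on UNIV" "infsum h UNIV \<le> H"
    using sum_le_summable(1,3)[of h H UNIV] h by auto
  have "f i \<le> sum (\<lambda>i. f i + h i) {i}" using h by simp
  also have "\<dots> \<le> (\<Sum>\<^sub>\<infinity>i. f i + h i)"
  proof (rule finite_sum_le_infsum)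
    show "0 \<le> f i + h i" for i using low[of i] by linarith
  qed (use f hs in \<open>auto intro: summable_on_add\<close>)
  also have "\<dots> = infsum f UNIV + infsum h UNIV" by (rule infsum_add[OF f hs(1)])
  finally show ?thesis using hs by linarith
qed

text \<open>Dominated convergence works along sequences, so unconditional sums are evaluated along
  growing boxes.\<close>

lemma filterlim_square_boxes:
  "filterlim (\<lambda>N. {- int N..int N} \<times> {- int N..int N}) (finite_subsets_at_top UNIV) sequentially"
  unfolding filterlim_finite_subsets_at_top
proof (intro allI impI)
  fix X :: "(int \<times> int) set" assume "finite X \<and> X \<subseteq> UNIV"
  then have X: "finite X" by simp
  define M where "M = Max (insert 0 ((\<lambda>(l, m). nat \<bar>l\<bar> + nat \<bar>m\<bar>) ` X))"
  have M: "nat \<bar>l\<bar> + nat \<bar>m\<bar> \<le> M" if "(l, m) \<in> X" for l m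
    unfolding M_def using X that by (intro Max_ge) (auto intro!: image_eqI[of _ _ "(l, m)"])
  have "X \<subseteq> {- int N..int N} \<times> {- int N..int N}" if "M \<le> N" for N
    using M that by fastforce
  then show "\<forall>\<^sub>F N in sequentially. finite ({- int N..int N} \<times> {- int N..int N}) \<and>
      X \<subseteq> {- int N..int N} \<times> {- int N..int N} \<and> {- int N..int N} \<times> {- int N..int N} \<subseteq> UNIV"
    unfolding eventually_sequentially by (intro exI[of _ M]) auto
qed

text \<open>What the decay argument uses of a solution, on the level of coefficients, so that a
  forward solution and a reflected backward solution are two instances. \<open>low\<close> takes the
  place of a conserved mass: one coefficient that stays away from zero for a short time
  suffices.\<close>

locale fourier_system =
  fixes \<alpha>1 \<alpha>2 \<gamma>1 \<gamma>2 \<Gamma> s R t0 m0 :: real and j0 :: int and a :: "real \<Rightarrow> int \<Rightarrow> complex"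
  assumes \<Gamma>_pos: "0 < \<Gamma>" and \<alpha>1: "\<alpha>1 \<noteq> 0" and nonresonant: "2 * \<alpha>2 / (3 * \<alpha>1) \<notin> \<int>"
    and s_ge: "1 \<le> s" and t0: "0 < t0" and m0: "0 < m0"
    and bound: "\<And>t. t \<in> {0..t0} \<Longrightarrow> sob_le s (a t) R"
    and cont: "h1_continuous_on {0..t0} a"
    and low: "\<And>t. t \<in> {0..t0} \<Longrightarrow> m0 \<le> (cmod (a t j0))\<^sup>2"
    and ode: "\<And>t k. t \<in> {0..t0} \<Longrightarrow> ((\<lambda>\<tau>. a \<tau> k) has_vector_derivative
       \<i> * of_real (dispersion \<alpha>1 \<alpha>2 k) * a t k + cubic \<gamma>1 \<gamma>2 \<Gamma> (a t) k) (at t within {0..t0})"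
begin

abbreviation "\<omega> \<equiv> dispersion \<alpha>1 \<alpha>2"
abbreviation "w \<equiv> weight \<gamma>1 \<gamma>2 \<Gamma>"
abbreviation "c \<equiv> complex_of_real (1 / (2 * pi))"

definition K :: real where "K = \<bar>\<gamma>1\<bar> + \<bar>\<gamma>2\<bar> + \<bar>\<Gamma>\<bar>"

definition res_coeff :: "int \<Rightarrow> real \<Rightarrow> complex" where
  "res_coeff k t = tri k (w k) (unit_seq k) (refl_cnj (a t)) (a t)
     + tri k (w k) ((a t)(k := 0)) (refl_cnj (a t)) (unit_seq k)"

definition nonres :: "int \<Rightarrow> real \<Rightarrow> complex" where
  "nonres k t = tri k (w k) ((a t)(k := 0)) (refl_cnj (a t)) ((a t)(k := 0))"

definition rate :: "int \<Rightarrow> real \<Rightarrow> complex" where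
  "rate k t = \<i> * of_real (\<omega> k) + c * res_coeff k t"

definition damp :: "int \<Rightarrow> real \<Rightarrow> complex" where
  "damp k t = exp (- integral {0..t} (rate k))"

lemma K_nonneg: "0 \<le> K" by (simp add: K_def)

lemma R_nonneg: "0 \<le> R" using bound[of 0] t0 by (auto simp: sob_le_def)

lemma bound1: "t \<in> {0..t0} \<Longrightarrow> sob_le 1 (a t) R"
  using bound s_ge by (auto intro: sob_le_mono)

lemma cmod_c: "cmod c \<le> 1" "cmod (c * z) \<le> cmod z"
proof -
  have "1 \<le> 2 * pi" using pi_ge_two by linarith
  then show 1: "cmod c \<le> 1" by (simp add: norm_divide)
  show "cmod (c * z) \<le> cmod z" using mult_right_mono[OF 1, of "cmod z"] by (simp only: norm_mult) simp
qed

lemma weight_le: "cmod (w k l m) \<le> K * (jp k + jp (l + m))"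
  unfolding K_def by (rule weight_bound)

lemma weight_le': "cmod (w k l m) \<le> 2 * K * jp k * jp (l + m)"
  using weight_bound'[of \<gamma>1 \<gamma>2 \<Gamma> k l m] by (simp add: K_def)

lemma jp_le_3: "jp k + jp (k + m) \<le> 3 * (jp k * jp m)"
proof -
  have "jp k * 1 \<le> jp k * jp m" "1 * jp m \<le> jp k * jp m" by (intro mult_mono; simp)+
  then show ?thesis using jp_add[of k m] by linarith
qed

lemma continuous_res_coeff: "continuous_on {0..t0} (res_coeff k)"
  unfolding res_coeff_def using K_nonneg
  by (intro continuous_on_add continuous_on_tri[of _ _ _ _ "2 * K * jp k"] h1_continuous_on_const[OF sob_le_unit_seq]
    cont h1_continuous_on_refl_cnj h1_continuous_on_upd weight_le') auto

lemma continuous_nonres: "continuous_on {0..t0} (nonres k)"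
  unfolding nonres_def using K_nonneg
  by (intro continuous_on_tri[of _ _ _ _ "2 * K * jp k"]
    cont h1_continuous_on_refl_cnj h1_continuous_on_upd weight_le') auto

lemma continuous_rate: "continuous_on {0..t0} (rate k)"
  unfolding rate_def by (intro continuous_intros continuous_res_coeff)

lemma continuous_a: "continuous_on {0..t0} (\<lambda>t. a t k)"
  by (rule h1_continuous_on_component[OF cont])

lemma continuous_cubic: "continuous_on {0..t0} (\<lambda>t. cubic \<gamma>1 \<gamma>2 \<Gamma> (a t) k)"
  unfolding cubic_def using K_nonneg
  by (intro continuous_on_mult_left continuous_on_tri[of _ _ _ _ "2 * K * jp k"]
    cont h1_continuous_on_refl_cnj weight_le') auto

lemma deriv_a:
  assumes t: "t \<in> {0..t0}"
  shows "((\<lambda>\<tau>. a \<tau> k) has_vector_derivative rate k t * a t k + c * nonres k t) (at t within {0..t0})"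
proof -
  have "cubic \<gamma>1 \<gamma>2 \<Gamma> (a t) k = c * (a t k * res_coeff k t + nonres k t)"
    unfolding cubic_def res_coeff_def nonres_def
    by (subst tri_resonant_split[OF bound1[OF t] sob_le_refl_cnj[OF bound1[OF t]] _ weight_le'])
       (use K_nonneg in auto)
  then show ?thesis using ode[OF t, of k] by (simp add: rate_def algebra_simps)
qed

text \<open>Serves both sums of \<open>res_coeff_eq\<close>. The growth of the weight in m is paid
  by the \<open>H^1\<close> bound: \<open>jp k + jp (k + m) \<le> 3 * (jp k * jp m)\<close>, and
  \<open>jp m\<close> is at most its square.\<close>

lemma weighted_mass: 
  assumes t: "t \<in> {0..t0}" and v: "\<And>m. cmod (v m) \<le> K * (jp k + jp (k + m))"
    and x: "\<And>m. cmod (x m) \<le> cmod (a t m)"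
  shows "sum_le (\<lambda>m. cmod (v m * (x (- m) * cnj (a t (- m))))) (3 * K * jp k * R\<^sup>2)"
proof -
  have "sum_le (\<lambda>m. (jp (- m) * cmod (a t (- m)))\<^sup>2) (R\<^sup>2)"
    using sum_le_reindex[OF sob_le_l2[OF bound1[OF t]], of uminus] by (auto simp: inj_def)
  then have "sum_le (\<lambda>m. 3 * K * jp k * (jp (- m) * cmod (a t (- m)))\<^sup>2) (3 * K * jp k * R\<^sup>2)"
    using K_nonneg by (intro sum_le_cmult) auto
  then show ?thesis
  proof (rule sum_le_mono)
    fix m
    let ?a = "cmod (a t (- m))"
    have "cmod (v m) \<le> K * (3 * (jp k * jp m))"
      using v[of m] mult_left_mono[OF jp_le_3[of k m] K_nonneg] by linarith
    moreover have "cmod (x (- m)) * ?a \<le> ?a * ?a" by (intro mult_right_mono x) auto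
    ultimately have "cmod (v m) * (cmod (x (- m)) * ?a) \<le> K * (3 * (jp k * jp m)) * (?a * ?a)"
      by (rule mult_mono) (use K_nonneg in auto)
    also have "\<dots> \<le> K * (3 * (jp k * (jp m * jp m))) * (?a * ?a)"
      using K_nonneg by (intro mult_right_mono mult_left_mono) (auto simp: mult_le_cancel_left1)
    finally show "cmod (v m * (x (- m) * cnj (a t (- m)))) \<le> 3 * K * jp k * (jp (- m) * cmod (a t (- m)))\<^sup>2"
      by (simp add: norm_mult power2_eq_square mult_ac)
  qed simp
qed

lemma res_coeff_eq:
  "res_coeff k t = (\<Sum>\<^sub>\<infinity>m. w k k m * (a t (- m) * cnj (a t (- m)))) 
     + (\<Sum>\<^sub>\<infinity>m. w k (- m) m * (((a t)(k := 0)) (- m) * cnj (a t (- m))))"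
proof -
  have "(\<Sum>\<^sub>\<infinity>l. w k l (- l) * (((a t)(k := 0)) l * refl_cnj (a t) (- l)))
    = (\<Sum>\<^sub>\<infinity>l\<in>range uminus. w k l (- l) * (((a t)(k := 0)) l * refl_cnj (a t) (- l)))" by simp
  also have "\<dots> = (\<Sum>\<^sub>\<infinity>m. w k (- m) m * (((a t)(k := 0)) (- m) * cnj (a t (- m))))"
    by (subst infsum_reindex) (auto simp: o_def refl_cnj_def inj_def)
  finally show ?thesis
    unfolding res_coeff_def tri_unit_left tri_unit_right by (simp add: refl_cnj_def mult_ac)
qed

lemma weight_diag_le: "cmod (w k (- m) m) \<le> K * (jp k + jp (k + m))"
proof -
  have "jp 0 \<le> jp (k + m)" by (simp add: jp_def japanese_def)
  then have "K * (jp k + jp (- m + m)) \<le> K * (jp k + jp (k + m))" using K_nonneg by (intro mult_left_mono) auto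
  then show ?thesis using weight_le[of k "- m" m] by linarith
qed

lemma res_coeff_bound:
  assumes t: "t \<in> {0..t0}" shows "cmod (res_coeff k t) \<le> 6 * K * R\<^sup>2 * jp k"
proof -
  have "cmod (\<Sum>\<^sub>\<infinity>m. w k k m * (a t (- m) * cnj (a t (- m)))) \<le> 3 * K * jp k * R\<^sup>2"
    by (intro sum_le_summable(3) weighted_mass t weight_le) auto
  moreover have "cmod (\<Sum>\<^sub>\<infinity>m. w k (- m) m * (((a t)(k := 0)) (- m) * cnj (a t (- m)))) \<le> 3 * K * jp k * R\<^sup>2"
    by (intro sum_le_summable(3) weighted_mass t weight_diag_le) auto
  ultimately show ?thesis unfolding res_coeff_eq
    by (intro norm_triangle_le) (simp add: algebra_simps)
qed

text \<open>In the terms with l = k the real part of the weight is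
  \<open>\<Gamma> * (k + m)\<close>, so the frequency j = - m contributes
  \<open>\<Gamma> * (k - j)\<close> times its mass. The frequency \<open>j0\<close> alone provides
  the growth in k. Frequencies above k have the wrong sign, but there
  \<open>j - k \<le> jp j\<close>, and the \<open>H^1\<close> bound absorbs the loss uniformly in
  k.\<close>

lemma Re_res_coeff:
  assumes t: "t \<in> {0..t0}" and k: "0 \<le> k" "j0 \<le> k"
  shows "\<Gamma> * (of_int (k - j0) * m0 - R\<^sup>2) \<le> Re (res_coeff k t)"
proof -
  let ?f = "\<lambda>m. w k k m * (a t (- m) * cnj (a t (- m)))"
  let ?g = "\<lambda>m. w k (- m) m * (((a t)(k := 0)) (- m) * cnj (a t (- m)))"
  have f: "?f summable_on UNIV" by (rule sum_le_summable(1)[OF weighted_mass[OF t weight_le]]) auto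
  have g: "?g summable_on UNIV" by (rule sum_le_summable(1)[OF weighted_mass[OF t weight_diag_le]]) auto
  have Ref: "Re (?f m) = \<Gamma> * (of_int (k + m) * (cmod (a t (- m)))\<^sup>2)" for m
    by (simp only: complex_norm_square[symmetric]) (simp add: weight_def)
  \<comment> \<open>In the terms with l + m = 0 the real part of the weight vanishes, which leaves
    an imaginary number times a mass.\<close>
  have Reg: "Re (?g m) = 0" for m
  proof (cases "- m = k")
    case False
    then have "((a t)(k := 0)) (- m) = a t (- m)" by (rule fun_upd_other)
    then show ?thesis by (simp only: complex_norm_square[symmetric]) (simp add: weight_def)
  qed simp
  have l2: "sum_le (\<lambda>m. (jp (- m) * cmod (a t (- m)))\<^sup>2) (R\<^sup>2)"
    using sum_le_reindex[OF sob_le_l2[OF bound1[OF t]], of uminus] by (auto simp: inj_def)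
  have "(\<lambda>m. Re (?f m)) summable_on UNIV" using f by (rule summable_on_Re)
  then have "Re (?f (- j0)) - \<Gamma> * R\<^sup>2 \<le> (\<Sum>\<^sub>\<infinity>m. Re (?f m))"
  proof (rule infsum_lower)
    show "sum_le (\<lambda>m. \<Gamma> * (jp (- m) * cmod (a t (- m)))\<^sup>2) (\<Gamma> * R\<^sup>2)"
      using \<Gamma>_pos by (intro sum_le_cmult l2) auto
    show "- (\<Gamma> * (jp (- m) * cmod (a t (- m)))\<^sup>2) \<le> Re (?f m)" for m
    proof -
      have "- ((jp m)\<^sup>2) \<le> of_int (k + m)"
      proof -
        have "jp m * 1 \<le> jp m * jp m" by (intro mult_left_mono) auto
        moreover have "- jp m \<le> of_int (k + m)" using k by (auto simp: jp_def japanese_def)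
        ultimately show ?thesis unfolding power2_eq_square by linarith
      qed
      from mult_right_mono[OF this, of "(cmod (a t (- m)))\<^sup>2"]
      have "- ((jp m * cmod (a t (- m)))\<^sup>2) \<le> of_int (k + m) * (cmod (a t (- m)))\<^sup>2"
        by (simp add: power_mult_distrib)
      from mult_left_mono[OF this, of \<Gamma>] show ?thesis unfolding Ref using \<Gamma>_pos by simp
    qed
  qed (use \<Gamma>_pos in auto)
  moreover have "\<Gamma> * (of_int (k - j0) * m0) \<le> Re (?f (- j0))"
    unfolding Ref using low[OF t] k \<Gamma>_pos m0 by (intro mult_left_mono mult_mono) auto
  moreover have "Re (res_coeff k t) = (\<Sum>\<^sub>\<infinity>m. Re (?f m)) + (\<Sum>\<^sub>\<infinity>m. Re (?g m))"
    unfolding res_coeff_eq by (simp only: plus_complex.sel infsum_Re[OF f] infsum_Re[OF g])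
  moreover have "(\<Sum>\<^sub>\<infinity>m. Re (?g m)) = 0" by (simp only: Reg infsum_0_simp)
  ultimately show ?thesis unfolding right_diff_distrib by linarith
qed

end

section \<open>The normal form on finite sets of frequencies\<close>

context fourier_system
begin

definition tprod :: "int \<Rightarrow> int \<Rightarrow> int \<Rightarrow> real \<Rightarrow> complex" where
  "tprod k l m t = a t l * refl_cnj (a t) m * a t (k - l - m)"

definition force :: "real \<Rightarrow> int \<Rightarrow> complex" where
  "force t = cubic \<gamma>1 \<gamma>2 \<Gamma> (a t)"

definition tprod_force :: "int \<Rightarrow> int \<Rightarrow> int \<Rightarrow> real \<Rightarrow> complex" where
  "tprod_force k l m t = force t l * refl_cnj (a t) m * a t (k - l - m)
     + a t l * refl_cnj (force t) m * a t (k - l - m) + a t l * refl_cnj (a t) m * force t (k - l - m)"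

definition phase :: "int \<Rightarrow> int \<Rightarrow> int \<Rightarrow> real" where
  "phase k l m = of_int (k - l) * of_int (l + m) * (3 * \<alpha>1 * of_int (k - m) + 2 * \<alpha>2)"

definition quot :: "int \<Rightarrow> int \<Rightarrow> int \<Rightarrow> complex" where
  "quot k l m = w k l m / (\<i> * of_real (phase k l m))"

text \<open>Division by the phase turns the oscillation of \<open>tprod\<close> relative to the k-th
  coefficient into a time derivative. \<open>F\<close> will be finite, so differentiation is term by
  term.\<close>

definition nf :: "int \<Rightarrow> (int \<times> int) set \<Rightarrow> real \<Rightarrow> complex" where
  "nf k F t = (\<Sum>(l, m)\<in>F. quot k l m * tprod k l m t)"

text \<open>What remains of the derivative of \<open>nf\<close> besides \<open>rate k * nf\<close>
  and \<open>nonres_part\<close>. The resonant coefficient is part of \<open>rate\<close> but not of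
  the oscillation of \<open>tprod\<close>, so it is subtracted here.\<close>

definition nf_rest :: "int \<Rightarrow> (int \<times> int) set \<Rightarrow> real \<Rightarrow> complex" where
  "nf_rest k F t = (\<Sum>(l, m)\<in>F. quot k l m * (tprod_force k l m t - c * res_coeff k t * tprod k l m t))"

definition nonres_part :: "int \<Rightarrow> (int \<times> int) set \<Rightarrow> real \<Rightarrow> complex" where
  "nonres_part k F t = (\<Sum>(l, m)\<in>F. w k l m * tprod k l m t)"

definition good :: "int \<Rightarrow> (int \<times> int) set" where
  "good k = {(l, m). l \<noteq> k \<and> l + m \<noteq> 0}"

text \<open>The linear parts add up to
  \<open>\<omega> l - \<omega> (- m) + \<omega> (k - l - m)\<close>, with a minus for the conjugated
  factor; by \<open>phase_factor\<close> this is \<open>\<omega> k + phase k l m\<close>.\<close>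

lemma deriv_tprod:
  assumes t: "t \<in> {0..t0}"
  shows "(tprod k l m has_vector_derivative
    \<i> * of_real (\<omega> k + phase k l m) * tprod k l m t + tprod_force k l m t) (at t within {0..t0})"
proof -
  let ?g = "\<lambda>k. \<i> * of_real (\<omega> k) * a t k + force t k"
  have d: "((\<lambda>\<tau>. a \<tau> k) has_vector_derivative ?g k) (at t within {0..t0})" for k
    using ode[OF t] by (simp add: force_def)
  have "phase k l m = \<omega> l - \<omega> (- m) + \<omega> (k - l - m) - \<omega> k"
    unfolding phase_factor phase_def ..
  then have p: "\<omega> k + phase k l m = \<omega> l - \<omega> (- m) + \<omega> (k - l - m)" by simp
  have "((\<lambda>\<tau>. a \<tau> l * cnj (a \<tau> (- m)) * a \<tau> (k - l - m)) has_vector_derivative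
     (a t l * cnj (a t (- m)) * ?g (k - l - m) + (a t l * cnj (?g (- m)) + ?g l * cnj (a t (- m))) * a t (k - l - m)))
     (at t within {0..t0})"
    by (intro has_vector_derivative_mult has_vector_derivative_cnj d)
  moreover have "tprod k l m = (\<lambda>\<tau>. a \<tau> l * cnj (a \<tau> (- m)) * a \<tau> (k - l - m))"
    by (simp add: tprod_def refl_cnj_def fun_eq_iff)
  moreover have "a t l * cnj (a t (- m)) * ?g (k - l - m) + (a t l * cnj (?g (- m)) + ?g l * cnj (a t (- m))) * a t (k - l - m)
     = \<i> * of_real (\<omega> k + phase k l m) * tprod k l m t + tprod_force k l m t"
    unfolding p by (simp add: tprod_def tprod_force_def refl_cnj_def algebra_simps)
  ultimately show ?thesis by simp
qed

lemma deriv_damp: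
  assumes t: "t \<in> {0..t0}"
  shows "(damp k has_vector_derivative - rate k t * damp k t) (at t within {0..t0})"
proof -
  have "((\<lambda>u. - integral {0..u} (rate k)) has_vector_derivative - rate k t) (at t within {0..t0})"
    by (intro has_vector_derivative_minus integral_has_vector_derivative continuous_rate t)
  then have "((\<lambda>u. exp (- integral {0..u} (rate k))) has_vector_derivative
     - rate k t * exp (- integral {0..t} (rate k))) (at t within {0..t0})"
    using field_vector_diff_chain_within[OF _ DERIV_subset[OF DERIV_exp subset_UNIV], of "\<lambda>u. - integral {0..u} (rate k)" "- rate k t" t "{0..t0}"]
    by (simp add: o_def)
  then show ?thesis by (simp add: damp_def fun_eq_iff[symmetric] flip: damp_def)
qed

lemma damp_bound:
  assumes t: "t \<in> {0..t0}" and \<kappa>: "\<And>t. t \<in> {0..t0} \<Longrightarrow> \<kappa> \<le> Re (rate k t)"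
  shows "cmod (damp k t) \<le> exp (- (\<kappa> * t))"
proof -
  have c: "continuous_on {0..t} (rate k)"
    using continuous_rate by (rule continuous_on_subset) (use t in auto)
  then have i: "rate k integrable_on {0..t}" by (rule integrable_continuous_interval)
  have "\<kappa> * t = integral {0..t} (\<lambda>_. \<kappa>)" using t by simp
  also have "\<dots> \<le> integral {0..t} (\<lambda>\<tau>. Re (rate k \<tau>))"
    using t c by (intro integral_le integrable_continuous_interval continuous_intros \<kappa>) auto
  also have "\<dots> = Re (integral {0..t} (rate k))"
    using integral_linear[OF i bounded_linear_Re] by (simp add: o_def)
  finally show ?thesis by (simp add: damp_def)
qed

text \<open>For the k-th coefficient minus \<open>c * nf\<close>, the terms with \<open>rate\<close>
  cancel against the derivative of \<open>damp\<close>, and the nonresonant terms in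
  \<open>F\<close> against the main part of the derivative of \<open>nf\<close>. Only the truncation
  error and \<open>nf_rest\<close> survive.\<close>

lemma normal_form_identity:
  assumes F: "finite F" "F \<subseteq> good k" and ph: "\<And>l m. (l, m) \<in> good k \<Longrightarrow> phase k l m \<noteq> 0"
  shows "((\<lambda>t. damp k t * (c * (nonres k t - nonres_part k F t)) - damp k t * (c * nf_rest k F t)) has_integral
    damp k t0 * (a t0 k - c * nf k F t0) - (a 0 k - c * nf k F 0)) {0..t0}"
proof -
  have nf: "(nf k F has_vector_derivative rate k t * nf k F t + nonres_part k F t + nf_rest k F t) (at t within {0..t0})"
    if t: "t \<in> {0..t0}" for t
  proof -
    have "(nf k F has_vector_derivative (\<Sum>(l, m)\<in>F. quot k l m *
       (\<i> * of_real (\<omega> k + phase k l m) * tprod k l m t + tprod_force k l m t))) (at t within {0..t0})"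
      unfolding nf_def case_prod_unfold
      by (intro has_vector_derivative_sum has_vector_derivative_mult_right deriv_tprod t)
    moreover have "(\<Sum>(l, m)\<in>F. quot k l m * (\<i> * of_real (\<omega> k + phase k l m) * tprod k l m t + tprod_force k l m t))
      = (\<Sum>(l, m)\<in>F. rate k t * (quot k l m * tprod k l m t) + w k l m * tprod k l m t
          + quot k l m * (tprod_force k l m t - c * res_coeff k t * tprod k l m t))"
    proof (intro sum.cong refl, clarify)
      fix l m assume "(l, m) \<in> F"
      then have "phase k l m \<noteq> 0" using F ph by auto
      then have q: "w k l m = quot k l m * (\<i> * of_real (phase k l m))" by (simp add: quot_def)
      show "quot k l m * (\<i> * of_real (\<omega> k + phase k l m) * tprod k l m t + tprod_force k l m t)
        = rate k t * (quot k l m * tprod k l m t) + w k l m * tprod k l m t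
          + quot k l m * (tprod_force k l m t - c * res_coeff k t * tprod k l m t)"
        unfolding q rate_def by (simp add: algebra_simps)
    qed
    ultimately show ?thesis
      by (simp add: nf_def nonres_part_def nf_rest_def case_prod_unfold sum.distrib sum_distrib_left)
  qed
  have "((\<lambda>t. damp k t * (c * (nonres k t - nonres_part k F t)) - damp k t * (c * nf_rest k F t)) has_integral
    damp k t0 * (a t0 k - c * nf k F t0) - damp k 0 * (a 0 k - c * nf k F 0)) {0..t0}"
  proof (rule fundamental_theorem_of_calculus)
    fix t assume t: "t \<in> {0..t0}"
    have "((\<lambda>t. damp k t * (a t k - c * nf k F t)) has_vector_derivative
      (damp k t * (rate k t * a t k + c * nonres k t - c * (rate k t * nf k F t + nonres_part k F t + nf_rest k F t))
       + - rate k t * damp k t * (a t k - c * nf k F t))) (at t within {0..t0})"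
      by (intro has_vector_derivative_mult has_vector_derivative_diff has_vector_derivative_mult_right
        deriv_damp deriv_a nf t)
    then show "((\<lambda>t. damp k t * (a t k - c * nf k F t)) has_vector_derivative
      damp k t * (c * (nonres k t - nonres_part k F t)) - damp k t * (c * nf_rest k F t)) (at t within {0..t0})"
      by (simp add: algebra_simps)
  qed (use t0 in simp)
  then show ?thesis by (simp add: damp_def)
qed

lemma nonres_part_tendsto:
  assumes t: "t \<in> {0..t0}"
  shows "(\<lambda>N. nonres_part k (({- int N..int N} \<times> {- int N..int N}) \<inter> good k) t) \<longlonglongrightarrow> nonres k t"
proof -
  let ?f = "\<lambda>i. case i of (l, m) \<Rightarrow> w k l m * (((a t)(k := 0)) l * refl_cnj (a t) m * ((a t)(k := 0)) (k - l - m))"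
  let ?B = "\<lambda>N. {- int N..int N} \<times> {- int N..int N}"
  note b = sob_le_upd[OF bound1[OF t], of k]
  have "?f summable_on UNIV"
    using sum_le_summable(1)[OF tri_sum_le[OF b sob_le_refl_cnj[OF bound1[OF t]] b _ weight_le', where k = k, unfolded case_prod_unfold]]
      K_nonneg by (simp add: case_prod_unfold)
  then have "(?f has_sum nonres k t) UNIV" unfolding nonres_def tri_def by (rule has_sum_infsum)
  then have "(sum ?f \<longlongrightarrow> nonres k t) (finite_subsets_at_top UNIV)" by (simp add: has_sum_def)
  from filterlim_compose[OF this filterlim_square_boxes]
  have "(\<lambda>N. sum ?f (?B N)) \<longlonglongrightarrow> nonres k t" .
  moreover have "sum ?f (?B N) = nonres_part k (?B N \<inter> good k) t" for N
  proof -
    \<comment> \<open>Outside \<open>good k\<close> one of the two updated factors is evaluated at k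
      and vanishes: l + m = 0 says that the third frequency is k.\<close>
    have "sum ?f (?B N) = sum ?f (?B N \<inter> good k)"
      by (rule sum.mono_neutral_right) (auto simp: good_def)
    also have "\<dots> = nonres_part k (?B N \<inter> good k) t" unfolding nonres_part_def
      by (rule sum.cong) (auto simp: good_def tprod_def)
    finally show ?thesis .
  qed
  ultimately show ?thesis by simp
qed

lemma nonres_part_bound:
  assumes t: "t \<in> {0..t0}" and F: "finite F"
  shows "cmod (nonres_part k F t) \<le> 4 * K * jp k * (R * R * R)" "cmod (nonres k t) \<le> 4 * K * jp k * (R * R * R)"
proof -
  note h = bound1[OF t] sob_le_refl_cnj[OF bound1[OF t]] and b = sob_le_upd[OF bound1[OF t], of k]
  have "sum_le (\<lambda>(l, m). cmod (w k l m * tprod k l m t)) (2 * (2 * K * jp k) * (R * R * R))"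
    using tri_sum_le[OF h(1,2,1) _ weight_le', where k = k] K_nonneg by (simp add: tprod_def)
  from sum_leD[OF this F]
  show "cmod (nonres_part k F t) \<le> 4 * K * jp k * (R * R * R)"
    unfolding nonres_part_def case_prod_unfold using norm_sum[of "\<lambda>p. w k (fst p) (snd p) * tprod k (fst p) (snd p) t" F] by simp
  have "sum_le (\<lambda>i. cmod (case i of (l, m) \<Rightarrow> w k l m * (((a t)(k := 0)) l * refl_cnj (a t) m * ((a t)(k := 0)) (k - l - m)))) (2 * (2 * K * jp k) * (R * R * R))"
    using tri_sum_le[OF b h(2) b _ weight_le', where k = k] K_nonneg by (simp add: case_prod_unfold)
  from sum_le_summable(3)[OF this, of UNIV] show "cmod (nonres k t) \<le> 4 * K * jp k * (R * R * R)"
    by (simp add: nonres_def tri_def)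
qed

lemma sob_le_force:
  assumes t: "t \<in> {0..t0}" shows "sob_le (s - 1) (force t) (24 * 3 powr s * K * (R * R * R))"
proof (rule sob_le_cmod_mono)
  show "sob_le (s - 1) (\<lambda>k. tri k (w k) (a t) (refl_cnj (a t)) (a t)) (24 * 3 powr s * K * (R * R * R))"
    by (intro sob_le_tri bound t sob_le_refl_cnj s_ge K_nonneg weight_le)
qed (use cmod_c in \<open>simp add: force_def cubic_def\<close>)

end

section \<open>Decay of the coefficients at time zero\<close>

context fourier_system
begin

lemma integral_exp_le:
  assumes \<kappa>: "0 < \<kappa>" and f: "continuous_on {0..t0} f" "\<And>t. t \<in> {0..t0} \<Longrightarrow> cmod (f t) \<le> V * exp (- (\<kappa> * t))" and V: "0 \<le> V"
  shows "cmod (integral {0..t0} f) \<le> V / \<kappa>"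
proof -
  have "((\<lambda>t. V * exp (- (\<kappa> * t))) has_integral (- (V / \<kappa>) * exp (- (\<kappa> * t0)) - (- (V / \<kappa>) * exp (- (\<kappa> * 0))))) {0..t0}"
    by (rule fundamental_theorem_of_calculus)
       (use t0 \<kappa> in \<open>auto intro!: derivative_eq_intros simp: has_real_derivative_iff_has_vector_derivative[symmetric]\<close>)
  then have i: "((\<lambda>t. V * exp (- (\<kappa> * t))) has_integral (V / \<kappa> - V / \<kappa> * exp (- (\<kappa> * t0)))) {0..t0}" by simp
  have "cmod (integral {0..t0} f) \<le> integral {0..t0} (\<lambda>t. V * exp (- (\<kappa> * t)))"
    using i f(2) by (intro integral_norm_bound_integral)
      (auto simp: has_integral_iff intro: integrable_continuous_interval f(1))
  also have "\<dots> = V / \<kappa> - V / \<kappa> * exp (- (\<kappa> * t0))" using i by (simp add: has_integral_iff)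
  also have "\<dots> \<le> V / \<kappa>" using V \<kappa> by simp
  finally show ?thesis .
qed

lemma sum_ker_bound:
  assumes Q: "\<And>l m. (l, m) \<in> F \<Longrightarrow> cmod (q l m) \<le> Cw * ker k l m" and F: "finite F" and Cw: "0 \<le> Cw"
    and f: "sum_le (\<lambda>(l, m). ker k l m * f l m) C" and le: "\<And>l m. cmod (g l m) \<le> f l m"
  shows "cmod (\<Sum>(l, m)\<in>F. q l m * g l m) \<le> Cw * C"
proof -
  have "cmod (\<Sum>(l, m)\<in>F. q l m * g l m) \<le> (\<Sum>(l, m)\<in>F. cmod (q l m * g l m))"
    by (simp add: case_prod_unfold norm_sum)
  also have "\<dots> \<le> (\<Sum>(l, m)\<in>F. Cw * (ker k l m * f l m))"
  proof (intro sum_mono, clarify)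
    fix l m assume "(l, m) \<in> F"
    then have "cmod (q l m) * cmod (g l m) \<le> (Cw * ker k l m) * f l m"
      using Q le Cw by (intro mult_mono) auto
    then show "cmod (q l m * g l m) \<le> Cw * (ker k l m * f l m)" by (simp add: norm_mult mult_ac)
  qed
  also have "\<dots> = Cw * (\<Sum>(l, m)\<in>F. ker k l m * f l m)" by (simp add: sum_distrib_left case_prod_unfold)
  also have "\<dots> \<le> Cw * C" by (intro mult_left_mono sum_leD[OF f] F Cw)
  finally show ?thesis .
qed

text \<open>\<open>C1\<close> is the constant of \<open>ker_tri_smooth\<close>, and
  \<open>C2\<close> that of \<open>ker_tri_rough\<close> with the bound of
  \<open>sob_le_force\<close> for one factor. In \<open>C3\<close> the force stands in each of the
  three slots, and the resonant coefficient multiplies \<open>C1\<close> by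
  \<open>6 * K * R^2 * jp k\<close>, so all parts carry the same power of
  \<open>jp k\<close>.\<close>

definition C1 :: real where "C1 = 72 * 3 powr s * (R * R * R)"
definition C2 :: real where "C2 = 48 * 3 powr s * (24 * 3 powr s * K * (R * R * R) * R * R)"
definition C3 :: real where "C3 = 3 * C2 + 6 * K * R\<^sup>2 * C1"

lemma C_nonneg: "0 \<le> C1" "0 \<le> C2" "0 \<le> C3"
  using R_nonneg K_nonneg by (auto simp: C1_def C2_def C3_def)

lemma nf_bound:
  assumes Q: "\<And>l m. (l, m) \<in> F \<Longrightarrow> cmod (quot k l m) \<le> Cw * ker k l m" and F: "finite F" and Cw: "0 \<le> Cw"
    and t: "t \<in> {0..t0}"
  shows "cmod (nf k F t) \<le> Cw * (C1 * jp k powr (- s - 1))"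
    and "cmod (nf_rest k F t) \<le> Cw * (C3 * jp k powr - s)"
proof -
  note a = bound[OF t] sob_le_refl_cnj[OF bound[OF t]] and f = sob_le_force[OF t] sob_le_refl_cnj[OF sob_le_force[OF t]]
  let ?A = "\<lambda>l m. cmod (a t l) * cmod (refl_cnj (a t) m) * cmod (a t (k - l - m))"
  have 1: "sum_le (\<lambda>(l, m). ker k l m * ?A l m) (C1 * jp k powr (- s - 1))"
    using ker_tri_smooth[OF a(1,2,1) s_ge, of k] by (simp add: C1_def)
  show "cmod (nf k F t) \<le> Cw * (C1 * jp k powr (- s - 1))"
    unfolding nf_def by (rule sum_ker_bound[OF Q F Cw 1]) (auto simp: tprod_def norm_mult)
  let ?X = "6 * K * R\<^sup>2 * jp k"
  have X: "0 \<le> ?X" using K_nonneg by simp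
  let ?F1 = "\<lambda>l m. cmod (force t l) * cmod (refl_cnj (a t) m) * cmod (a t (k - l - m))"
  let ?F2 = "\<lambda>l m. cmod (a t l) * cmod (refl_cnj (force t) m) * cmod (a t (k - l - m))"
  let ?F3 = "\<lambda>l m. cmod (a t l) * cmod (refl_cnj (a t) m) * cmod (force t (k - l - m))"
  have "C2 * jp k powr - s + C2 * jp k powr - s + C2 * jp k powr - s + ?X * (C1 * jp k powr (- s - 1)) = C3 * jp k powr - s"
    by (simp add: C3_def powr_diff algebra_simps)
  moreover have "sum_le (\<lambda>i. (case i of (l, m) \<Rightarrow> ker k l m * ?F1 l m) + (case i of (l, m) \<Rightarrow> ker k l m * ?F2 l m)
     + (case i of (l, m) \<Rightarrow> ker k l m * ?F3 l m) + ?X * (case i of (l, m) \<Rightarrow> ker k l m * ?A l m))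
     (C2 * jp k powr - s + C2 * jp k powr - s + C2 * jp k powr - s + ?X * (C1 * jp k powr (- s - 1)))"
    using ker_tri_rough[OF f(1) a(2,1) s_ge, of k] ker_tri_rough2[OF a(1) f(2) a(1) s_ge, of k]
      ker_tri_rough3[OF a(1,2) f(1) s_ge, of k]
    by (intro sum_le_add sum_le_cmult X 1) (simp_all add: C2_def mult_ac)
  ultimately have 2: "sum_le (\<lambda>(l, m). ker k l m * (?F1 l m + ?F2 l m + ?F3 l m + ?X * ?A l m)) (C3 * jp k powr - s)"
    by (simp add: case_prod_unfold algebra_simps)
  show "cmod (nf_rest k F t) \<le> Cw * (C3 * jp k powr - s)"
    unfolding nf_rest_def
  proof (rule sum_ker_bound[OF Q F Cw 2])
    fix l m
    have "cmod (tprod_force k l m t - c * res_coeff k t * tprod k l m t)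
      \<le> cmod (tprod_force k l m t) + cmod (c * res_coeff k t * tprod k l m t)" by (rule norm_triangle_ineq4)
    also have "cmod (tprod_force k l m t) \<le> ?F1 l m + ?F2 l m + ?F3 l m"
      unfolding tprod_force_def norm_mult[symmetric] by (intro norm_triangle_le add_mono order_refl)
    also have "cmod (c * res_coeff k t * tprod k l m t) \<le> ?X * ?A l m"
    proof -
      have "cmod (c * (res_coeff k t * tprod k l m t)) \<le> cmod (res_coeff k t * tprod k l m t)" by (rule cmod_c)
      also have "\<dots> \<le> ?X * ?A l m" unfolding norm_mult tprod_def
        by (intro mult_right_mono res_coeff_bound t) auto
      finally show ?thesis by (simp only: mult.assoc)
    qed
    finally show "cmod (tprod_force k l m t - c * res_coeff k t * tprod k l m t) \<le> ?F1 l m + ?F2 l m + ?F3 l m + ?X * ?A l m"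
      by simp
  qed
qed

lemma continuous_damp: "continuous_on {0..t0} (damp k)"
  unfolding continuous_on_eq_continuous_within
  using deriv_damp has_vector_derivative_continuous by blast

lemma continuous_tprod: "continuous_on {0..t0} (tprod k l m)"
  unfolding continuous_on_eq_continuous_within
  using deriv_tprod has_vector_derivative_continuous by blast

lemma continuous_force: "continuous_on {0..t0} (\<lambda>t. force t k)"
  unfolding force_def by (rule continuous_cubic)

lemma continuous_nonres_part: "continuous_on {0..t0} (nonres_part k F)"
  unfolding nonres_part_def case_prod_unfold by (intro continuous_intros continuous_tprod)

lemma continuous_nf_rest: "continuous_on {0..t0} (nf_rest k F)"
  unfolding nf_rest_def case_prod_unfold tprod_force_def refl_cnj_def
  by (intro continuous_intros continuous_tprod continuous_force continuous_res_coeff continuous_a)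

text \<open>Every contribution gains one power of \<open>jp k\<close> beyond s, but for different
  reasons: the two normal form boundary terms by the kernel, the coefficient at time
  \<open>t0\<close> by the smallness of \<open>damp\<close>, and the rest by integrating
  \<open>damp\<close> over time.\<close>

lemma coefficient_bound:
  assumes Q: "\<And>l m. (l, m) \<in> good k \<Longrightarrow> cmod (quot k l m) \<le> Cw * ker k l m" and Cw: "0 \<le> Cw"
    and ph: "\<And>l m. (l, m) \<in> good k \<Longrightarrow> phase k l m \<noteq> 0"
    and \<kappa>: "0 < \<kappa>" "\<And>t. t \<in> {0..t0} \<Longrightarrow> \<kappa> * jp k \<le> Re (rate k t)"
  shows "cmod (a 0 k) \<le> (2 * (Cw * C1) + R / (\<kappa> * t0) + Cw * C3 / \<kappa>) * jp k powr (- s - 1)"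
proof -
  define F where "F = (\<lambda>N. ({- int N..int N} \<times> {- int N..int N}) \<inter> good k)"
  have F: "finite (F N)" "F N \<subseteq> good k" for N by (auto simp: F_def)
  let ?J = "\<lambda>N. integral {0..t0} (\<lambda>t. damp k t * (c * (nonres k t - nonres_part k (F N) t)))"
  have damp1: "cmod (damp k t) \<le> exp (- (\<kappa> * jp k * t))" if "t \<in> {0..t0}" for t
    using damp_bound[OF that \<kappa>(2)] .
  have jp: "jp k powr - s / jp k = jp k powr (- s - 1)" by (simp add: powr_diff)
  have damp_t0: "cmod (damp k t0) \<le> 1 / (\<kappa> * t0 * jp k)" "cmod (damp k t0) \<le> 1"
  proof -
    have p: "0 < \<kappa> * jp k * t0" using \<kappa> t0 by simp
    \<comment> \<open>The exponential smallness is used only through \<open>x \<le> exp x\<close>: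
      one power of \<open>jp k\<close> is all that is wanted.\<close>
    have "\<kappa> * jp k * t0 \<le> exp (\<kappa> * jp k * t0)" using exp_ge_add_one_self[of "\<kappa> * jp k * t0"] by linarith
    then have "exp (- (\<kappa> * jp k * t0)) \<le> 1 / (\<kappa> * jp k * t0)"
      using p by (simp add: exp_minus field_simps)
    then show "cmod (damp k t0) \<le> 1 / (\<kappa> * t0 * jp k)" using damp1[of t0] t0 by (simp add: mult_ac)
    have e: "exp (- (\<kappa> * jp k * t0)) \<le> 1" using p by simp
    show "cmod (damp k t0) \<le> 1" by (rule order_trans[OF damp1 e]) (use t0 in auto)
  qed
  have main: "cmod (a 0 k) \<le> (2 * (Cw * C1) + R / (\<kappa> * t0) + Cw * C3 / \<kappa>) * jp k powr (- s - 1) + cmod (?J N)" for N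
  proof -
    let ?D = "Cw * (C1 * jp k powr (- s - 1))"
    let ?I = "integral {0..t0} (\<lambda>t. damp k t * (c * nf_rest k (F N) t))"
    have nfb: "cmod (nf k (F N) t) \<le> ?D" "cmod (nf_rest k (F N) t) \<le> Cw * (C3 * jp k powr - s)" if "t \<in> {0..t0}" for t
      using F(2)[of N] that by (intro nf_bound Q F(1) Cw; blast)+
    have ci: "continuous_on {0..t0} (\<lambda>t. damp k t * (c * nf_rest k (F N) t))"
      "continuous_on {0..t0} (\<lambda>t. damp k t * (c * (nonres k t - nonres_part k (F N) t)))"
      by (intro continuous_intros continuous_damp continuous_nf_rest continuous_nonres continuous_nonres_part)+
    have "?J N - ?I = damp k t0 * (a t0 k - c * nf k (F N) t0) - (a 0 k - c * nf k (F N) 0)"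
      unfolding integral_diff[OF integrable_continuous_interval[OF ci(2)] integrable_continuous_interval[OF ci(1)], symmetric]
      by (rule integral_unique[OF normal_form_identity[OF F ph]])
    then have "a 0 k = c * nf k (F N) 0 + damp k t0 * a t0 k + - (damp k t0 * (c * nf k (F N) t0)) + ?I + - ?J N"
      by (simp add: algebra_simps)
    then have "cmod (a 0 k) \<le> cmod (c * nf k (F N) 0) + cmod (damp k t0 * a t0 k) + cmod (damp k t0 * (c * nf k (F N) t0))
       + cmod ?I + cmod (?J N)"
      by (metis (no_types, lifting) add_right_mono norm_minus_cancel norm_triangle_ineq norm_triangle_le)
    also have "cmod (c * nf k (F N) 0) \<le> ?D"
      using cmod_c(2)[of "nf k (F N) 0"] nfb(1)[of 0] t0 by simp
    also have "cmod (damp k t0 * a t0 k) \<le> 1 / (\<kappa> * t0 * jp k) * (R * jp k powr - s)"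
      unfolding norm_mult using damp_t0 sob_le_point(2)[OF bound] t0 \<kappa> by (intro mult_mono) auto
    also have "\<dots> = R / (\<kappa> * t0) * jp k powr (- s - 1)"
      by (simp flip: jp)
    also have "cmod (damp k t0 * (c * nf k (F N) t0)) \<le> 1 * ?D"
      unfolding norm_mult[of "damp k t0"]
      using damp_t0(2) order_trans[OF cmod_c(2) nfb(1)[of t0]] t0 by (intro mult_mono) auto
    also have "cmod ?I \<le> Cw * (C3 * jp k powr - s) / (\<kappa> * jp k)"
    proof (rule integral_exp_le)
      fix t assume t: "t \<in> {0..t0}"
      have "cmod (damp k t) * cmod (c * nf_rest k (F N) t) \<le> exp (- (\<kappa> * jp k * t)) * (Cw * (C3 * jp k powr - s))"
        using damp1[OF t] order_trans[OF cmod_c(2) nfb(2)[OF t]] by (intro mult_mono) auto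
      then show "cmod (damp k t * (c * nf_rest k (F N) t)) \<le> Cw * (C3 * jp k powr - s) * exp (- (\<kappa> * jp k * t))"
        by (simp only: norm_mult[of "damp k t"] mult.commute)
    qed (use ci \<kappa> Cw C_nonneg in auto)
    also have "Cw * (C3 * jp k powr - s) / (\<kappa> * jp k) = Cw * C3 / \<kappa> * jp k powr (- s - 1)"
      by (simp flip: jp)
    finally show ?thesis by (simp add: algebra_simps)
  qed
  \<comment> \<open>\<open>main\<close> holds for every box with the same constants, so growing
    boxes remove the truncation error. As k is fixed, the dominating constant may depend on
    it.\<close>
  have "?J \<longlonglongrightarrow> integral {0..t0} (\<lambda>t. 0)"
  proof (rule dominated_convergence)
    let ?M = "4 * K * jp k * (R * R * R)"
    fix N t assume t: "t \<in> {0..t0}"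
    have "cmod (damp k t) \<le> 1" using damp1[OF t] t \<kappa> by (smt (verit) atLeastAtMost_iff exp_le_one_iff jp_nn mult_nonneg_nonneg)
    moreover have "cmod (c * (nonres k t - nonres_part k (F N) t)) \<le> ?M + ?M"
      using order_trans[OF cmod_c(2) norm_triangle_ineq4] nonres_part_bound[OF t F(1)[of N]]
      by (meson add_mono order_trans)
    ultimately have "cmod (damp k t) * cmod (c * (nonres k t - nonres_part k (F N) t)) \<le> 1 * (?M + ?M)"
      by (intro mult_mono) auto
    then show "cmod (damp k t * (c * (nonres k t - nonres_part k (F N) t))) \<le> ?M + ?M"
      by (simp only: norm_mult[of "damp k t"])  simp
  next
    fix t assume t: "t \<in> {0..t0}"
    have "(\<lambda>N. damp k t * (c * (nonres k t - nonres_part k (F N) t))) \<longlonglongrightarrow> damp k t * (c * (nonres k t - nonres k t))"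
      unfolding F_def by (intro tendsto_intros nonres_part_tendsto t)
    then show "(\<lambda>N. damp k t * (c * (nonres k t - nonres_part k (F N) t))) \<longlonglongrightarrow> 0" by simp
  qed (intro integrable_continuous_interval continuous_intros continuous_damp continuous_nonres continuous_nonres_part)+
  then have "(\<lambda>N. (2 * (Cw * C1) + R / (\<kappa> * t0) + Cw * C3 / \<kappa>) * jp k powr (- s - 1) + cmod (?J N))
     \<longlonglongrightarrow> (2 * (Cw * C1) + R / (\<kappa> * t0) + Cw * C3 / \<kappa>) * jp k powr (- s - 1) + cmod 0"
    by (intro tendsto_intros) simp
  then show ?thesis
    using main by (intro LIMSEQ_le_const[of _ _ "cmod (a 0 k)"]) auto
qed

theorem initial_decay:
  obtains C k0 where "\<And>k. k0 \<le> k \<Longrightarrow> cmod (a 0 k) \<le> C * jp k powr (- s - 1)"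
proof -
  obtain \<delta> where \<delta>: "\<delta> > 0" "\<And>n. \<delta> * jp n \<le> \<bar>3 * \<alpha>1 * of_int n + 2 * \<alpha>2\<bar>"
    using nonresonant_lower_bound[OF \<alpha>1 nonresonant] by metis
  define Cw where "Cw = 8 * K / \<delta>"
  have Cw: "0 \<le> Cw" using \<delta>(1) K_nonneg by (simp add: Cw_def)
  \<comment> \<open>For large k the real part of \<open>res_coeff\<close> is at least
    \<open>\<Gamma> * m0 * jp k / 2\<close>, one half being given up to absorb \<open>j0\<close> and
    \<open>R^2\<close>; the remaining factor is c.\<close>
  define \<kappa> where "\<kappa> = \<Gamma> * m0 / (4 * pi)"
  have \<kappa>: "0 < \<kappa>" using \<Gamma>_pos m0 by (simp add: \<kappa>_def)
  \<comment> \<open>The third condition says that \<open>(1 + k) / 2 \<le> k - j0 - R^2 / m0\<close>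
    at k = \<open>k0\<close> and beyond, where \<open>jp k = 1 + k\<close>.\<close>
  obtain k0 :: int where k0: "0 \<le> k0" "j0 \<le> k0" "2 * of_int j0 + 2 * R\<^sup>2 / m0 + 1 \<le> of_int k0"
  proof
    let ?k = "max 0 (max j0 \<lceil>2 * of_int j0 + 2 * R\<^sup>2 / m0 + 1\<rceil>)"
    have "2 * of_int j0 + 2 * R\<^sup>2 / m0 + 1 \<le> of_int \<lceil>2 * of_int j0 + 2 * R\<^sup>2 / m0 + 1\<rceil>" by (rule le_of_int_ceiling)
    also have "\<dots> \<le> of_int ?k" by (simp only: of_int_le_iff)
    finally show "2 * of_int j0 + 2 * R\<^sup>2 / m0 + 1 \<le> of_int ?k" .
    show "0 \<le> ?k" "j0 \<le> ?k" by simp_all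
  qed
  have q: "phase k l m \<noteq> 0" "cmod (quot k l m) \<le> Cw * ker k l m" if "(l, m) \<in> good k" for k l m
  proof -
    have lm: "l \<noteq> k" "l + m \<noteq> 0" using that by (auto simp: good_def)
    note W = weight_over_phase[OF \<delta> lm]
    show "phase k l m \<noteq> 0" using W(1) unfolding phase_def .
    have "cmod (quot k l m) = cmod (w k l m) / \<bar>phase k l m\<bar>"
      by (simp add: quot_def norm_divide norm_mult)
    then show "cmod (quot k l m) \<le> Cw * ker k l m"
      using W(2)[of \<gamma>1 \<gamma>2 \<Gamma>] unfolding phase_def Cw_def K_def by simp
  qed
  have "cmod (a 0 k) \<le> (2 * (Cw * C1) + R / (\<kappa> * t0) + Cw * C3 / \<kappa>) * jp k powr (- s - 1)" if k: "k0 \<le> k" for k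
  proof (rule coefficient_bound[OF q(2) Cw q(1) \<kappa>])
    fix t assume t: "t \<in> {0..t0}"
    have kk: "2 * of_int j0 + 2 * R\<^sup>2 / m0 + 1 \<le> real_of_int k" using k0(3) k by linarith
    have "jp k / 2 * m0 \<le> of_int (k - j0) * m0 - R\<^sup>2"
    proof -
      have "0 \<le> k" using k k0 by linarith
      then have "jp k = 1 + of_int k" by (simp add: jp_def japanese_def)
      then have "jp k / 2 \<le> of_int (k - j0) - R\<^sup>2 / m0" using kk by simp
      from mult_right_mono[OF this, of m0] show ?thesis using m0 by (simp add: algebra_simps)
    qed
    from mult_left_mono[OF this, of \<Gamma>]
    have "\<Gamma> * (jp k / 2 * m0) \<le> Re (res_coeff k t)"
      using Re_res_coeff[OF t, of k] k k0 \<Gamma>_pos by linarith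
    from mult_left_mono[OF this, of "1 / (2 * pi)"]
    show "\<kappa> * jp k \<le> Re (rate k t)" by (simp add: rate_def \<kappa>_def field_simps)
  qed
  then show ?thesis using that by blast
qed

end

section \<open>Uniqueness of Fourier coefficients\<close>

definition char :: "int \<Rightarrow> real \<Rightarrow> complex" where
  "char k x = exp (\<i> * of_int k * of_real x)"

lemma char_cis: "char k x = cis (of_int k * x)"
  by (simp add: char_def cis_conv_exp mult_ac)

lemma norm_char [simp]: "cmod (char k x) = 1"
  by (simp add: char_cis)

lemma char_add: "char (j + k) x = char j x * char k x"
  by (simp add: char_cis cis_mult algebra_simps)

lemma continuous_char [continuous_intros]: "continuous_on A (char k)"
  unfolding char_def by (intro continuous_intros)

lemma measurable_char [measurable]: "char k \<in> borel_measurable borel"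
  by (rule borel_measurable_continuous_onI[OF continuous_char])

lemma char_periodic: "char k (x + 2 * pi) = char k x"
proof -
  have "cis (of_int k * (x + 2 * pi)) = cis (of_int k * x) * cis (2 * pi * of_int k)"
    by (simp add: cis_mult algebra_simps)
  also have "cis (2 * pi * of_int k) = 1"
    by (rule cis_multiple_2pi) simp
  finally show ?thesis by (simp add: char_cis)
qed

lemma fourier_char: "fourier f k = 1 / complex_of_real (sqrt (2 * pi)) * (LINT x:torus|lborel. char (- k) x * f x)"
  by (simp add: fourier_def char_def)

lemma integrable_bounded_mult:
  fixes h f :: "real \<Rightarrow> complex"
  assumes "integrable lborel h" "f \<in> borel_measurable borel" "\<And>x. cmod (f x) \<le> B"
  shows "integrable lborel (\<lambda>x. h x * f x)"
proof (rule Bochner_Integration.integrable_bound)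
  show "integrable lborel (\<lambda>x. of_real B * h x)" using assms(1) by simp
  show "AE x in lborel. cmod (h x * f x) \<le> cmod (of_real B * h x)"
  proof (intro AE_I2)
    fix x
    have "cmod (f x) \<le> \<bar>B\<bar>" using assms(3)[of x] by linarith
    then have "cmod (h x) * cmod (f x) \<le> cmod (h x) * \<bar>B\<bar>" by (rule mult_left_mono) simp
    then show "cmod (h x * f x) \<le> cmod (of_real B * h x)" by (simp add: norm_mult mult.commute)
  qed
  show "(\<lambda>x. h x * f x) \<in> borel_measurable lborel"
    using assms(2) borel_measurable_integrable[OF assms(1)] by simp
qed

lemma integrable_char_mult: "integrable lborel h \<Longrightarrow> integrable lborel (\<lambda>x. h x * char k x)"
  by (rule integrable_bounded_mult[where B = 1]) auto

text \<open>Stated for integrable functions on the line; the torus enters in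
  \<open>fourier_zero_AE\<close> through extension by zero.\<close>

definition char_orth :: "(real \<Rightarrow> complex) \<Rightarrow> bool" where
  "char_orth h \<longleftrightarrow> integrable lborel h \<and> (\<forall>k. (LINT x|lborel. h x * char k x) = 0)"

text \<open>Orthogonality to all characters is inherited by multiplication with a character, which
  makes the induction over polynomials in \<open>cis x\<close> work.\<close>

lemma char_orth_polynomial:
  assumes "real_polynomial_function p" "char_orth h"
  shows "char_orth (\<lambda>x. h x * of_real (p (cis x)))"
  using assms
proof (induction arbitrary: h)
  case (linear f)
  \<comment> \<open>On the unit circle a real-linear function is
    \<open>f 1 * cos x + f \<i> * sin x\<close>, a combination of the characters of frequency 1 and
    -1.\<close>
  have f: "of_real (f (cis x)) = (of_real (f 1) / 2 + of_real (f \<i>) / (2 * \<i>)) * char 1 x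
     + (of_real (f 1) / 2 - of_real (f \<i>) / (2 * \<i>)) * char (- 1) x" for x
  proof -
    have "cis x = cos x *\<^sub>R 1 + sin x *\<^sub>R \<i>" by (simp add: complex_eq_iff)
    then have "f (cis x) = cos x * f 1 + sin x * f \<i>"
      using linear_add[OF bounded_linear.linear[OF linear(1)]] linear_scale[OF bounded_linear.linear[OF linear(1)]]
      by simp
    then show ?thesis by (simp add: char_cis complex_eq_iff)
  qed
  obtain A B where AB: "\<And>x. of_real (f (cis x)) = A * char 1 x + B * char (- 1) x"
    using f by blast
  have e: "h x * of_real (f (cis x)) * char k x = A * (h x * char (k + 1) x) + B * (h x * char (k - 1) x)" for x k
    unfolding AB by (simp add: algebra_simps flip: char_add) 
  have h: "integrable lborel h" "\<And>k. (LINT x|lborel. h x * char k x) = 0"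
    using linear(2) by (auto simp: char_orth_def)
  note i = integrable_char_mult[OF h(1)]
  show ?case unfolding char_orth_def
  proof (intro conjI allI)
    have "integrable lborel (\<lambda>x. A * (h x * char 1 x) + B * (h x * char (- 1) x))"
      by (intro Bochner_Integration.integrable_add integrable_mult_right i)
    then show "integrable lborel (\<lambda>x. h x * of_real (f (cis x)))"
      unfolding AB by (simp add: algebra_simps)
    show "(LINT x|lborel. h x * of_real (f (cis x)) * char k x) = 0" for k
      unfolding e by (simp add: Bochner_Integration.integral_add integrable_mult_right i h(2))
  qed
next
  case (const c)
  then show ?case by (auto simp: char_orth_def mult.assoc mult.left_commute[of _ "of_real c"])
next
  case (add f g)
  from add.IH(1)[OF add.prems] add.IH(2)[OF add.prems] show ?case
    by (auto simp: char_orth_def distrib_left distrib_right Bochner_Integration.integral_add integrable_char_mult)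
next
  case (mult f g)
  from mult.IH(2)[OF mult.IH(1)[OF mult.prems]] show ?case by (simp add: mult_ac)
qed

text \<open>Stone-Weierstrass on the circle: real polynomials approximate g uniformly, and a uniform
  error is harmless against an integrable h. The pairing with a polynomial is zero by the character
  of frequency 0.\<close>

lemma char_orth_continuous:
  assumes h: "char_orth h" and g: "continuous_on UNIV g"
  shows "(LINT x|lborel. h x * of_real (g (cis x))) = 0"
proof -
  have hi: "integrable lborel h" using h by (simp add: char_orth_def)
  have contg: "continuous_on (sphere 0 1) g" using g by (rule continuous_on_subset) simp
  have "bounded (g ` sphere 0 1)"
    by (intro compact_imp_bounded compact_continuous_image[OF contg]) simp
  then obtain B where "\<forall>y\<in>g ` sphere 0 1. norm y \<le> B"
    unfolding bounded_iff by blast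
  then have B: "\<bar>g z\<bar> \<le> B" if "z \<in> sphere 0 1" for z using that by auto
  have gm: "(\<lambda>x. of_real (g (cis x)) :: complex) \<in> borel_measurable borel"
    by (intro borel_measurable_continuous_onI continuous_intros continuous_on_compose2[OF g]) auto
  have gi: "integrable lborel (\<lambda>x. h x * of_real (g (cis x)))"
    by (rule integrable_bounded_mult[OF hi gm, of B]) (use B in auto)
  define H where "H = (LINT x|lborel. cmod (h x))"
  have H: "0 \<le> H" by (simp add: H_def)
  have le: "cmod (LINT x|lborel. h x * of_real (g (cis x))) \<le> e * H" if e: "e > 0" for e
  proof -
    obtain p where p: "real_polynomial_function p" "\<And>z. z \<in> sphere 0 1 \<Longrightarrow> \<bar>g z - p z\<bar> < e"
      using Stone_Weierstrass_real_polynomial_function[OF compact_sphere contg e] by metis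
    have po: "char_orth (\<lambda>x. h x * of_real (p (cis x)))" by (rule char_orth_polynomial[OF p(1) h])
    then have pi: "integrable lborel (\<lambda>x. h x * of_real (p (cis x)))" and
      p0: "(LINT x|lborel. h x * of_real (p (cis x)) * char 0 x) = 0"
      unfolding char_orth_def by blast+
    have "(LINT x|lborel. h x * of_real (g (cis x))) = (LINT x|lborel. h x * of_real (g (cis x)) - h x * of_real (p (cis x)))"
      using gi pi p0 by (simp add: Bochner_Integration.integral_diff char_def)
    also have "cmod \<dots> \<le> (LINT x|lborel. e * cmod (h x))"
    proof (rule Bochner_Integration.integral_norm_bound_integral)
      fix x
      have "\<bar>g (cis x) - p (cis x)\<bar> \<le> e" using p(2)[of "cis x"] by (simp add: less_imp_le)
      then have "cmod (h x) * \<bar>g (cis x) - p (cis x)\<bar> \<le> cmod (h x) * e" by (rule mult_left_mono) simp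
      then show "cmod (h x * of_real (g (cis x)) - h x * of_real (p (cis x))) \<le> e * cmod (h x)"
        by (simp add: norm_mult mult.commute flip: right_diff_distrib of_real_diff)
    qed (use gi pi hi in auto)
    also have "\<dots> = e * H" by (simp add: H_def)
    finally show ?thesis .
  qed
  have "cmod (LINT x|lborel. h x * of_real (g (cis x))) \<le> 0"
  proof (rule field_le_epsilon)
    fix e :: real assume e: "e > 0"
    then have "e / (H + 1) > 0" using H by simp
    from le[OF this] have "cmod (LINT x|lborel. h x * of_real (g (cis x))) \<le> e * (H / (H + 1))" by simp
    also have "\<dots> \<le> e * 1" using H e by (intro mult_left_mono) auto
    finally show "cmod (LINT x|lborel. h x * of_real (g (cis x))) \<le> 0 + e" by simp
  qed
  then show ?thesis by simp
qed

text \<open>The indicator is the limit of the continuous functions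
  \<open>min 1 (n * infdist z (- O'))\<close>. The complement has to be nonempty, as
  \<open>infdist\<close> to the empty set is 0.\<close>

lemma char_orth_open:
  assumes h: "char_orth h" and O: "open O'" "O' \<noteq> UNIV"
  shows "(LINT x|lborel. h x * of_real (indicator O' (cis x))) = 0"
proof -
  have hi: "integrable lborel h" using h by (simp add: char_orth_def)
  define g where "g = (\<lambda>n z. min 1 (real n * infdist z (- O')))"
  have g: "continuous_on UNIV (g n)" for n
    unfolding g_def by (intro continuous_intros)
  have O'm: "O' \<in> sets borel" using O by simp
  have im: "(\<lambda>x. of_real (indicator O' (cis x)) :: complex) \<in> borel_measurable borel"
  proof -
    have "cis \<in> borel_measurable borel" by (intro borel_measurable_continuous_onI continuous_intros)
    then have "(\<lambda>x. indicator O' (cis x) :: real) \<in> borel_measurable borel"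
      using O'm by measurable
    then show ?thesis by measurable
  qed
  have gm: "(\<lambda>x. of_real (g n (cis x)) :: complex) \<in> borel_measurable borel" for n
    by (intro borel_measurable_continuous_onI continuous_intros continuous_on_compose2[OF g]) auto
  have "(\<lambda>n. LINT x|lborel. h x * of_real (g n (cis x))) \<longlonglongrightarrow> (LINT x|lborel. h x * of_real (indicator O' (cis x)))"
  proof (rule integral_dominated_convergence[where w = "\<lambda>x. cmod (h x)"])
    show "(\<lambda>x. h x * of_real (indicator O' (cis x))) \<in> borel_measurable lborel"
      using im borel_measurable_integrable[OF hi] by simp
    show "(\<lambda>x. h x * of_real (g n (cis x))) \<in> borel_measurable lborel" for n
      using gm borel_measurable_integrable[OF hi] by simp
    show "integrable lborel (\<lambda>x. cmod (h x))" using hi by simp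
    show "AE x in lborel. (\<lambda>n. h x * of_real (g n (cis x))) \<longlonglongrightarrow> h x * of_real (indicator O' (cis x))"
    proof (intro AE_I2 tendsto_intros)
      fix x
      show "(\<lambda>n. g n (cis x)) \<longlonglongrightarrow> indicator O' (cis x)"
      proof (cases "cis x \<in> O'")
        case True
        have "infdist (cis x) (- O') > 0"
          using O True infdist_pos_not_in_closed[of "- O'" "cis x"] by (auto simp: closed_def)
        then obtain N where N: "1 < real N * infdist (cis x) (- O')" using ex_less_of_nat_mult by blast
        have "g n (cis x) = 1" if "N \<le> n" for n
        proof -
          have "real N * infdist (cis x) (- O') \<le> real n * infdist (cis x) (- O')"
            using that by (intro mult_right_mono infdist_nonneg) auto
          then show ?thesis using N by (simp add: g_def)
        qed
        then show ?thesis using True by (intro tendsto_eventually) (auto simp: eventually_sequentially)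
      next
        case False
        then show ?thesis by (simp add: g_def)
      qed
    qed
    show "AE x in lborel. cmod (h x * of_real (g n (cis x))) \<le> cmod (h x)" for n
    proof (intro AE_I2)
      fix x
      have "\<bar>g n (cis x)\<bar> \<le> 1" by (auto simp: g_def infdist_nonneg)
      then have "cmod (h x) * \<bar>g n (cis x)\<bar> \<le> cmod (h x) * 1" by (intro mult_left_mono) auto
      then show "cmod (h x * of_real (g n (cis x))) \<le> cmod (h x)" by (simp add: norm_mult)
    qed
  qed
  then show ?thesis using char_orth_continuous[OF h g] by (simp add: LIMSEQ_const_iff)
qed

text \<open>Orthogonality passes from continuous functions on the circle to open sets and, by a
  Dynkin system argument, to Borel sets of the line; then the real and imaginary parts have the same
  integrals as 0 over all Borel sets.\<close>

theorem fourier_zero_AE: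
  assumes d: "set_integrable lborel torus d" and z: "\<And>k. fourier d k = 0"
  shows "AE x in lborel. x \<in> torus \<longrightarrow> d x = 0"
proof -
  \<comment> \<open>The endpoints, a null set, are removed because on the open interval
    \<open>Arg2pi\<close> inverts \<open>cis\<close> continuously.\<close>
  define h where "h = (\<lambda>x. indicator {0<..<2 * pi} x *\<^sub>R d x)"
  have d': "set_integrable lborel {0<..<2 * pi} d"
    by (rule set_integrable_subset[OF d]) auto
  have hi: "integrable lborel h" using d' by (simp add: h_def set_integrable_def)
  have null: "AE x in lborel. x \<noteq> 0 \<and> x \<noteq> 2 * pi"
    using AE_lborel_singleton[of 0] AE_lborel_singleton[of "2 * pi"] by eventually_elim simp
  have h: "char_orth h" unfolding char_orth_def
  proof (intro conjI allI hi)
    fix k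
    have "(LINT x|lborel. h x * char k x) = (LINT x:torus|lborel. char k x * d x)"
      unfolding set_lebesgue_integral_def
    proof (rule integral_cong_AE)
      show "AE x in lborel. h x * char k x = indicator torus x *\<^sub>R (char k x * d x)"
        using null by eventually_elim (auto simp: h_def indicator_def)
      show "(\<lambda>x. h x * char k x) \<in> borel_measurable lborel"
        using borel_measurable_integrable[OF hi] by simp
      have "(\<lambda>x. char k x * (indicator torus x *\<^sub>R d x)) \<in> borel_measurable lborel"
        using borel_measurable_integrable[OF d[unfolded set_integrable_def]] by (intro borel_measurable_times) auto
      moreover have "(\<lambda>x. indicator torus x *\<^sub>R (char k x * d x)) = (\<lambda>x. char k x * (indicator torus x *\<^sub>R d x))"
        by (simp add: fun_eq_iff)
      ultimately show "(\<lambda>x. indicator torus x *\<^sub>R (char k x * d x)) \<in> borel_measurable lborel" by (simp only:)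
    qed
    also have "\<dots> = 0" using z[of "- k"] by (simp add: fourier_char)
    finally show "(LINT x|lborel. h x * char k x) = 0" .
  qed
  have hU: "(LINT x:U|lborel. h x) = 0" if U: "open U" for U
  proof -
    \<comment> \<open>An open set of the plane that meets the unit circle exactly in the image of
      \<open>U \<inter> {0<..<2 * pi}\<close>; the ray on which \<open>Arg2pi\<close> jumps is cut
      out.\<close>
    define O' where "O' = (- nonneg_Reals) \<inter> Arg2pi -` U"
    have c: "continuous_on (- nonneg_Reals) Arg2pi"
      by (intro continuous_at_imp_continuous_on ballI continuous_at_Arg2pi) auto
    have "open (- nonneg_Reals :: complex set)" using closed_nonneg_Reals_complex by auto
    then have "open O'" unfolding O'_def using continuous_open_preimage[OF c _ U] by auto
    moreover have "0 \<notin> O'" by (simp add: O'_def)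
    then have "O' \<noteq> UNIV" by blast
    ultimately have "(LINT x|lborel. h x * of_real (indicator O' (cis x))) = 0"
      by (rule char_orth_open[OF h])
    moreover have "h x * of_real (indicator O' (cis x)) = indicator U x *\<^sub>R h x" for x
    proof (cases "0 < x \<and> x < 2 * pi")
      case True
      have A: "Arg2pi (cis x) = x"
        using Arg2pi_unique[of 1 x "cis x"] True by (simp add: cis_conv_exp)
      have "cis x \<notin> nonneg_Reals"
        using A True Arg2pi_eq_0[of "cis x"] by (auto simp: complex_nonneg_Reals_iff complex_is_Real_iff)
      then show ?thesis using A by (auto simp: O'_def indicator_def)
    qed (auto simp: h_def)
    ultimately show ?thesis by (simp add: set_lebesgue_integral_def)
  qed
  have hA: "(LINT x:A|lborel. h x) = 0" if "A \<in> sets borel" for A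
  proof -
    have "Int_stable {S :: real set. open S}" by (auto simp: Int_stable_def)
    moreover have "{S :: real set. open S} \<subseteq> Pow UNIV" by simp
    moreover have "A \<in> sigma_sets UNIV {S. open S}" using that by (simp add: borel_def)
    ultimately show ?thesis
    proof (induction rule: sigma_sets_induct_disjoint)
      case (basic B)
      then show ?case by (simp add: hU)
    next
      case (compl B)
      then have B: "B \<in> sets lborel" by (simp add: borel_def)
      have "(LINT x:B \<union> (UNIV - B)|lborel. h x) = (LINT x:B|lborel. h x) + (LINT x:UNIV - B|lborel. h x)"
        by (rule set_integral_Un) (use hi B in \<open>auto simp: set_integrable_def intro!: integrable_mult_indicator\<close>)
      then show ?case using compl hU[of UNIV] by simp
    next
      case (union B)
      then have B: "B i \<in> sets lborel" for i by (auto simp: borel_def)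
      have "(LINT x:(\<Union>i. B i)|lborel. h x) = (\<Sum>i. (LINT x:(B i)|lborel. h x))"
        by (rule lebesgue_integral_countable_add)
           (use B union(1) hi in \<open>auto simp: disjoint_family_on_def set_integrable_def intro!: integrable_mult_indicator\<close>)
      then show ?case using union by simp
    qed (simp add: set_lebesgue_integral_def)
  qed
  have hiA: "set_integrable lborel A h" if "A \<in> sets borel" for A
    using hi that by (auto simp: set_integrable_def intro!: integrable_mult_indicator)
  have AE: "AE x in lborel. L (h x) = 0" if L: "bounded_linear L" for L :: "complex \<Rightarrow> real"
  proof (rule density_unique_real)
    show "integrable lborel (\<lambda>x. L (h x))" by (rule integrable_bounded_linear[OF L hi])
    fix A :: "real set" assume "A \<in> sets lborel"
    then have A: "A \<in> sets borel" by simp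
    have "(LINT x:A|lborel. L (h x)) = L (LINT x:A|lborel. h x)"
      using integral_bounded_linear[OF L hiA[OF A, unfolded set_integrable_def]]
      by (simp add: set_lebesgue_integral_def linear_scale[OF bounded_linear.linear[OF L]])
    then show "(LINT x:A|lborel. L (h x)) = (LINT x:A|lborel. 0)"
      using hA[OF A] by (simp add: linear_0[OF bounded_linear.linear[OF L]])
  qed simp
  from AE[OF bounded_linear_Re] AE[OF bounded_linear_Im] null show ?thesis
    by eventually_elim (auto simp: h_def complex_eq_iff indicator_def split: if_splits)
qed

section \<open>Absolutely convergent Fourier series\<close>

text \<open>The frequency is a function of an arbitrary index, so that a product of two series is
  again such a series, over pairs of indices, without regrouping.\<close>

definition trig :: "('i \<Rightarrow> complex) \<Rightarrow> ('i \<Rightarrow> int) \<Rightarrow> real \<Rightarrow> complex" where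
  "trig c n x = (\<Sum>\<^sub>\<infinity>i. c i * char (n i) x)"

lemma trig_uniform_limit:
  assumes "sum_le (\<lambda>i. cmod (c i)) C"
  shows "uniform_limit A (\<lambda>F x. \<Sum>i\<in>F. c i * char (n i) x) (trig c n) (finite_subsets_at_top UNIV)"
  using Weierstrass_m_test_general[of UNIV A "\<lambda>i x. c i * char (n i) x" "\<lambda>i. cmod (c i)"]
    sum_le_summable(2)[OF assms] by (simp add: norm_mult trig_def[abs_def])

lemma continuous_trig:
  assumes "sum_le (\<lambda>i. cmod (c i)) C" shows "continuous_on A (trig c n)"
proof (rule uniform_limit_theorem[OF _ trig_uniform_limit[OF assms]])
  show "\<forall>\<^sub>F F in finite_subsets_at_top UNIV. continuous_on A (\<lambda>x. \<Sum>i\<in>F. c i * char (n i) x)"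
    by (intro always_eventually allI continuous_intros)
qed simp

lemma trig_periodic: "periodic (trig c n)"
  by (simp add: periodic_def trig_def char_periodic)

lemma trig_measurable:
  assumes "sum_le (\<lambda>i. cmod (c i)) C" shows "trig c n \<in> borel_measurable borel"
  by (rule borel_measurable_continuous_onI[OF continuous_trig[OF assms]])

lemma integral_char: "(char j has_integral (if j = 0 then 2 * pi else 0)) torus"
proof (cases "j = 0")
  case True
  then show ?thesis using has_integral_const_real[of "1 :: complex" 0 "2 * pi"]
    by (simp add: char_def[abs_def] scaleR_conv_of_real)
next
  case False
  have "(char j has_integral char j (2 * pi) / (\<i> * of_int j) - char j 0 / (\<i> * of_int j)) torus"
  proof (rule fundamental_theorem_of_calculus)
    fix x
    have "((\<lambda>x. exp (\<i> * of_int j * of_real x) / (\<i> * of_int j)) has_vector_derivative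
       (\<i> * of_int j * exp (\<i> * of_int j * of_real x)) / (\<i> * of_int j)) (at x within torus)"
      by (rule has_vector_derivative_real_field) (auto intro!: derivative_eq_intros)
    then show "((\<lambda>x. char j x / (\<i> * of_int j)) has_vector_derivative char j x) (at x within torus)"
      using False by (simp add: char_def)
  qed simp
  moreover have "char j (2 * pi) = char j 0" using char_periodic[of j 0] by simp
  ultimately show ?thesis using False by simp
qed

lemma set_integrable_torus: "continuous_on torus f \<Longrightarrow> set_integrable lborel torus (f :: real \<Rightarrow> complex)"
  by (rule borel_integrable_atLeastAtMost')

lemma fourier_trig:
  fixes c :: "'i \<Rightarrow> complex"
  assumes c: "sum_le (\<lambda>i. cmod (c i)) C"
  shows "fourier (trig c n) k = sqrt (2 * pi) * (\<Sum>\<^sub>\<infinity>i. if n i = k then c i else 0)"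
proof -
  have eq: "char (- k) x * trig c n x = trig c (\<lambda>i. n i - k) x" for x
    unfolding trig_def by (subst infsum_cmult_right'[symmetric]) (auto intro!: infsum_cong simp: mult_ac simp flip: char_add)
  obtain I J where IJ: "\<And>F. ((\<lambda>x. \<Sum>i\<in>F. c i * char (n i - k) x) has_integral I F) torus"
    "(trig c (\<lambda>i. n i - k) has_integral J) torus" "(I \<longlongrightarrow> J) (finite_subsets_at_top UNIV)"
    by (rule uniform_limit_integral[OF trig_uniform_limit[OF c, where A = torus and n = "\<lambda>i. n i - k"]]) (auto intro!: continuous_intros)
  have "I F = (\<Sum>i\<in>F. c i * (if n i - k = 0 then 2 * pi else 0))" if "finite F" for F
    by (rule has_integral_unique[OF IJ(1)]) (intro has_integral_sum that has_integral_mult_right integral_char)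
  then have "(sum (\<lambda>i. 2 * pi * (if n i = k then c i else 0)) \<longlongrightarrow> J) (finite_subsets_at_top UNIV)"
    by (intro Lim_transform_eventually[OF IJ(3)] eventually_finite_subsets_at_top_weakI)
       (auto intro!: sum.cong simp: mult_ac)
  then have "(\<Sum>\<^sub>\<infinity>i. 2 * pi * (if n i = k then c i else 0)) = J"
    by (intro infsumI) (simp add: has_sum_def)
  then have J: "J = 2 * pi * (\<Sum>\<^sub>\<infinity>i. if n i = k then c i else 0)"
    by (simp only: infsum_cmult_right')
  have "(LINT x:torus|lborel. trig c (\<lambda>i. n i - k) x) = J"
    using set_borel_integral_eq_integral(2)[OF set_integrable_torus[OF continuous_trig[OF c]]] IJ(2)
    by (simp add: has_integral_iff)
  then have "fourier (trig c n) k = 1 / complex_of_real (sqrt (2 * pi)) * J"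
    unfolding fourier_char eq by simp
  also have "\<dots> = complex_of_real (2 * pi / sqrt (2 * pi)) * (\<Sum>\<^sub>\<infinity>i. if n i = k then c i else 0)"
    unfolding J by (simp add: of_real_divide)
  also have "2 * pi / sqrt (2 * pi) = sqrt (2 * pi)" by (rule real_div_sqrt) simp
  finally show ?thesis .
qed

lemma trig_mult:
  assumes c: "sum_le (\<lambda>i. cmod (c i)) C" and d: "sum_le (\<lambda>i. cmod (d i)) D"
  shows "trig c n x * trig d m x = trig (\<lambda>(i, j). c i * d j) (\<lambda>(i, j). n i + m j) x"
    and "sum_le (\<lambda>i. cmod (case i of (i, j) \<Rightarrow> c i * d j)) (C * D)"
proof -
  show s: "sum_le (\<lambda>i. cmod (case i of (i, j) \<Rightarrow> c i * d j)) (C * D)"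
    using sum_le_prod[OF c d] by (simp add: case_prod_unfold norm_mult)
  let ?f = "\<lambda>(i, j). c i * d j * char (n i + m j) x"
  have "sum_le (\<lambda>i. norm (?f i)) (C * D)"
    using s by (simp add: case_prod_unfold norm_mult)
  then have "?f summable_on UNIV \<times> UNIV" by (rule sum_le_summable(1))
  then have "infsum ?f UNIV = (\<Sum>\<^sub>\<infinity>i. \<Sum>\<^sub>\<infinity>j. c i * char (n i) x * (d j * char (m j) x))"
    using infsum_Sigma_banach[of ?f UNIV "\<lambda>_. UNIV"] by (simp add: char_add mult_ac)
  also have "\<dots> = trig c n x * trig d m x"
    by (simp only: infsum_cmult_right' infsum_cmult_left' trig_def)
  finally show "trig c n x * trig d m x = trig (\<lambda>(i, j). c i * d j) (\<lambda>(i, j). n i + m j) x"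
    by (simp add: trig_def case_prod_unfold)
qed

section \<open>Sobolev functions as absolutely convergent series\<close>

definition series :: "(int \<Rightarrow> complex) \<Rightarrow> real \<Rightarrow> complex" where
  "series a = trig (\<lambda>k. a k / complex_of_real (sqrt (2 * pi))) (\<lambda>k. k)"

lemma series_coeffs_summable:
  assumes "sum_le (\<lambda>k. cmod (a k)) C" shows "sum_le (\<lambda>k. cmod (a k / complex_of_real (sqrt (2 * pi)))) (C / sqrt (2 * pi))"
  using sum_le_cmult[OF assms, of "1 / sqrt (2 * pi)"] by (simp add: norm_divide)

lemma fourier_series:
  assumes "sum_le (\<lambda>k. cmod (a k)) C" shows "fourier (series a) k = a k"
proof -
  have "(\<Sum>\<^sub>\<infinity>i. if i = k then a i / complex_of_real (sqrt (2 * pi)) else 0) = a k / complex_of_real (sqrt (2 * pi))"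
    by (subst infsum_cong_neutral[where T = "{k}" and g = "\<lambda>i. a i / complex_of_real (sqrt (2 * pi))"]) auto
  then show ?thesis
    unfolding series_def fourier_trig[OF series_coeffs_summable[OF assms]] by simp
qed

lemma cnj_series: "cnj (series a x) = series (refl_cnj a) x"
proof -
  have "cnj (series a x) = (\<Sum>\<^sub>\<infinity>k. cnj (a k) / complex_of_real (sqrt (2 * pi)) * char (- k) x)"
    by (simp add: series_def trig_def flip: infsum_cnj) (simp add: char_cis cis_cnj)
  also have "\<dots> = (\<Sum>\<^sub>\<infinity>k\<in>range uminus. refl_cnj a k / complex_of_real (sqrt (2 * pi)) * char k x)"
    by (subst infsum_reindex) (auto simp: inj_def o_def refl_cnj_def)
  finally show ?thesis by (simp add: series_def trig_def)
qed

lemma fourier_cong_AE: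
  assumes "f \<in> borel_measurable borel" "g \<in> borel_measurable borel" "AE x in lborel. x \<in> torus \<longrightarrow> f x = g x"
  shows "fourier f k = fourier g k"
  unfolding fourier_char using assms
  by (intro arg_cong2[where f = times] refl set_lebesgue_integral_cong_AE) auto

lemma sobolev_seq_sob_le: "sobolev_seq s a \<Longrightarrow> sob_le s a (sobolev_seq_norm s a)"
proof -
  assume a: "sobolev_seq s a"
  let ?f = "\<lambda>j. (jp j powr s * cmod (a j))\<^sup>2"
  have f: "?f summable_on UNIV" using a by (simp add: sobolev_seq_def jp_def)
  have n: "sobolev_seq_norm s a = sqrt (infsum ?f UNIV)" by (simp add: sobolev_seq_norm_def jp_def)
  have "sum ?f F \<le> infsum ?f UNIV" if "finite F" for F
    using f that by (intro finite_sum_le_infsum) auto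
  moreover have "0 \<le> infsum ?f UNIV" by (intro infsum_nonneg) auto
  ultimately show ?thesis by (simp add: sob_le_def sum_le_def n)
qed

lemma sobolev_set_integrable:
  assumes "f \<in> sobolev s" shows "set_integrable lborel torus f"
proof -
  have 1: "set_integrable lborel torus (\<lambda>x. 1 :: real)" by (rule borel_integrable_atLeastAtMost') simp
  show ?thesis
  proof (rule set_integrable_bound[where f = "\<lambda>x. 1 + (cmod (f x))\<^sup>2"])
  show "set_integrable lborel torus (\<lambda>x. 1 + (cmod (f x))\<^sup>2)"
    using assms by (intro set_integral_add 1) (auto simp: sobolev_def)
  show "set_borel_measurable lborel torus f"
    using assms by (auto simp: sobolev_def set_borel_measurable_def)
  show "AE x in lborel. x \<in> torus \<longrightarrow> norm (f x) \<le> norm (1 + (cmod (f x))\<^sup>2)"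
  proof (intro AE_I2 impI)
    fix x
    have "cmod (f x) \<le> 1 + (cmod (f x))\<^sup>2"
      using zero_le_power2[of "cmod (f x) - 1 / 2"] by (simp add: power2_eq_square algebra_simps)
    then show "norm (f x) \<le> norm (1 + (cmod (f x))\<^sup>2)" by simp
  qed
  qed
qed

text \<open>Both sides have the same coefficients, so \<open>fourier_zero_AE\<close> applies to
  their difference. Nonlinear expressions in \<open>f\<close> can then be computed from the
  series.\<close>

lemma sobolev_AE_series:
  assumes f: "f \<in> sobolev s" and C: "sum_le (\<lambda>k. cmod (fourier f k)) C"
  shows "AE x in lborel. x \<in> torus \<longrightarrow> f x = series (fourier f) x"
proof -
  define S where "S = series (fourier f)"
  have FS: "fourier S k = fourier f k" for k unfolding S_def by (rule fourier_series[OF C])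
  have Si: "set_integrable lborel torus S"
    unfolding S_def series_def by (intro set_integrable_torus continuous_trig[OF series_coeffs_summable[OF C]])
  have m: "char j \<in> borel_measurable borel" for j by simp
  have ci: "set_integrable lborel torus (\<lambda>x. char j x * g x)" if "set_integrable lborel torus g" for g j
    using integrable_char_mult[OF that[unfolded set_integrable_def], of j]
    by (simp add: set_integrable_def mult_ac scaleR_conv_of_real)
  note fi = sobolev_set_integrable[OF f]
  have "fourier (\<lambda>x. f x - S x) k = 0" for k
    using set_integral_diff(2)[OF ci[OF fi, of "- k"] ci[OF Si, of "- k"]] FS[of k]
    by (simp add: fourier_char algebra_simps)
  then have "AE x in lborel. x \<in> torus \<longrightarrow> f x - S x = 0"
    by (intro fourier_zero_AE set_integral_diff fi Si)
  then show ?thesis by (simp add: S_def)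
qed

section \<open>Fourier coefficients of the nonlinear terms\<close>

context
  fixes f :: "real \<Rightarrow> complex" and s :: real
  assumes f: "f \<in> sobolev s" and s: "1 \<le> s"
begin

lemma sobolev_coeffs: "sob_le s (fourier f) (sobolev_norm s f)"
  using f sobolev_seq_sob_le by (auto simp: sobolev_def sobolev_norm_def)

lemma sobolev_coeffs_h1: "sob_le 1 (fourier f) (sobolev_norm s f)"
  using sobolev_coeffs s by (rule sob_le_mono) simp

lemma coeffs_l1: "sum_le (\<lambda>k. cmod (fourier f k)) (2 * sobolev_norm s f)"
  "sum_le (\<lambda>k. cmod (refl_cnj (fourier f) k)) (2 * sobolev_norm s f)"
  by (rule sob_le_l1 sob_le_refl_cnj sobolev_coeffs_h1)+

lemma sobolev_measurable: "f \<in> borel_measurable borel"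
  using f by (simp add: sobolev_def)

lemma sobolev_AE_eq_series: "AE x in lborel. x \<in> torus \<longrightarrow> f x = series (fourier f) x"
  by (rule sobolev_AE_series[OF f coeffs_l1(1)])

abbreviation "root_2pi \<equiv> complex_of_real (sqrt (2 * pi))"

lemma square_trig:
  "complex_of_real ((cmod (series (fourier f) x))\<^sup>2) =
     trig (\<lambda>(l, m). fourier f l / root_2pi * (refl_cnj (fourier f) m / root_2pi)) (\<lambda>(l, m). l + m) x"
  and square_trig_summable:
  "sum_le (\<lambda>i. cmod (case i of (l, m) \<Rightarrow> fourier f l / root_2pi * (refl_cnj (fourier f) m / root_2pi)))
     (2 * sobolev_norm s f / sqrt (2 * pi) * (2 * sobolev_norm s f / sqrt (2 * pi)))"
  using trig_mult[OF series_coeffs_summable[OF coeffs_l1(1)] series_coeffs_summable[OF coeffs_l1(2)]]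
  by (simp_all only: complex_norm_square cnj_series) (simp_all only: series_def)

lemma fourier_abs_square:
  "fourier (\<lambda>x. complex_of_real ((cmod (f x))\<^sup>2)) q = 1 / root_2pi * (\<Sum>\<^sub>\<infinity>l. fourier f l * refl_cnj (fourier f) (q - l))"
proof -
  let ?a = "fourier f" and ?y = "refl_cnj (fourier f)"
  let ?c = "\<lambda>(l, m). ?a l / root_2pi * (?y m / root_2pi)"
  have "fourier (\<lambda>x. complex_of_real ((cmod (f x))\<^sup>2)) q = fourier (trig ?c (\<lambda>(l, m). l + m)) q"
  proof (rule fourier_cong_AE)
    show "(\<lambda>x. complex_of_real ((cmod (f x))\<^sup>2)) \<in> borel_measurable borel" using sobolev_measurable by measurable
    show "trig ?c (\<lambda>(l, m). l + m) \<in> borel_measurable borel" by (rule trig_measurable[OF square_trig_summable])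
    show "AE x in lborel. x \<in> torus \<longrightarrow> complex_of_real ((cmod (f x))\<^sup>2) = trig ?c (\<lambda>(l, m). l + m) x"
      using sobolev_AE_eq_series
    proof eventually_elim
      case (elim x)
      then show ?case using square_trig[of x] by metis
    qed
  qed
  also have "\<dots> = root_2pi * (\<Sum>\<^sub>\<infinity>i. if (case i of (l, m) \<Rightarrow> l + m) = q then ?c i else 0)"
    by (rule fourier_trig[OF square_trig_summable])
  also have "(\<Sum>\<^sub>\<infinity>i. if (case i of (l, m) \<Rightarrow> l + m) = q then ?c i else 0) = (\<Sum>\<^sub>\<infinity>i\<in>range (\<lambda>l. (l, q - l)). ?c i)"
    by (rule infsum_cong_neutral) (auto simp: image_iff)
  also have "\<dots> = (\<Sum>\<^sub>\<infinity>l. ?a l / root_2pi * (?y (q - l) / root_2pi))"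
    by (subst infsum_reindex) (auto simp: inj_def o_def)
  also have "\<dots> = (\<Sum>\<^sub>\<infinity>l. 1 / root_2pi * (1 / root_2pi) * (?a l * ?y (q - l)))" by (simp add: field_simps)
  also have "\<dots> = 1 / root_2pi * (1 / root_2pi) * (\<Sum>\<^sub>\<infinity>l. ?a l * ?y (q - l))" by (simp only: infsum_cmult_right')
  finally show ?thesis by simp
qed

lemma cubic_trig:
  fixes c d
  defines "c \<equiv> (\<lambda>(i, n). (case i of (l, m) \<Rightarrow> fourier f l / root_2pi * (refl_cnj (fourier f) m / root_2pi)) * (fourier f n / root_2pi))"
    and "d \<equiv> (\<lambda>(i, n). (case i of (l, m) \<Rightarrow> l + m) + n)"
  shows "complex_of_real ((cmod (series (fourier f) x))\<^sup>2) * series (fourier f) x = trig c d x"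
    and "\<exists>C. sum_le (\<lambda>i. cmod (c i)) C"
  using trig_mult[OF square_trig_summable series_coeffs_summable[OF coeffs_l1(1)]]
  unfolding square_trig c_def d_def by (auto simp only: series_def)

lemma cubic_integrable:
  "set_integrable lborel torus (\<lambda>x. complex_of_real ((cmod (f x))\<^sup>2) * f x)"
  and fourier_cubic:
  "fourier (\<lambda>x. complex_of_real ((cmod (f x))\<^sup>2) * f x) k
     = complex_of_real (1 / (2 * pi)) * tri k (\<lambda>l m. 1) (fourier f) (refl_cnj (fourier f)) (fourier f)"
proof -
  let ?a = "fourier f" and ?y = "refl_cnj (fourier f)"
  define c where "c = (\<lambda>(i, n). (case i of (l, m) \<Rightarrow> ?a l / root_2pi * (?y m / root_2pi)) * (?a n / root_2pi))"
  define d where "d = (\<lambda>(i, n). (case i of (l, m) \<Rightarrow> l + m) + n :: int)"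
  have eq: "complex_of_real ((cmod (series ?a x))\<^sup>2) * series ?a x = trig c d x" for x
    unfolding c_def d_def by (rule cubic_trig(1))
  obtain C where C: "sum_le (\<lambda>i. cmod (c i)) C" using cubic_trig(2) unfolding c_def by blast
  have "root_2pi * root_2pi = complex_of_real (2 * pi)" by (simp flip: of_real_mult)
  then have nc3: "root_2pi * (1 / root_2pi) ^ 3 = complex_of_real (1 / (2 * pi))" by (simp add: power3_eq_cube)
  have m: "(\<lambda>x. complex_of_real ((cmod (f x))\<^sup>2) * f x) \<in> borel_measurable borel"
    using sobolev_measurable by measurable
  have AE: "AE x in lborel. x \<in> torus \<longrightarrow> complex_of_real ((cmod (f x))\<^sup>2) * f x = trig c d x"
    using sobolev_AE_eq_series
  proof eventually_elim
    case (elim x)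
    then show ?case using eq[of x] by metis
  qed
  have "set_integrable lborel torus (trig c d)" by (rule set_integrable_torus[OF continuous_trig[OF C]])
  then show "set_integrable lborel torus (\<lambda>x. complex_of_real ((cmod (f x))\<^sup>2) * f x)"
    by (subst set_integrable_cong_AE[where g = "trig c d"]) (use m trig_measurable[OF C] AE in auto)
  have "fourier (\<lambda>x. complex_of_real ((cmod (f x))\<^sup>2) * f x) k = fourier (trig c d) k"
    by (rule fourier_cong_AE[OF m trig_measurable[OF C] AE])
  also have "\<dots> = root_2pi * (\<Sum>\<^sub>\<infinity>i. if d i = k then c i else 0)" by (rule fourier_trig[OF C])
  also have "(\<Sum>\<^sub>\<infinity>i. if d i = k then c i else 0) = (\<Sum>\<^sub>\<infinity>i\<in>range (\<lambda>(l, m). ((l, m), k - l - m)). c i)"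
  proof (rule infsum_cong_neutral)
    fix x assume "x \<in> UNIV - range (\<lambda>(l, m). ((l, m), k - l - m))"
    moreover obtain l m n where x: "x = ((l, m), n)" by (metis surj_pair)
    ultimately have "n \<noteq> k - l - m" by (auto simp: image_iff)
    then show "(if d x = k then c x else 0) = 0" by (auto simp: x d_def)
  qed (auto simp: d_def)
  also have "\<dots> = (\<Sum>\<^sub>\<infinity>(l, m). ?a l / root_2pi * (?y m / root_2pi) * (?a (k - l - m) / root_2pi))"
    by (subst infsum_reindex) (auto simp: inj_on_def o_def c_def case_prod_unfold)
  also have "\<dots> = (\<Sum>\<^sub>\<infinity>i. (1 / root_2pi) ^ 3 * (case i of (l, m) \<Rightarrow> 1 * (?a l * ?y m * ?a (k - l - m))))"
    by (auto intro!: infsum_cong simp: field_simps power3_eq_cube)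
  also have "\<dots> = (1 / root_2pi) ^ 3 * tri k (\<lambda>l m. 1) ?a ?y ?a"
    by (simp only: infsum_cmult_right' tri_def)
  finally show "fourier (\<lambda>x. complex_of_real ((cmod (f x))\<^sup>2) * f x) k
     = complex_of_real (1 / (2 * pi)) * tri k (\<lambda>l m. 1) ?a ?y ?a"
    by (simp only: mult.assoc[symmetric] nc3)
qed

text \<open>The frequency q of \<open>|f|^2\<close> is l + m in \<open>tri\<close>. The pairing sums
  over q outside and l inside; absolute convergence by \<open>tri_sum_le\<close>, which tolerates
  the factor l + m from the derivative, permits this change of variables.\<close>

lemma dual_pairing_tri:
  "dual_pairing (deriv_abs_sq f) (fourier (\<lambda>x. f x * (r * char (- k) x)))
     = r * \<i> / root_2pi * tri k (\<lambda>l m. of_int (l + m)) (fourier f) (refl_cnj (fourier f)) (fourier f)"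
proof -
  let ?a = "fourier f" and ?y = "refl_cnj (fourier f)"
  have shift: "fourier (\<lambda>x. f x * (r * char (- k) x)) (- q) = r * ?a (k - q)" for q
  proof -
    have "char (- (- q)) x * (f x * (r * char (- k) x)) = r * (char (- (k - q)) x * f x)" for x
      using char_add[of q "- k" x] by (simp add: mult_ac)
    then show ?thesis unfolding fourier_char by (simp only: set_integral_mult_right mult_ac)
  qed
  let ?t = "\<lambda>i. case i of (l, m) \<Rightarrow> of_int (l + m) * (?a l * ?y m * ?a (k - l - m))"
  have "sum_le (\<lambda>i. cmod (?t i)) (2 * 1 * (sobolev_norm s f * sobolev_norm s f * sobolev_norm s f))"
    using tri_sum_le[OF sobolev_coeffs_h1 sob_le_refl_cnj[OF sobolev_coeffs_h1] sobolev_coeffs_h1, of 1 "\<lambda>l m. of_int (l + m)" k]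
    by (simp add: case_prod_unfold jp_def japanese_def del: of_int_add)
  then have t: "?t summable_on UNIV" by (rule sum_le_summable(1))
  let ?h = "\<lambda>(q, l). (l, q - l) :: int \<times> int"
  have h: "inj ?h" "range ?h = UNIV"
    by (auto simp: inj_def image_iff) (metis add_diff_cancel_left' )
  have t': "(\<lambda>(q, l). of_int q * (?a l * ?y (q - l) * ?a (k - q))) summable_on UNIV \<times> UNIV"
  proof -
    have "(?t \<circ> ?h) summable_on UNIV"
      using t summable_on_reindex[OF h(1), of ?t] by (simp add: h(2))
    then show ?thesis by (simp add: o_def case_prod_unfold)
  qed
  have "tri k (\<lambda>l m. of_int (l + m)) ?a ?y ?a = infsum ?t (range ?h)" by (simp add: tri_def h(2))
  also have "\<dots> = (\<Sum>\<^sub>\<infinity>(q, l). of_int q * (?a l * ?y (q - l) * ?a (k - q)))"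
    by (subst infsum_reindex[OF h(1)]) (simp add: o_def case_prod_unfold)
  also have "\<dots> = (\<Sum>\<^sub>\<infinity>q. \<Sum>\<^sub>\<infinity>l. of_int q * ?a (k - q) * (?a l * ?y (q - l)))"
    using infsum_Sigma_banach[OF t'] by (simp add: mult_ac)
  also have "\<dots> = (\<Sum>\<^sub>\<infinity>q. of_int q * ?a (k - q) * (\<Sum>\<^sub>\<infinity>l. ?a l * ?y (q - l)))"
    by (simp only: infsum_cmult_right')
  finally have "r * \<i> / root_2pi * tri k (\<lambda>l m. of_int (l + m)) ?a ?y ?a
    = (\<Sum>\<^sub>\<infinity>q. r * \<i> / root_2pi * (of_int q * ?a (k - q) * (\<Sum>\<^sub>\<infinity>l. ?a l * ?y (q - l))))"
    by (simp only: infsum_cmult_right')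
  then show ?thesis
    unfolding dual_pairing_def deriv_abs_sq_def shift fourier_abs_square by (simp add: mult_ac)
qed

end

section \<open>Test functions and the integral equation\<close>

text \<open>The derivative of \<open>p (1 / y) * exp (- (1 / y))\<close> is the exponential times
  \<open>(p - p') (1 / y) / y^2\<close>.\<close>

fun flat_poly :: "nat \<Rightarrow> real poly" where
  "flat_poly 0 = 1"
| "flat_poly (Suc i) = [:0, 0, 1:] * (flat_poly i - pderiv (flat_poly i))"

text \<open>\<open>flat i\<close> is the \<open>i\<close>-th derivative of the function equal to \<open>exp (- 1 / y)\<close> for
  \<open>y > 0\<close> and to \<open>0\<close> for \<open>y \<le> 0\<close>.\<close>

definition flat :: "nat \<Rightarrow> real \<Rightarrow> real" where
  "flat i y = (if y \<le> 0 then 0 else poly (flat_poly i) (1 / y) * exp (- (1 / y)))"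

lemma poly_times_exp_tendsto_0: "((\<lambda>z. poly p z * exp (- z)) \<longlongrightarrow> 0) (at_top :: real filter)"
proof -
  have "((\<lambda>z. \<Sum>i\<le>degree p. coeff p i * (z ^ i / exp z)) \<longlongrightarrow> (\<Sum>i\<le>degree p. coeff p i * 0)) at_top"
    by (intro tendsto_intros tendsto_power_div_exp_0)
  moreover have "poly p z * exp (- z) = (\<Sum>i\<le>degree p. coeff p i * (z ^ i / exp z))" for z
    unfolding poly_altdef sum_distrib_right by (simp add: exp_minus divide_inverse mult_ac)
  ultimately show ?thesis by simp
qed

lemma flat_derivative: "(flat i has_real_derivative flat (Suc i) y) (at y)"
proof -
  consider "y < 0" | "y > 0" | "y = 0" by linarith
  then show ?thesis
  proof cases
    case 1
    have "((\<lambda>_. 0) has_real_derivative 0) (at y)" by simp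
    then have "(flat i has_real_derivative 0) (at y)"
      by (rule has_field_derivative_transform_within_open[where S = "{..<0}"]) (use 1 in \<open>auto simp: flat_def\<close>)
    then show ?thesis using 1 by (simp add: flat_def)
  next
    case 2
    let ?p = "flat_poly i"
    have "((\<lambda>y. poly ?p (1 / y) * exp (- (1 / y))) has_real_derivative
       poly ?p (1 / y) * (exp (- (1 / y)) * (1 / y\<^sup>2)) + poly (pderiv ?p) (1 / y) * (- (1 / y\<^sup>2)) * exp (- (1 / y))) (at y)"
      using 2 by (auto intro!: derivative_eq_intros DERIV_chain2[OF poly_DERIV] simp: power2_eq_square)
    then have "(flat i has_real_derivative
       poly ?p (1 / y) * (exp (- (1 / y)) * (1 / y\<^sup>2)) + poly (pderiv ?p) (1 / y) * (- (1 / y\<^sup>2)) * exp (- (1 / y))) (at y)"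
      by (rule has_field_derivative_transform_within_open[where S = "{0<..}"]) (use 2 in \<open>auto simp: flat_def\<close>)
    moreover have "flat (Suc i) y = poly ?p (1 / y) * (exp (- (1 / y)) * (1 / y\<^sup>2)) + poly (pderiv ?p) (1 / y) * (- (1 / y\<^sup>2)) * exp (- (1 / y))"
      using 2 by (simp add: flat_def power2_eq_square algebra_simps)
    ultimately show ?thesis by simp
  next
    case 3
    \<comment> \<open>With z = 1 / h the difference quotient at 0 from the right is z times the
      polynomial times \<open>exp (- z)\<close>; \<open>pCons 0\<close> is the multiplication by
      z.\<close>
    have "((\<lambda>z. poly (pCons 0 (flat_poly i)) z * exp (- z)) \<longlongrightarrow> 0) at_top" by (rule poly_times_exp_tendsto_0)
    from filterlim_compose[OF this filterlim_inverse_at_top_right]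
    have "((\<lambda>h. flat i h / h) \<longlongrightarrow> 0) (at_right 0)"
      by (rule Lim_transform_eventually)
         (auto simp: eventually_at_filter flat_def divide_inverse mult_ac)
    moreover have "((\<lambda>h. flat i h / h) \<longlongrightarrow> 0) (at_left 0)"
      by (rule tendsto_eventually) (auto simp: eventually_at_filter flat_def)
    ultimately have "((\<lambda>h. flat i h / h) \<longlongrightarrow> 0) (at 0)" by (rule filterlim_split_at[rotated])
    then show ?thesis using 3 by (simp add: DERIV_def flat_def)
  qed
qed

lemma flat_nonneg: "0 \<le> flat 0 y" and flat_le_1: "flat 0 y \<le> 1" and flat_zero: "y \<le> 0 \<Longrightarrow> flat i y = 0"
  by (auto simp: flat_def)

lemma flat_1: "0 \<le> flat 1 y" "y\<^sup>2 * flat 1 y \<le> 1"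
  by (auto simp: flat_def power2_eq_square)

lemma continuous_flat: "continuous_on A (flat i)"
  using flat_derivative by (meson DERIV_isCont continuous_at_imp_continuous_on)

lemma flat_tendsto_1:
  assumes "0 < c" shows "(\<lambda>n. flat 0 (real (Suc n) * c)) \<longlonglongrightarrow> 1"
proof -
  have "(\<lambda>n. exp (- (1 / c * inverse (real (Suc n))))) \<longlonglongrightarrow> exp (- (1 / c * 0))"
    by (intro tendsto_intros LIMSEQ_inverse_real_of_nat)
  moreover have "flat 0 (real (Suc n) * c) = exp (- (1 / c * inverse (real (Suc n))))" for n
  proof -
    have "0 < real (Suc n) * c" using assms by simp
    then show ?thesis by (simp only: flat_def not_le[symmetric] if_False flat_poly.simps poly_1 mult_1_left) (simp add: divide_inverse mult_ac)
  qed
  ultimately show ?thesis by simp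
qed

section \<open>From the weak form in time to an integral equation\<close>

lemma approximate_identity_bound:
  fixes q z g e M D :: real
  assumes "0 < q" "0 \<le> g" "(q * z)\<^sup>2 * g \<le> 1" "0 \<le> M" "D \<le> e + M * z\<^sup>2"
  shows "D * (q * g) \<le> e * (q * g) + M / q"
proof -
  have "D * (q * g) \<le> (e + M * z\<^sup>2) * (q * g)" using assms by (intro mult_right_mono) auto
  also have "\<dots> = e * (q * g) + M / q * ((q * z)\<^sup>2 * g)"
    using assms(1) by (simp add: power2_eq_square field_simps)
  also have "\<dots> \<le> e * (q * g) + M / q * 1"
    using assms by (intro add_left_mono mult_left_mono) auto
  finally show ?thesis by simp
qed

text \<open>The derivative of \<open>\<tau> \<mapsto> - flat 0 (n (c - \<tau>))\<close> is an approximate identity at \<open>c\<close>,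
  because \<open>(c - \<tau>)\<^sup>2\<close> times it is bounded by \<open>1 / n\<close>.\<close>

lemma flat_approximate_identity:
  fixes f :: "real \<Rightarrow> complex"
  assumes f: "continuous_on {0..T} f" and c: "0 < c" "c < T"
  shows "(\<lambda>n. integral {0..T} (\<lambda>\<tau>. f \<tau> * of_real (real (Suc n) * flat 1 (real (Suc n) * (c - \<tau>))))) \<longlonglongrightarrow> f c"
proof -
  let ?k = "\<lambda>n \<tau>. real (Suc n) * flat 1 (real (Suc n) * (c - \<tau>))"
  have ck: "continuous_on {0..T} (?k n)" for n
    by (intro continuous_intros continuous_on_compose2[OF continuous_flat]) auto
  have k_int: "(?k n has_integral flat 0 (real (Suc n) * c)) {0..T}" for n
  proof -
    have "(?k n has_integral - flat 0 (real (Suc n) * (c - T)) - - flat 0 (real (Suc n) * (c - 0))) {0..T}"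
    proof (rule fundamental_theorem_of_calculus)
      fix \<tau>
      have "((\<lambda>\<tau>. - flat 0 (real (Suc n) * (c - \<tau>))) has_real_derivative - (flat (Suc 0) (real (Suc n) * (c - \<tau>)) * (real (Suc n) * (0 - 1)))) (at \<tau> within {0..T})"
        by (intro DERIV_minus DERIV_chain2[OF flat_derivative] derivative_intros DERIV_cmult)
      then show "((\<lambda>\<tau>. - flat 0 (real (Suc n) * (c - \<tau>))) has_vector_derivative ?k n \<tau>) (at \<tau> within {0..T})"
        by (simp add: has_real_derivative_iff_has_vector_derivative algebra_simps)
    qed (use c in auto)
    moreover have "flat 0 (real (Suc n) * (c - T)) = 0" using c by (intro flat_zero) (simp add: mult_nonneg_nonpos)
    ultimately show ?thesis by simp
  qed
  have cc: "c \<in> {0..T}" using c by auto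
  \<comment> \<open>The kernel lives on \<tau> < c and has mass
    \<open>flat 0 (real (Suc n) * c)\<close> in place of 1, so the comparison is with f c times this
    mass.\<close>
  have "(\<lambda>n. integral {0..T} (\<lambda>\<tau>. f \<tau> * of_real (?k n \<tau>)) - f c * of_real (flat 0 (real (Suc n) * c))) \<longlonglongrightarrow> 0"
  proof (rule LIMSEQ_I)
    fix r :: real assume r: "0 < r"
    have "bounded (f ` {0..T})" by (intro compact_imp_bounded compact_continuous_image f) auto
    then obtain B where B: "\<And>t. t \<in> {0..T} \<Longrightarrow> cmod (f t) \<le> B" by (force simp: bounded_iff)
    then have B0: "0 \<le> B" using cc norm_ge_zero order_trans by blast
    obtain d where d: "d > 0" "\<And>t. t \<in> {0..T} \<Longrightarrow> \<bar>t - c\<bar> < d \<Longrightarrow> cmod (f t - f c) < r / 2"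
      using f[unfolded continuous_on_iff, rule_format, OF cc, of "r / 2"] r by (auto simp: dist_norm)
    \<comment> \<open>A quadratic majorant replaces splitting the integral: at distance d or more
      from c the oscillation \<open>2 * B\<close> is at most \<open>M * (c - t)^2\<close>, and the
      kernel times that square is of order 1 / n.\<close>
    define M where "M = 2 * B / d\<^sup>2"
    have M: "0 \<le> M" using B0 by (simp add: M_def)
    have fM: "cmod (f t - f c) \<le> r / 2 + M * (c - t)\<^sup>2" if t: "t \<in> {0..T}" for t
    proof (cases "\<bar>t - c\<bar> < d")
      case True
      have "0 \<le> M * (c - t)\<^sup>2" using M by simp
      then show ?thesis using d(2)[OF t True] by linarith
    next
      case False
      then have "d\<^sup>2 \<le> \<bar>t - c\<bar>\<^sup>2" using d(1) by (intro power_mono) auto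
      then have "d\<^sup>2 \<le> (c - t)\<^sup>2" by (simp add: power2_commute)
      then have "M * d\<^sup>2 \<le> M * (c - t)\<^sup>2" using M by (rule mult_left_mono)
      moreover have "M * d\<^sup>2 = 2 * B" using d(1) by (simp add: M_def)
      moreover have "cmod (f t - f c) \<le> B + B" using B[OF t] B[OF cc] by (meson add_mono norm_triangle_ineq4 order_trans)
      ultimately show ?thesis using r by linarith
    qed
    obtain N where N: "M * T / (r / 2) < real N" using reals_Archimedean2 by blast
    have "cmod (integral {0..T} (\<lambda>\<tau>. f \<tau> * of_real (?k n \<tau>)) - f c * of_real (flat 0 (real (Suc n) * c))) < r" if n: "N \<le> n" for n
    proof -
      have ci: "continuous_on {0..T} (\<lambda>\<tau>. f \<tau> * of_real (?k n \<tau>))" "continuous_on {0..T} (\<lambda>\<tau>. f c * of_real (?k n \<tau>))"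
        by (intro continuous_intros f continuous_on_of_real ck)+
      have I: "integral {0..T} (\<lambda>\<tau>. f c * of_real (?k n \<tau>)) = f c * of_real (flat 0 (real (Suc n) * c))"
        using has_integral_mult_right[OF has_integral_of_real[OF k_int], of "f c"] by (rule integral_unique)
      have E: "integral {0..T} (\<lambda>\<tau>. f \<tau> * of_real (?k n \<tau>)) - f c * of_real (flat 0 (real (Suc n) * c))
        = integral {0..T} (\<lambda>\<tau>. f \<tau> * of_real (?k n \<tau>) - f c * of_real (?k n \<tau>))"
        by (simp only: integral_diff[OF integrable_continuous_interval[OF ci(1)] integrable_continuous_interval[OF ci(2)]] I)
      have "cmod (integral {0..T} (\<lambda>\<tau>. f \<tau> * of_real (?k n \<tau>)) - f c * of_real (flat 0 (real (Suc n) * c)))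
         \<le> integral {0..T} (\<lambda>\<tau>. r / 2 * ?k n \<tau> + M / real (Suc n))"
        unfolding E
      proof (rule integral_norm_bound_integral)
        show "(\<lambda>\<tau>. f \<tau> * of_real (?k n \<tau>) - f c * of_real (?k n \<tau>)) integrable_on {0..T}"
          by (rule integrable_continuous_interval[OF continuous_on_diff[OF ci]])
        show "(\<lambda>\<tau>. r / 2 * ?k n \<tau> + M / real (Suc n)) integrable_on {0..T}"
          by (rule integrable_continuous_interval) (rule continuous_on_add[OF continuous_on_mult_left[OF ck] continuous_on_const])
        fix t assume t: "t \<in> {0..T}"
        let ?y = "real (Suc n) * (c - t)"
        have k0: "0 \<le> ?k n t" using flat_1(1) by (intro mult_nonneg_nonneg) auto
        have "cmod (f t * of_real (?k n t) - f c * of_real (?k n t)) = cmod (f t - f c) * ?k n t"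
          unfolding left_diff_distrib[symmetric] norm_mult norm_of_real using k0 by (simp only: abs_of_nonneg)
        also have "\<dots> \<le> r / 2 * ?k n t + M / real (Suc n)"
          by (rule approximate_identity_bound[OF _ flat_1 M fM[OF t]]) (rule of_nat_0_less_iff[THEN iffD2, OF zero_less_Suc])
        finally show "cmod (f t * of_real (?k n t) - f c * of_real (?k n t)) \<le> r / 2 * ?k n t + M / real (Suc n)" .
      qed
      also have "\<dots> = r / 2 * flat 0 (real (Suc n) * c) + M / real (Suc n) * T"
      proof -
        have "((\<lambda>\<tau>. M / real (Suc n)) has_integral M / real (Suc n) * T) {0..T}"
          using has_integral_const_real[of "M / real (Suc n)" 0 T] c by (simp add: mult.commute)
        from has_integral_add[OF has_integral_mult_right[OF k_int[of n], of "r / 2"] this]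
        show ?thesis by (rule integral_unique)
      qed
      also have "\<dots> < r"
      proof -
        have "r / 2 * flat 0 (real (Suc n) * c) \<le> r / 2 * 1" using r flat_le_1 by (intro mult_left_mono) auto
        moreover have "M * T < r / 2 * real (Suc n)"
        proof -
          have "M * T < real N * (r / 2)" using N r by (simp add: pos_divide_less_eq)
          also have "\<dots> \<le> real (Suc n) * (r / 2)" using n r by (intro mult_right_mono) auto
          finally show ?thesis by (simp add: mult.commute)
        qed
        then have "M / real (Suc n) * T < r / 2" by (simp add: pos_divide_less_eq del: of_nat_Suc)
        ultimately show ?thesis by linarith
      qed
      finally show ?thesis .
    qed
    then show "\<exists>no. \<forall>n\<ge>no. norm (integral {0..T} (\<lambda>\<tau>. f \<tau> * of_real (?k n \<tau>)) - f c * of_real (flat 0 (real (Suc n) * c)) - 0) < r"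
      by (intro exI[of _ N]) simp
  qed
  moreover have "(\<lambda>n. f c * of_real (flat 0 (real (Suc n) * c))) \<longlonglongrightarrow> f c * of_real 1"
    by (intro tendsto_intros flat_tendsto_1 c)
  ultimately show ?thesis using tendsto_add by fastforce
qed

text \<open>The test functions \<open>flat 0 (n * (c - \<tau>))\<close> tend to the indicator of
  \<tau> < c, while minus their derivatives concentrate at c and recover \<open>f c\<close>.\<close>

lemma weak_solution_integral_equation:
  fixes f F :: "real \<Rightarrow> complex"
  assumes f: "continuous_on {0..T} f" and F: "continuous_on {0..T} F" and c: "0 < c" "c < T"
    and weak: "\<And>n. integral {0..T} (\<lambda>\<tau>. f \<tau> * of_real (real (Suc n) * flat 1 (real (Suc n) * (c - \<tau>))))
       - f0 * of_real (flat 0 (real (Suc n) * c)) = integral {0..T} (\<lambda>\<tau>. F \<tau> * of_real (flat 0 (real (Suc n) * (c - \<tau>))))"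
  shows "f c = f0 + integral {0..c} F"
proof -
  \<comment> \<open>\<open>flat 0\<close> vanishes at 0, so the pointwise limit at \<tau> = c is 0;
    that single point is removed afterwards.\<close>
  have "(\<lambda>n. integral {0..T} (\<lambda>\<tau>. F \<tau> * of_real (flat 0 (real (Suc n) * (c - \<tau>))))) \<longlonglongrightarrow> 
    integral {0..T} (\<lambda>\<tau>. if \<tau> \<in> {0..c} then (if \<tau> = c then 0 else F \<tau>) else 0)"
  proof (rule dominated_convergence(2))
    show "(\<lambda>\<tau>. F \<tau> * of_real (flat 0 (real (Suc n) * (c - \<tau>)))) integrable_on {0..T}" for n
      by (intro integrable_continuous_interval continuous_intros F continuous_on_compose2[OF continuous_flat]) auto
    show "(\<lambda>\<tau>. cmod (F \<tau>)) integrable_on {0..T}"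
      by (intro integrable_continuous_interval continuous_intros F)
    fix t assume t: "t \<in> {0..T}"
    show "norm (F t * of_real (flat 0 (real (Suc n) * (c - t)))) \<le> cmod (F t)" for n
      using mult_left_mono[OF flat_le_1, of "cmod (F t)" "real (Suc n) * (c - t)"] flat_nonneg[of "real (Suc n) * (c - t)"]
      by (simp add: norm_mult)
    show "(\<lambda>n. F t * of_real (flat 0 (real (Suc n) * (c - t)))) \<longlonglongrightarrow> (if t \<in> {0..c} then (if t = c then 0 else F t) else 0)"
    proof (cases "t < c")
      case True
      have "(\<lambda>n. F t * of_real (flat 0 (real (Suc n) * (c - t)))) \<longlonglongrightarrow> F t * of_real 1"
        using True by (intro tendsto_intros flat_tendsto_1) simp
      then show ?thesis using True t by simp
    next
      case False
      then have "flat 0 (real (Suc n) * (c - t)) = 0" for n by (intro flat_zero) (simp add: mult_nonneg_nonpos)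
      then show ?thesis using False by auto
    qed
  qed
  also have "integral {0..T} (\<lambda>\<tau>. if \<tau> \<in> {0..c} then (if \<tau> = c then 0 else F \<tau>) else 0) = integral ({0..c} \<inter> {0..T}) (\<lambda>\<tau>. if \<tau> = c then 0 else F \<tau>)"
    by (rule Henstock_Kurzweil_Integration.integral_restrict_Int)
  also have "{0..c} \<inter> {0..T} = {0..c}" using c by auto
  also have "integral {0..c} (\<lambda>\<tau>. if \<tau> = c then 0 else F \<tau>) = integral {0..c} F" by (rule integral_spike[of "{c}"]) auto
  finally have R: "(\<lambda>n. integral {0..T} (\<lambda>\<tau>. F \<tau> * of_real (flat 0 (real (Suc n) * (c - \<tau>))))) \<longlonglongrightarrow> integral {0..c} F" .
  have "(\<lambda>n. complex_of_real (flat 0 (real (Suc n) * c))) \<longlonglongrightarrow> of_real 1"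
    by (rule tendsto_of_real[OF flat_tendsto_1[OF c(1)]])
  note L = tendsto_diff[OF flat_approximate_identity[OF f c] tendsto_mult_left[OF this, of f0], unfolded weak]
  have "f c - f0 * of_real 1 = integral {0..c} F" by (rule LIMSEQ_unique[OF L R])
  then show ?thesis by (simp add: algebra_simps)
qed

text \<open>Here \<open>\<sigma> = 1\<close> is the forward and \<open>\<sigma> = - 1\<close> the backward problem.\<close>

definition half_interval :: "real \<Rightarrow> real \<Rightarrow> real set" where
  "half_interval \<sigma> T = {t. 0 \<le> \<sigma> * t \<and> \<sigma> * t < T}"

text \<open>A smooth cutoff in time that vanishes from \<open>\<sigma> * t = c\<close> on but not at
  time 0, times the character that extracts the k-th coefficient. \<open>N\<close> sharpens the
  cutoff.\<close>

definition test_wave :: "real \<Rightarrow> real \<Rightarrow> real \<Rightarrow> int \<Rightarrow> real \<Rightarrow> real \<Rightarrow> complex" where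
  "test_wave \<sigma> N c k t x = of_real (flat 0 (N * (c - \<sigma> * t))) * char (- k) x"

lemma char_vector_derivative:
  "(char k has_vector_derivative \<i> * of_int k * char k x) (at x within A)"
proof -
  have "((\<lambda>x. exp (\<i> * of_int k * of_real x)) has_vector_derivative \<i> * of_int k * exp (\<i> * of_int k * of_real x)) (at x within A)"
    by (rule has_vector_derivative_real_field) (auto intro!: derivative_eq_intros)
  then show ?thesis by (simp add: char_def[abs_def])
qed

lemma flat_chain_derivative:
  "((\<lambda>\<tau>. flat i (N * (c - \<sigma> * \<tau>))) has_real_derivative flat (Suc i) (N * (c - \<sigma> * t)) * (- \<sigma> * N)) (at t within A)"
proof -
  have "((\<lambda>\<tau>. N * (c - \<sigma> * \<tau>)) has_real_derivative - \<sigma> * N) (at t within A)"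
    by (auto intro!: derivative_eq_intros)
  then show ?thesis by (rule DERIV_chain2[OF flat_derivative])
qed

lemma half_interval_image:
  assumes "\<sigma> = 1 \<or> \<sigma> = - 1"
  shows "half_interval \<sigma> T = (\<lambda>\<tau>. \<sigma> * \<tau>) ` {0..<T}"
  using assms by (auto simp: half_interval_def image_iff intro: bexI[of _ "- _"])

lemma test_wave_test_function:
  assumes \<sigma>: "\<sigma> = 1 \<or> \<sigma> = - 1" and c: "0 < c" "c < T" and N: "0 < N"
  shows "test_wave \<sigma> N c k \<in> test_functions (half_interval \<sigma> T)"
proof -
  let ?I = "half_interval \<sigma> T"
  define D where "D = (\<lambda>(i::nat) (j::nat) t x. of_real ((- \<sigma> * N) ^ i * flat i (N * (c - \<sigma> * t))) * ((\<i> * of_int (- k)) ^ j * char (- k) x))"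
  have "smooth_on_strip ?I (test_wave \<sigma> N c k)"
    unfolding smooth_on_strip_def
  proof (intro exI[of _ D] conjI ballI allI)
    show "D 0 0 t x = test_wave \<sigma> N c k t x" for t x by (simp add: D_def test_wave_def)
    show "continuous_on (?I \<times> UNIV) (\<lambda>(t, x). D i j t x)" for i j
      unfolding D_def case_prod_unfold
      by (intro continuous_intros continuous_on_compose2[OF continuous_flat[of UNIV]] continuous_on_compose2[OF continuous_char[of UNIV]]) auto
    show "((\<lambda>\<tau>. D i j \<tau> x) has_vector_derivative D (Suc i) j t x) (at t within ?I)" for i j t x
    proof -
      have "((\<lambda>\<tau>. (- \<sigma> * N) ^ i * flat i (N * (c - \<sigma> * \<tau>))) has_real_derivative (- \<sigma> * N) ^ i * (flat (Suc i) (N * (c - \<sigma> * t)) * (- \<sigma> * N))) (at t within ?I)"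
        by (intro DERIV_cmult flat_chain_derivative)
      then have "((\<lambda>\<tau>. (- \<sigma> * N) ^ i * flat i (N * (c - \<sigma> * \<tau>))) has_real_derivative (- \<sigma> * N) ^ Suc i * flat (Suc i) (N * (c - \<sigma> * t))) (at t within ?I)"
        by (simp add: mult_ac)
      then show ?thesis unfolding D_def
        by (intro has_vector_derivative_mult_left has_vector_derivative_of_real)
    qed
    show "(D i j t has_vector_derivative D i (Suc j) t x) (at x)" for i j t x
    proof -
      have "(char (- k) has_vector_derivative \<i> * of_int (- k) * char (- k) x) (at x)"
        by (rule char_vector_derivative)
      then have "((\<lambda>x. of_real ((- \<sigma> * N) ^ i * flat i (N * (c - \<sigma> * t))) * ((\<i> * of_int (- k)) ^ j * char (- k) x)) has_vector_derivative
        of_real ((- \<sigma> * N) ^ i * flat i (N * (c - \<sigma> * t))) * ((\<i> * of_int (- k)) ^ j * (\<i> * of_int (- k) * char (- k) x))) (at x)"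
        by (intro has_vector_derivative_mult_right)
      then show ?thesis by (simp add: D_def mult_ac)
    qed
  qed
  moreover have "\<exists>K. compact K \<and> K \<subseteq> ?I \<and> (\<forall>t\<in>?I - K. \<forall>x. test_wave \<sigma> N c k t x = 0)"
  proof (intro exI[of _ "(\<lambda>\<tau>. \<sigma> * \<tau>) ` {0..c}"] conjI ballI allI)
    show "compact ((\<lambda>\<tau>. \<sigma> * \<tau>) ` {0..c})" by (intro compact_continuous_image continuous_intros) auto
    show "(\<lambda>\<tau>. \<sigma> * \<tau>) ` {0..c} \<subseteq> ?I" unfolding half_interval_image[OF \<sigma>] using c by auto
    fix t x assume t: "t \<in> ?I - (\<lambda>\<tau>. \<sigma> * \<tau>) ` {0..c}"
    then obtain \<tau> where \<tau>: "t = \<sigma> * \<tau>" "0 \<le> \<tau>" unfolding half_interval_image[OF \<sigma>] by (metis DiffD1 atLeastLessThan_iff imageE)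
    moreover have "\<tau> \<notin> {0..c}" using t \<tau>(1) by blast
    ultimately have "t = \<sigma> * \<tau>" "\<not> \<tau> \<le> c" by auto
    then have "c - \<sigma> * t \<le> 0" using \<sigma> by auto
    then have "N * (c - \<sigma> * t) \<le> 0" using N by (simp add: mult_nonneg_nonpos)
    then show "test_wave \<sigma> N c k t x = 0" by (simp add: test_wave_def flat_zero)
  qed
  ultimately show ?thesis
    by (auto simp: test_functions_def periodic_def test_wave_def char_periodic)
qed

lemma dt_test_wave:
  assumes \<sigma>: "\<sigma> = 1 \<or> \<sigma> = - 1" and T: "0 < T" and t: "t \<in> half_interval \<sigma> T"
  shows "dt (half_interval \<sigma> T) (test_wave \<sigma> N c k) t x = of_real (- \<sigma> * (N * flat 1 (N * (c - \<sigma> * t)))) * char (- k) x"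
  unfolding dt_def
proof (rule vector_derivative_within)
  \<comment> \<open>A derivative within a set is unique only at limit points, and the endpoint 0 is
    included: a connected set with two points has no isolated point.\<close>
  have conn: "connected (half_interval \<sigma> T)"
    unfolding half_interval_image[OF \<sigma>] by (intro connected_continuous_image continuous_intros) auto
  have "\<sigma> * 0 \<in> half_interval \<sigma> T" "\<sigma> * (T / 2) \<in> half_interval \<sigma> T"
    unfolding half_interval_image[OF \<sigma>] by (rule imageI; use T in simp)+
  moreover have "\<sigma> * 0 \<noteq> \<sigma> * (T / 2)" using \<sigma> T by auto
  ultimately have "\<nexists>a. half_interval \<sigma> T = {a}" by (metis singletonD)
  then have "t islimpt half_interval \<sigma> T" using connected_imp_perfect[OF conn t] by blast
  then show "at t within half_interval \<sigma> T \<noteq> bot" by (simp add: trivial_limit_within)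
  have "((\<lambda>\<tau>. flat 0 (N * (c - \<sigma> * \<tau>))) has_real_derivative - \<sigma> * (N * flat 1 (N * (c - \<sigma> * t)))) (at t within half_interval \<sigma> T)"
    using flat_chain_derivative[of 0 N c \<sigma> t] by (simp add: mult_ac)
  then show "((\<lambda>\<tau>. test_wave \<sigma> N c k \<tau> x) has_vector_derivative
      of_real (- \<sigma> * (N * flat 1 (N * (c - \<sigma> * t)))) * char (- k) x) (at t within half_interval \<sigma> T)"
    unfolding test_wave_def by (intro has_vector_derivative_mult_left has_vector_derivative_of_real)
qed

lemma dx_power_test_wave:
  "(dx ^^ j) (test_wave \<sigma> N c k) = (\<lambda>t x. (\<i> * of_int (- k)) ^ j * test_wave \<sigma> N c k t x)"
proof (induction j)
  case (Suc j)
  show ?case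
  proof (intro ext)
    fix t x
    let ?r = "of_real (flat 0 (N * (c - \<sigma> * t))) :: complex"
    have "((\<lambda>x. (\<i> * of_int (- k)) ^ j * (?r * char (- k) x)) has_vector_derivative (\<i> * of_int (- k)) ^ j * (?r * (\<i> * of_int (- k) * char (- k) x))) (at x)"
      by (intro has_vector_derivative_mult_right char_vector_derivative)
    then have "vector_derivative (\<lambda>x. (\<i> * of_int (- k)) ^ j * test_wave \<sigma> N c k t x) (at x) = (\<i> * of_int (- k)) ^ Suc j * test_wave \<sigma> N c k t x"
      by (intro vector_derivative_at) (simp add: test_wave_def mult_ac)
    then show "(dx ^^ Suc j) (test_wave \<sigma> N c k) t x = (\<i> * of_int (- k)) ^ Suc j * test_wave \<sigma> N c k t x"
      by (simp add: Suc dx_def)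
  qed
qed simp

text \<open>Brings both problems to nonnegative \<tau> and away from the open end of the interval:
  \<open>H\<close> vanishes after \<open>T0\<close> and needs continuity only up to there.\<close>

lemma time_integral:
  fixes G H :: "real \<Rightarrow> complex"
  assumes \<sigma>: "\<sigma> = 1 \<or> \<sigma> = - 1" and T0: "0 < T0" "T0 < T"
    and G: "\<And>\<tau>. \<tau> \<in> {0..<T} \<Longrightarrow> G (\<sigma> * \<tau>) = H \<tau>" and H0: "\<And>\<tau>. T0 < \<tau> \<Longrightarrow> H \<tau> = 0"
    and H: "continuous_on {0..T0} H"
  shows "(LINT t:half_interval \<sigma> T|lborel. G t) = integral {0..T0} H"
proof -
  have "(LINT t:half_interval \<sigma> T|lborel. G t) = (LINT \<tau>:{0..<T}|lborel. G (\<sigma> * \<tau>))"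
  proof (cases "\<sigma> = 1")
    case True
    have "half_interval 1 T = {0..<T}" by (auto simp: half_interval_def)
    then show ?thesis using True by simp
  next
    case False
    then have "\<sigma> = - 1" using \<sigma> by simp
    moreover have "{x. - x \<in> half_interval (- 1) T} = {0..<T}" by (auto simp: half_interval_def)
    ultimately show ?thesis using set_integral_reflect[of "half_interval \<sigma> T" G] by simp
  qed
  also have "\<dots> = (LINT \<tau>:{0..T0}|lborel. H \<tau>)"
    unfolding set_lebesgue_integral_def
    by (rule Bochner_Integration.integral_cong) (use T0 G H0 in \<open>auto simp: indicator_def not_le\<close>)
  also have "\<dots> = integral {0..T0} H"
    by (rule set_borel_integral_eq_integral(2)[OF borel_integrable_atLeastAtMost'[OF H]])
  finally show ?thesis .
qed

section \<open>The integral equation for the Fourier coefficients\<close>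

lemma tri_weight:
  assumes "sob_le 1 x X" "sob_le 1 y Y" "sob_le 1 z Z"
  shows "tri k (weight \<gamma>1 \<gamma>2 \<Gamma> k) x y z = (\<i> * of_real \<gamma>1 + \<i> * of_real \<gamma>2 * of_int k) * tri k (\<lambda>l m. 1) x y z
     + of_real \<Gamma> * tri k (\<lambda>l m. of_int (l + m)) x y z"
proof -
  let ?t = "\<lambda>w i. case i of (l, m) \<Rightarrow> w l m * (x l * y m * z (k - l - m))"
  have s: "?t w summable_on UNIV" if "\<And>l m. cmod (w l m) \<le> 1 * jp (l + m)" for w
    using sum_le_summable(1)[OF tri_sum_le[OF assms _ that, where k = k, unfolded case_prod_unfold]]
    by (simp add: case_prod_unfold)
  have s1: "?t (\<lambda>l m. 1) summable_on UNIV" by (rule s) simp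
  have s2: "?t (\<lambda>l m. of_int (l + m)) summable_on UNIV" by (rule s) (simp add: jp_def japanese_def del: of_int_add)
  have lin: "(\<Sum>\<^sub>\<infinity>i. A * f i + B * g i) = A * infsum f UNIV + B * infsum g UNIV"
    if "f summable_on UNIV" "g summable_on UNIV" for f g :: "int \<times> int \<Rightarrow> complex" and A B
    using that by (simp add: infsum_add infsum_cmult_right' summable_on_cmult_right)
  have w: "weight \<gamma>1 \<gamma>2 \<Gamma> k l m = (\<i> * of_real \<gamma>1 + \<i> * of_real \<gamma>2 * of_int k) * 1 + of_real \<Gamma> * of_int (l + m)" for l m
    by (simp add: weight_def complex_eq_iff)
  have "tri k (weight \<gamma>1 \<gamma>2 \<Gamma> k) x y z = (\<Sum>\<^sub>\<infinity>i. (\<i> * of_real \<gamma>1 + \<i> * of_real \<gamma>2 * of_int k) * ?t (\<lambda>l m. 1) i + of_real \<Gamma> * ?t (\<lambda>l m. of_int (l + m)) i)"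
    unfolding tri_def
  proof (rule infsum_cong, clarify)
    fix l m
    show "weight \<gamma>1 \<gamma>2 \<Gamma> k l m * (x l * y m * z (k - l - m)) =
      (\<i> * of_real \<gamma>1 + \<i> * of_real \<gamma>2 * of_int k) * (1 * (x l * y m * z (k - l - m))) + of_real \<Gamma> * (of_int (l + m) * (x l * y m * z (k - l - m)))"
      unfolding w by (simp only: distrib_right mult.assoc)
  qed
  also have "\<dots> = (\<i> * of_real \<gamma>1 + \<i> * of_real \<gamma>2 * of_int k) * infsum (?t (\<lambda>l m. 1)) UNIV + of_real \<Gamma> * infsum (?t (\<lambda>l m. of_int (l + m))) UNIV"
    by (rule lin[OF s1 s2])
  finally show ?thesis by (simp only: tri_def)
qed

lemma sob_le_diff:
  assumes "sob_le s x X" "sob_le s y Y" shows "sob_le s (\<lambda>j. x j - y j) (2 * (X + Y))"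
proof -
  have nn: "0 \<le> X" "0 \<le> Y" using assms by (auto simp: sob_le_def)
  have "sum_le (\<lambda>j. 2 * ((jp j powr s * cmod (x j))\<^sup>2 + (jp j powr s * cmod (y j))\<^sup>2)) (2 * (X\<^sup>2 + Y\<^sup>2))"
    using assms by (intro sum_le_cmult sum_le_add) (auto simp: sob_le_def)
  then have "sum_le (\<lambda>j. (jp j powr s * cmod (x j - y j))\<^sup>2) ((2 * (X + Y))\<^sup>2)"
  proof (rule sum_le_mono)
    fix j
    let ?x = "jp j powr s * cmod (x j)" and ?y = "jp j powr s * cmod (y j)"
    have "jp j powr s * cmod (x j - y j) \<le> jp j powr s * (cmod (x j) + cmod (y j))"
      by (intro mult_left_mono norm_triangle_ineq4) auto
    then have "(jp j powr s * cmod (x j - y j))\<^sup>2 \<le> (?x + ?y)\<^sup>2"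
      by (intro power_mono) (auto simp: distrib_left)
    also have "\<dots> \<le> 2 * (?x\<^sup>2 + ?y\<^sup>2)"
      using zero_le_power2[of "?x - ?y"] by (simp add: power2_eq_square algebra_simps)
    finally show "(jp j powr s * cmod (x j - y j))\<^sup>2 \<le> 2 * (?x\<^sup>2 + ?y\<^sup>2)" .
    show "2 * (X\<^sup>2 + Y\<^sup>2) \<le> (2 * (X + Y))\<^sup>2"
      using nn mult_nonneg_nonneg[OF nn] by (simp add: power2_eq_square algebra_simps)
  qed
  then show ?thesis using nn by (simp add: sob_le_def)
qed

lemma sob_le_sobolev_seq: "sob_le s a X \<Longrightarrow> sobolev_seq s a"
  using sum_le_summable(1)[of "\<lambda>j. (jp j powr s * cmod (a j))\<^sup>2" "X\<^sup>2" UNIV]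
  by (simp add: sob_le_def sobolev_seq_def jp_def)

lemma fourier_diff:
  assumes "f \<in> sobolev s" "g \<in> sobolev s"
  shows "fourier (\<lambda>x. f x - g x) k = fourier f k - fourier g k"
proof -
  have ci: "set_integrable lborel torus (\<lambda>x. char j x * h x)" if "h \<in> sobolev s" for h j
    using integrable_char_mult[OF sobolev_set_integrable[OF that, unfolded set_integrable_def], of j]
    by (simp add: set_integrable_def mult_ac scaleR_conv_of_real)
  have "(\<lambda>x. char (- k) x * (f x - g x)) = (\<lambda>x. char (- k) x * f x - char (- k) x * g x)"
    by (simp add: right_diff_distrib)
  then show ?thesis
    unfolding fourier_char by (simp only: set_integral_diff(2)[OF ci[OF assms(1)] ci[OF assms(2)]] right_diff_distrib)
qed

lemma sobolev_coeff_diff: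
  assumes f: "f \<in> sobolev s" and g: "g \<in> sobolev s"
  shows "sob_le s (\<lambda>k. fourier f k - fourier g k) (sobolev_norm s (\<lambda>x. f x - g x))"
proof -
  have "sob_le s (fourier f) (sobolev_seq_norm s (fourier f))" "sob_le s (fourier g) (sobolev_seq_norm s (fourier g))"
    using f g by (auto simp: sobolev_def intro: sobolev_seq_sob_le)
  from sobolev_seq_sob_le[OF sob_le_sobolev_seq[OF sob_le_diff[OF this]]]
  show ?thesis unfolding sobolev_norm_def fourier_diff[OF f g, abs_def] .
qed

lemma C_sobolev_coeffs:
  assumes \<sigma>: "\<sigma> = 1 \<or> \<sigma> = - 1" and u: "u \<in> C_sobolev ((\<lambda>\<tau>. \<sigma> * \<tau>) ` {0..T}) s" and \<tau>: "\<tau> \<in> {0..T}" and e: "0 < e"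
  obtains d where "d > 0" "\<And>r. r \<in> {0..T} \<Longrightarrow> \<bar>r - \<tau>\<bar> < d \<Longrightarrow>
    sob_le s (\<lambda>k. fourier (u (\<sigma> * r)) k - fourier (u (\<sigma> * \<tau>)) k) e"
proof -
  let ?J = "(\<lambda>\<tau>. \<sigma> * \<tau>) ` {0..T}"
  have mem: "u (\<sigma> * r) \<in> sobolev s" if "r \<in> {0..T}" for r
    using u that by (auto simp: C_sobolev_def)
  have "((\<lambda>r. sobolev_norm s (\<lambda>x. u r x - u (\<sigma> * \<tau>) x)) \<longlongrightarrow> 0) (at (\<sigma> * \<tau>) within ?J)"
    using u \<tau> by (auto simp: C_sobolev_def)
  from tendstoD[OF this e] obtain d where d: "d > 0" "\<forall>t\<in>?J. t \<noteq> \<sigma> * \<tau> \<and> dist t (\<sigma> * \<tau>) < d \<longrightarrow>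
      dist (sobolev_norm s (\<lambda>x. u t x - u (\<sigma> * \<tau>) x)) 0 < e"
    unfolding eventually_at by blast
  have "sob_le s (\<lambda>k. fourier (u (\<sigma> * r)) k - fourier (u (\<sigma> * \<tau>)) k) e" if r: "r \<in> {0..T}" "\<bar>r - \<tau>\<bar> < d" for r
  proof (cases "r = \<tau>")
    case True
    then show ?thesis using e by (simp add: sob_le_0)
  next
    case False
    have "dist (\<sigma> * r) (\<sigma> * \<tau>) < d" "\<sigma> * r \<noteq> \<sigma> * \<tau>" using \<sigma> r False by (auto simp: dist_norm)
    moreover have "\<sigma> * r \<in> ?J" using r by blast
    ultimately have "dist (sobolev_norm s (\<lambda>x. u (\<sigma> * r) x - u (\<sigma> * \<tau>) x)) 0 < e" using d(2) by blast
    then have "\<bar>sobolev_norm s (\<lambda>x. u (\<sigma> * r) x - u (\<sigma> * \<tau>) x)\<bar> < e" by (simp add: dist_norm)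
    then show ?thesis
      using sob_le_mono[OF sobolev_coeff_diff[OF mem[OF r(1)] mem[OF \<tau>]] order_refl, of e] by simp
  qed
  then show ?thesis using that d(1) by blast
qed

text \<open>Testing with \<open>test_wave\<close> makes every spatial term a k-th coefficient, and
  the weak identity becomes the hypothesis of \<open>weak_solution_integral_equation\<close>. In the
  variable \<tau>, where time is \<open>\<sigma> * \<tau>\<close>, the right-hand side acquires the
  factor \<sigma>.\<close>

lemma weak_integral_equation:
  assumes \<sigma>: "\<sigma> = 1 \<or> \<sigma> = - 1" and T0: "0 < T0" "T0 < T" and s: "1 \<le> s"
    and mem: "\<And>\<tau>. \<tau> \<in> {0..<T} \<Longrightarrow> u (\<sigma> * \<tau>) \<in> sobolev s"
    and hc: "h1_continuous_on {0..T0} (\<lambda>\<tau>. fourier (u (\<sigma> * \<tau>)))"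
    and weak: "\<And>\<phi>. \<phi> \<in> test_functions (half_interval \<sigma> T) \<Longrightarrow>
       weak_identity \<alpha>1 \<alpha>2 \<gamma>1 \<gamma>2 \<Gamma> (half_interval \<sigma> T) (- \<sigma>) u0 u \<phi>"
    and c: "0 < c" "c < T0"
  shows "fourier (u (\<sigma> * c)) k = fourier u0 k + integral {0..c} (\<lambda>\<tau>. of_real \<sigma> *
    (\<i> * of_real (dispersion \<alpha>1 \<alpha>2 k) * fourier (u (\<sigma> * \<tau>)) k + cubic \<gamma>1 \<gamma>2 \<Gamma> (fourier (u (\<sigma> * \<tau>))) k))"
proof -
  define a where "a = (\<lambda>\<tau>. fourier (u (\<sigma> * \<tau>)))"
  define nc where "nc = complex_of_real (sqrt (2 * pi))"
  define P1 where "P1 = (\<lambda>\<tau>. tri k (\<lambda>l m. 1) (a \<tau>) (refl_cnj (a \<tau>)) (a \<tau>))"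
  define P2 where "P2 = (\<lambda>\<tau>. tri k (\<lambda>l m. of_int (l + m)) (a \<tau>) (refl_cnj (a \<tau>)) (a \<tau>))"
  define A where "A = \<i> * complex_of_real (dispersion \<alpha>1 \<alpha>2 k)"
  define B where "B = \<i> * complex_of_real \<gamma>1 + \<i> * complex_of_real \<gamma>2 * of_int k"
  define p where "p = complex_of_real (1 / (2 * pi))"
  define F where "F = (\<lambda>\<tau>. of_real \<sigma> * (A * a \<tau> k + cubic \<gamma>1 \<gamma>2 \<Gamma> (a \<tau>) k))"
  have nc: "nc \<noteq> 0" "nc * nc * p = 1"
    unfolding nc_def p_def by (simp_all flip: of_real_mult)
  have \<sigma>2: "\<sigma> * (\<sigma> * \<tau>) = \<tau>" "complex_of_real \<sigma> * of_real \<sigma> = 1" for \<tau> using \<sigma> by auto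
  have hc: "h1_continuous_on {0..T0} a" using hc by (simp add: a_def)
  obtain X where X: "\<And>t. t \<in> {0..T0} \<Longrightarrow> sob_le 1 (a t) X" using hc unfolding h1_continuous_on_def by blast
  have ca: "continuous_on {0..T0} (\<lambda>\<tau>. a \<tau> k)" by (rule h1_continuous_on_component[OF hc])
  note hr = h1_continuous_on_refl_cnj[OF hc]
  have cP: "continuous_on {0..T0} P1" "continuous_on {0..T0} P2"
    unfolding P1_def P2_def
    by (rule continuous_on_tri[OF hc hr hc, of 1]; simp add: jp_def japanese_def del: of_int_add)+
  have cub: "cubic \<gamma>1 \<gamma>2 \<Gamma> (a \<tau>) k = p * (B * P1 \<tau> + of_real \<Gamma> * P2 \<tau>)" if "\<tau> \<in> {0..T0}" for \<tau>
    unfolding cubic_def tri_weight[OF X[OF that] sob_le_refl_cnj[OF X[OF that]] X[OF that]] P1_def P2_def p_def B_def ..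
  have Feq: "F \<tau> = of_real \<sigma> * (A * a \<tau> k + p * (B * P1 \<tau> + of_real \<Gamma> * P2 \<tau>))" if "\<tau> \<in> {0..T0}" for \<tau>
    unfolding F_def cub[OF that] ..
  have cF: "continuous_on {0..T0} F"
    by (subst continuous_on_cong[OF refl Feq]) (auto intro!: continuous_intros ca cP)
  have weak': "integral {0..T0} (\<lambda>\<tau>. a \<tau> k * of_real (real (Suc n) * flat 1 (real (Suc n) * (c - \<tau>))))
       - fourier u0 k * of_real (flat 0 (real (Suc n) * c)) = integral {0..T0} (\<lambda>\<tau>. F \<tau> * of_real (flat 0 (real (Suc n) * (c - \<tau>))))" for n
  proof -
    define N where "N = real (Suc n)"
    have N: "0 < N" by (simp add: N_def)
    define x where "x = (\<lambda>\<tau>. complex_of_real (flat 0 (N * (c - \<tau>))))"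
    define x' where "x' = (\<lambda>\<tau>. complex_of_real (N * flat 1 (N * (c - \<tau>))))"
    have cx: "continuous_on {0..T0} x" "continuous_on {0..T0} x'"
      unfolding x_def x'_def by (intro continuous_intros continuous_on_compose2[OF continuous_flat[of UNIV]]; simp)+
    have x0: "x \<tau> = 0" "x' \<tau> = 0" if "T0 < \<tau>" for \<tau>
      using that c N by (auto simp: x_def x'_def flat_zero mult_nonneg_nonpos)
    define \<phi> where "\<phi> = test_wave \<sigma> N c k"
    let ?I = "half_interval \<sigma> T"
    let ?g = "\<lambda>t y. u t y * (- complex_of_real \<alpha>1 * (dx ^^ 3) \<phi> t y + \<i> * complex_of_real \<alpha>2 * (dx ^^ 2) \<phi> t y)
          + complex_of_real ((cmod (u t y))\<^sup>2) * u t y *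
              (\<i> * complex_of_real \<gamma>1 * \<phi> t y - complex_of_real \<gamma>2 * dx \<phi> t y)"
    have \<phi>: "\<phi> (\<sigma> * \<tau>) = (\<lambda>y. x \<tau> * char (- k) y)" for \<tau>
      by (simp add: \<phi>_def test_wave_def[abs_def] x_def \<sigma>2)
    have dt: "dt ?I \<phi> (\<sigma> * \<tau>) y = of_real (- \<sigma>) * x' \<tau> * char (- k) y" if "\<tau> \<in> {0..<T}" for \<tau> y
    proof -
      have I: "\<sigma> * \<tau> \<in> ?I" unfolding half_interval_image[OF \<sigma>] using that by blast
      show ?thesis unfolding \<phi>_def using dt_test_wave[OF \<sigma> _ I, of N c k y] T0
        by (simp add: x'_def \<sigma>2)
    qed
    have dx: "(dx ^^ j) \<phi> (\<sigma> * \<tau>) y = (\<i> * of_int (- k)) ^ j * (x \<tau> * char (- k) y)" for j \<tau> y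
      unfolding \<phi>_def dx_power_test_wave by (simp add: test_wave_def x_def \<sigma>2)
    have four: "(LINT y:torus|lborel. f y * (r * char (- k) y)) = r * (nc * fourier f k)" for f r
    proof -
      have "(LINT y:torus|lborel. f y * (r * char (- k) y)) = r * (LINT y:torus|lborel. char (- k) y * f y)"
        by (simp add: mult_ac flip: set_integral_mult_right)
      then show ?thesis by (simp add: fourier_char nc_def)
    qed
    have "weak_identity \<alpha>1 \<alpha>2 \<gamma>1 \<gamma>2 \<Gamma> ?I (- \<sigma>) u0 u \<phi>"
      unfolding \<phi>_def using c T0 N by (intro weak test_wave_test_function \<sigma>) auto
    moreover have "(LINT t:?I|lborel. LINT y:torus|lborel. u t y * dt ?I \<phi> t y)
      = integral {0..T0} (\<lambda>\<tau>. (- of_real \<sigma> * nc) * (a \<tau> k * x' \<tau>))"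
    proof (rule time_integral[OF \<sigma> T0])
      fix \<tau> assume \<tau>: "\<tau> \<in> {0..<T}"
      show "(LINT y:torus|lborel. u (\<sigma> * \<tau>) y * dt ?I \<phi> (\<sigma> * \<tau>) y) = (- of_real \<sigma> * nc) * (a \<tau> k * x' \<tau>)"
        unfolding dt[OF \<tau>] four by (simp add: a_def mult_ac)
    qed (auto intro!: continuous_intros ca cx simp: x0)
    moreover have "(LINT y:torus|lborel. u0 y * \<phi> 0 y) = x 0 * (nc * fourier u0 k)"
      using \<phi>[of 0] four[of u0 "x 0"] by simp
    moreover have "(LINT t:?I|lborel. LINT y:torus|lborel. ?g t y)
      = integral {0..T0} (\<lambda>\<tau>. nc * (x \<tau> * (A * a \<tau> k + p * B * P1 \<tau>)))"
    proof (rule time_integral[OF \<sigma> T0])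
      fix \<tau> assume \<tau>: "\<tau> \<in> {0..<T}"
      let ?u = "u (\<sigma> * \<tau>)"
      have ci: "set_integrable lborel torus (\<lambda>y. h y * (r * char (- k) y))" if "set_integrable lborel torus h" for h r
        using integrable_mult_right[OF integrable_char_mult[OF that[unfolded set_integrable_def], of "- k"], of r]
        by (simp add: set_integrable_def mult_ac scaleR_conv_of_real)
      \<comment> \<open>The transposed operator on \<open>char (- k)\<close> has the symbol of the
        equation at k: the sign from transposing the third derivative cancels the one from -
        k.\<close>
      have A: "- complex_of_real \<alpha>1 * (\<i> * of_int (- k)) ^ 3 + \<i> * complex_of_real \<alpha>2 * (\<i> * of_int (- k)) ^ 2 = A"
        by (simp add: A_def dispersion_def power3_eq_cube power2_eq_square algebra_simps)
      have "?g (\<sigma> * \<tau>) y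
        = ?u y * (A * x \<tau> * char (- k) y) + complex_of_real ((cmod (?u y))\<^sup>2) * ?u y * (B * x \<tau> * char (- k) y)" for y
        using dx[of 1 \<tau> y] dx[of 2 \<tau> y] dx[of 3 \<tau> y] unfolding A[symmetric] B_def \<phi>
        by (simp add: algebra_simps)
      then have "(LINT y:torus|lborel. ?g (\<sigma> * \<tau>) y)
        = (LINT y:torus|lborel. ?u y * (A * x \<tau> * char (- k) y) + complex_of_real ((cmod (?u y))\<^sup>2) * ?u y * (B * x \<tau> * char (- k) y))"
        by simp
      also have "\<dots> = (LINT y:torus|lborel. ?u y * (A * x \<tau> * char (- k) y)) + (LINT y:torus|lborel. complex_of_real ((cmod (?u y))\<^sup>2) * ?u y * (B * x \<tau> * char (- k) y))"
        by (rule set_integral_add(2)[OF ci[OF sobolev_set_integrable[OF mem[OF \<tau>]]] ci[OF cubic_integrable[OF mem[OF \<tau>] s]]])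
      also have "\<dots> = nc * (x \<tau> * (A * a \<tau> k + p * B * P1 \<tau>))"
        unfolding four fourier_cubic[OF mem[OF \<tau>] s] a_def P1_def p_def by (simp only: algebra_simps)
      finally show "(LINT y:torus|lborel. ?g (\<sigma> * \<tau>) y)
        = nc * (x \<tau> * (A * a \<tau> k + p * B * P1 \<tau>))" .
    qed (auto intro!: continuous_intros ca cx cP simp: x0)
    moreover have "(LINT t:?I|lborel. dual_pairing (deriv_abs_sq (u t)) (fourier (\<lambda>y. u t y * \<phi> t y)))
      = integral {0..T0} (\<lambda>\<tau>. (\<i> / nc) * (x \<tau> * P2 \<tau>))"
    proof (rule time_integral[OF \<sigma> T0])
      fix \<tau> assume \<tau>: "\<tau> \<in> {0..<T}"
      show "dual_pairing (deriv_abs_sq (u (\<sigma> * \<tau>))) (fourier (\<lambda>y. u (\<sigma> * \<tau>) y * \<phi> (\<sigma> * \<tau>) y)) = (\<i> / nc) * (x \<tau> * P2 \<tau>)"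
        unfolding \<phi> dual_pairing_tri[OF mem[OF \<tau>] s] by (simp add: P2_def a_def nc_def)
    qed (auto intro!: continuous_intros ca cx cP simp: x0 nc)
    ultimately have W: "- ((- of_real \<sigma> * nc) * integral {0..T0} (\<lambda>\<tau>. a \<tau> k * x' \<tau>)) + complex_of_real (- \<sigma>) * (x 0 * (nc * fourier u0 k))
      = nc * integral {0..T0} (\<lambda>\<tau>. x \<tau> * (A * a \<tau> k + p * B * P1 \<tau>))
        - \<i> * complex_of_real \<Gamma> * ((\<i> / nc) * integral {0..T0} (\<lambda>\<tau>. x \<tau> * P2 \<tau>))"
      unfolding weak_identity_def by (simp only: integral_mult_right)
    let ?Q1 = "integral {0..T0} (\<lambda>\<tau>. x \<tau> * (A * a \<tau> k + p * B * P1 \<tau>))" and ?Q2 = "integral {0..T0} (\<lambda>\<tau>. x \<tau> * P2 \<tau>)"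
    let ?Q = "integral {0..T0} (\<lambda>\<tau>. a \<tau> k * x' \<tau>)"
    have "integral {0..T0} (\<lambda>\<tau>. F \<tau> * x \<tau>) = integral {0..T0} (\<lambda>\<tau>. of_real \<sigma> * (x \<tau> * (A * a \<tau> k + p * B * P1 \<tau>)) + of_real \<sigma> * p * of_real \<Gamma> * (x \<tau> * P2 \<tau>))"
      by (rule Henstock_Kurzweil_Integration.integral_cong) (simp add: Feq algebra_simps)
    also have "\<dots> = integral {0..T0} (\<lambda>\<tau>. of_real \<sigma> * (x \<tau> * (A * a \<tau> k + p * B * P1 \<tau>))) + integral {0..T0} (\<lambda>\<tau>. of_real \<sigma> * p * of_real \<Gamma> * (x \<tau> * P2 \<tau>))"
      by (rule Henstock_Kurzweil_Integration.integral_add; rule integrable_continuous_interval; intro continuous_intros cx ca cP)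
    also have "\<dots> = of_real \<sigma> * ?Q1 + of_real \<sigma> * p * of_real \<Gamma> * ?Q2"
      by (simp only: integral_mult_right)
    finally have RHS: "integral {0..T0} (\<lambda>\<tau>. F \<tau> * x \<tau>) = of_real \<sigma> * ?Q1 + of_real \<sigma> * p * of_real \<Gamma> * ?Q2" .
    have pn: "1 / nc = nc * p" using nc by (simp add: field_simps)
    have alg: "Q - f0 * x0 = \<sigma> * Q1 + \<sigma> * p * G * Q2"
      if "- ((- \<sigma> * nc) * Q) + (- \<sigma>) * (x0 * (nc * f0)) = nc * Q1 - \<i> * G * ((\<i> / nc) * Q2)" "\<sigma> * \<sigma> = 1"
      for Q f0 x0 \<sigma> Q1 Q2 G :: complex
    proof -
      \<comment> \<open>With the minus sign in front, the \<open>\<i>\<close> of the derivative and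
        the \<open>\<i>\<close> of the equation multiply to 1: the \<Gamma> term enters with a real
        coefficient.\<close>
      have "\<i> * G * ((\<i> / nc) * Q2) = - (G * ((1 / nc) * Q2))" by (simp add: divide_inverse mult_ac)
      then have "nc * (\<sigma> * (Q - f0 * x0)) = nc * (Q1 + p * G * Q2)"
        using that(1) unfolding pn by (simp add: algebra_simps)
      then have "\<sigma> * (Q - f0 * x0) = Q1 + p * G * Q2" using nc(1) by simp
      then have "\<sigma> * (\<sigma> * (Q - f0 * x0)) = \<sigma> * (Q1 + p * G * Q2)" by simp
      then show ?thesis using that(2) by (simp add: mult.assoc[symmetric] distrib_left)
    qed
    have "?Q - fourier u0 k * x 0 = integral {0..T0} (\<lambda>\<tau>. F \<tau> * x \<tau>)"
      unfolding RHS by (rule alg[OF _ \<sigma>2(2)]) (use W in simp)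
    then show ?thesis by (simp add: x_def x'_def N_def)
  qed
  have "a c k = fourier u0 k + integral {0..c} F"
    by (rule weak_solution_integral_equation[OF ca cF c weak'])
  then show ?thesis by (simp add: F_def a_def A_def)
qed

section \<open>Nonexistence\<close>

lemma refl_cnj_refl_cnj [simp]: "refl_cnj (refl_cnj x) = x"
  by (simp add: refl_cnj_def)

lemma cnj_tri:
  "cnj (tri (- k) w x y z) = tri k (\<lambda>l m. cnj (w (- l) (- m))) (refl_cnj x) (refl_cnj y) (refl_cnj z)"
proof -
  let ?h = "\<lambda>(l, m). (- l, - m) :: int \<times> int"
  have h: "inj ?h" "range ?h = UNIV"
    by (simp add: inj_def case_prod_unfold prod_eq_iff) (rule surjI[of _ ?h], auto)
  have "cnj (tri (- k) w x y z) = (\<Sum>\<^sub>\<infinity>i\<in>range ?h. cnj (case i of (l, m) \<Rightarrow> w l m * (x l * y m * z (- k - l - m))))"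
    unfolding h(2) tri_def infsum_cnj ..
  also have "\<dots> = tri k (\<lambda>l m. cnj (w (- l) (- m))) (refl_cnj x) (refl_cnj y) (refl_cnj z)"
    unfolding tri_def infsum_reindex[OF h(1)]
    by (intro infsum_cong) (auto simp: refl_cnj_def algebra_simps)
  finally show ?thesis .
qed

text \<open>The minus sign is compensated by the reversal of time and \<Gamma> keeps its sign, so
  the reflected coefficients obey a system of the same type. Only \<gamma>2 and, by
  \<open>dispersion_reflect\<close>, \<alpha>1 change sign.\<close>

lemma cnj_cubic: "cnj (cubic \<gamma>1 \<gamma>2 \<Gamma> x (- k)) = - cubic \<gamma>1 (- \<gamma>2) \<Gamma> (refl_cnj x) k"
proof -
  have w: "cnj (weight \<gamma>1 \<gamma>2 \<Gamma> (- k) (- l) (- m)) = - 1 * weight \<gamma>1 (- \<gamma>2) \<Gamma> k l m" for l m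
    by (simp add: weight_def complex_eq_iff algebra_simps)
  have "tri k (\<lambda>l m. - 1 * weight \<gamma>1 (- \<gamma>2) \<Gamma> k l m) (refl_cnj x) x (refl_cnj x) = - 1 * tri k (weight \<gamma>1 (- \<gamma>2) \<Gamma> k) (refl_cnj x) x (refl_cnj x)"
    unfolding tri_def infsum_cmult_right'[symmetric] by (intro infsum_cong) auto
  then show ?thesis unfolding cubic_def complex_cnj_mult cnj_tri w by simp
qed

lemma dispersion_reflect: "dispersion \<alpha>1 \<alpha>2 (- k) = dispersion (- \<alpha>1) \<alpha>2 k"
  by (simp add: dispersion_def)

lemma sum_le_range:
  fixes h :: "'b \<Rightarrow> 'a"
  assumes h: "inj h" and g: "sum_le (\<lambda>i. g (h i)) C" "\<And>k. k \<notin> range h \<Longrightarrow> g k = 0"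
  shows "sum_le g C"
  unfolding sum_le_def
proof (intro allI impI)
  fix F :: "'a set" assume F: "finite F"
  have "sum g F = sum g (h ` (h -` F))"
    by (rule sum.mono_neutral_right) (use F g(2) in auto)
  also have "\<dots> = (\<Sum>i\<in>h -` F. g (h i))" by (subst sum.reindex) (use h in \<open>auto intro: inj_on_subset\<close>)
  also have "\<dots> \<le> C" by (intro sum_leD[OF g(1)] finite_vimageI F h)
  finally show "sum g F \<le> C" .
qed

text \<open>Sparse frequencies, because a sequence in \<open>H\<^sup>s\<close> can be of size \<open>\<bar>k\<bar> powr - \<rho>\<close> with
  \<open>\<rho>\<close> close to \<open>s\<close> only there.\<close>

definition lacunary :: "real \<Rightarrow> int \<Rightarrow> complex" where
  "lacunary \<rho> k = (if \<exists>j. \<bar>k\<bar> = 2 ^ j then of_real (jp k powr - \<rho>) else 0)"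

text \<open>At |k| = 2^j the weighted square is at most the j-th power of r < 1, a geometric
  sequence. Positive and negative k are treated apart, so that each support is the range of an
  injective function of j.\<close>

lemma lacunary_sobolev:
  assumes "s < \<rho>" obtains X where "sob_le s (lacunary \<rho>) X"
proof -
  define r where "r = 2 powr (- 2 * (\<rho> - s))"
  have r: "0 < r" "r < 1" using assms by (auto simp: r_def powr_less_one)
  let ?g = "\<lambda>k. (jp k powr s * cmod (lacunary \<rho> k))\<^sup>2"
  have geom: "sum_le (\<lambda>j::nat. r ^ j) (1 / (1 - r))"
    unfolding sum_le_def
  proof (intro allI impI)
    fix F :: "nat set" assume "finite F"
    then have "(\<Sum>j\<in>F. r ^ j) \<le> (\<Sum>j. r ^ j)"
      using r by (intro sum_le_suminf summable_geometric) auto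
    then show "(\<Sum>j\<in>F. r ^ j) \<le> 1 / (1 - r)" using r by (simp add: suminf_geometric)
  qed
  have g: "?g k \<le> r ^ j" if "\<bar>k\<bar> = 2 ^ j" for k j
  proof -
    have "jp k powr s * cmod (lacunary \<rho> k) = jp k powr (s - \<rho>)"
      using that by (auto simp: lacunary_def powr_add[symmetric])
    then have "?g k = jp k powr (- 2 * (\<rho> - s))"
      by (simp add: power2_eq_square powr_add[symmetric])
    also have "\<dots> \<le> (2 ^ j) powr (- 2 * (\<rho> - s))"
    proof (rule powr_mono2')
      have "\<bar>real_of_int k\<bar> = 2 ^ j" using that by (metis of_int_abs of_int_numeral of_int_power)
      then show "2 ^ j \<le> jp k" by (simp add: jp_def japanese_def)
    qed (use assms in auto)
    also have "\<dots> = r ^ j"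
      by (simp add: r_def powr_realpow[symmetric] powr_powr mult.commute)
    finally show ?thesis .
  qed
  define g1 where "g1 = (\<lambda>k. if 0 < k then ?g k else 0)"
  define g2 where "g2 = (\<lambda>k. if k < 0 then ?g k else 0)"
  have nn: "?g k = 0" if "\<nexists>j. \<bar>k\<bar> = 2 ^ j" for k using that by (simp add: lacunary_def)
  have "sum_le g1 (1 / (1 - r))"
  proof (rule sum_le_range[where h = "\<lambda>j::nat. 2 ^ j"])
    show "sum_le (\<lambda>j. g1 (2 ^ j)) (1 / (1 - r))"
      by (rule sum_le_mono[OF geom]) (use r in \<open>auto simp: g1_def intro!: g\<close>)
    fix k :: int assume k: "k \<notin> range (\<lambda>j::nat. 2 ^ j)"
    have "\<nexists>j. \<bar>k\<bar> = 2 ^ j" if pos: "0 < k"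
    proof
      assume "\<exists>j. \<bar>k\<bar> = 2 ^ j"
      then obtain j where "k = 2 ^ j" using pos by auto
      then show False using k by blast
    qed
    then show "g1 k = 0" unfolding g1_def using nn by simp
  qed (auto simp: inj_def)
  moreover have "sum_le g2 (1 / (1 - r))"
  proof (rule sum_le_range[where h = "\<lambda>j::nat. - (2 ^ j)"])
    show "sum_le (\<lambda>j. g2 (- (2 ^ j))) (1 / (1 - r))"
      by (rule sum_le_mono[OF geom]) (use r in \<open>auto simp: g2_def simp del: jp_minus intro!: g\<close>)
    fix k :: int assume k: "k \<notin> range (\<lambda>j::nat. - (2 ^ j))"
    have "\<nexists>j. \<bar>k\<bar> = 2 ^ j" if neg: "k < 0"
    proof
      assume "\<exists>j. \<bar>k\<bar> = 2 ^ j"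
      then obtain j where "\<bar>k\<bar> = 2 ^ j" by blast
      then have "k = - (2 ^ j)" using neg by simp
      then show False using k by blast
    qed
    then show "g2 k = 0" unfolding g2_def using nn by simp
  qed (auto simp: inj_def)
  ultimately have "sum_le (\<lambda>k. g1 k + g2 k) (1 / (1 - r) + 1 / (1 - r))" by (rule sum_le_add)
  then have "sum_le ?g (2 / (1 - r))"
  proof (rule sum_le_mono)
    fix k
    have "?g 0 = 0" by (intro nn) auto
    then show "?g k \<le> g1 k + g2 k" by (cases "k = 0") (auto simp: g1_def g2_def)
  qed simp
  then have "sob_le s (lacunary \<rho>) (sqrt (2 / (1 - r)))"
    using r by (simp add: sob_le_def)
  then show ?thesis by (rule that)
qed

text \<open>Turns a solution into an instance of \<open>fourier_system\<close> on a short interval: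
  continuity in \<open>H^s\<close> gives the bound, the weak identity the differential equation, and
  one nonzero initial coefficient the lower bound.\<close>

lemma solution_coefficient_decay:
  assumes par: "0 < \<Gamma>" "\<alpha>1 \<noteq> 0" "2 * \<alpha>2 / (3 * \<alpha>1) \<notin> \<int>" and s: "1 \<le> s" and T: "0 < T"
    and \<sigma>: "\<sigma> = 1 \<or> \<sigma> = - 1" and u: "u \<in> C_sobolev ((\<lambda>\<tau>. \<sigma> * \<tau>) ` {0..T}) s"
    and weak: "\<And>\<phi>. \<phi> \<in> test_functions (half_interval \<sigma> T) \<Longrightarrow>
       weak_identity \<alpha>1 \<alpha>2 \<gamma>1 \<gamma>2 \<Gamma> (half_interval \<sigma> T) (- \<sigma>) u0 u \<phi>"
    and j0: "fourier u0 j0 \<noteq> 0"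
  obtains C k0 where "\<And>k. k0 \<le> k \<Longrightarrow> cmod (fourier u0 (if \<sigma> = 1 then k else - k)) \<le> C * jp k powr (- s - 1)"
proof -
  define a where "a = (\<lambda>\<tau>. fourier (u (\<sigma> * \<tau>)))"
  have mem: "u (\<sigma> * \<tau>) \<in> sobolev s" if "\<tau> \<in> {0..T}" for \<tau>
    using u that by (auto simp: C_sobolev_def)
  define R0 where "R0 = sobolev_norm s (u (\<sigma> * 0))"
  have R0: "sob_le s (a 0) R0" unfolding a_def R0_def by (rule sobolev_coeffs[OF mem s]) (use T in auto)
  obtain d where d: "d > 0" "\<And>r. r \<in> {0..T} \<Longrightarrow> \<bar>r - 0\<bar> < d \<Longrightarrow> sob_le s (\<lambda>k. a r k - a 0 k) 1"
    unfolding a_def by (rule C_sobolev_coeffs[OF \<sigma> u, of 0 1]) (use T in auto)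
  define T0 where "T0 = min (d / 2) (T / 2)"
  have T0: "0 < T0" "T0 < T" "T0 < d" using d T by (auto simp: T0_def)
  \<comment> \<open>\<open>a t\<close> is the difference of \<open>a t - a 0\<close>, of norm at
    most 1, and \<open>- a 0\<close>; the factor 2 is that of \<open>sob_le_diff\<close>.\<close>
  define R where "R = 2 * (1 + R0)"
  have bound: "sob_le s (a t) R" if t: "t \<in> {0..T0}" for t
  proof -
    have "sob_le s (\<lambda>k. - a 0 k) R0" by (rule sob_le_cmod_mono[OF R0]) simp
    from sob_le_diff[OF d(2)[of t] this] show ?thesis using t T0 by (simp add: R_def)
  qed
  have cont: "h1_continuous_on {0..T0} a"
    unfolding h1_continuous_on_def
  proof (rule conjI; (intro ballI allI impI)?)
    have "sob_le 1 (a t) R" if "t \<in> {0..T0}" for t using bound[OF that] s by (rule sob_le_mono) simp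
    then show "\<exists>X. \<forall>t\<in>{0..T0}. sob_le 1 (a t) X" by blast
    fix t e :: real assume t: "t \<in> {0..T0}" and e: "0 < e"
    then have "t \<in> {0..T}" using T0 by auto
    from C_sobolev_coeffs[OF \<sigma> u this e] obtain d where d: "d > 0"
      "\<And>r. r \<in> {0..T} \<Longrightarrow> \<bar>r - t\<bar> < d \<Longrightarrow> sob_le s (\<lambda>k. a r k - a t k) e"
      unfolding a_def by metis
    have "sob_le 1 (\<lambda>k. a r k - a t k) e" if "r \<in> {0..T0}" "\<bar>r - t\<bar> < d" for r
      by (rule sob_le_mono[OF d(2)[of r] s order_refl]) (use that T0 in auto)
    then show "\<exists>d>0. \<forall>r\<in>{0..T0}. \<bar>r - t\<bar> < d \<longrightarrow> sob_le 1 (\<lambda>k. a r k - a t k) e" using d(1) by blast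
  qed
  let ?f = "\<lambda>k \<tau>. of_real \<sigma> * (\<i> * of_real (dispersion \<alpha>1 \<alpha>2 k) * a \<tau> k + cubic \<gamma>1 \<gamma>2 \<Gamma> (a \<tau>) k)"
  have ca: "continuous_on {0..T0} (\<lambda>\<tau>. a \<tau> k)" for k by (rule h1_continuous_on_component[OF cont])
  have cf: "continuous_on {0..T0} (?f k)" for k
    unfolding cubic_def
    by (intro continuous_on_mult_left continuous_on_add ca
      continuous_on_tri[OF cont h1_continuous_on_refl_cnj[OF cont] cont _ weight_bound']) simp
  have eq: "a t k = fourier u0 k + integral {0..t} (?f k)" if t: "t \<in> {0..T0}" for t k
  proof -
    have cl: "closure {0<..<T0} = {0..T0}" using T0 by simp
    \<comment> \<open>The integral equation is available at interior times; continuity extends it to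
      the closed interval, and at time 0 it identifies \<open>a 0\<close> with the coefficients of
      \<open>u0\<close>.\<close>
    have "continuous_on (closure {0<..<T0}) (\<lambda>t. a t k - integral {0..t} (?f k))"
      unfolding cl by (intro continuous_on_diff ca indefinite_integral_continuous_1 integrable_continuous_interval cf)
    moreover have "a c k - integral {0..c} (?f k) = fourier u0 k" if "c \<in> {0<..<T0}" for c
      using weak_integral_equation[OF \<sigma> T0(1,2) s mem cont[unfolded a_def] weak, where c = c and k = k] that by (simp add: a_def)
    ultimately have "a t k - integral {0..t} (?f k) = fourier u0 k"
      using t unfolding cl[symmetric] by (rule continuous_constant_on_closure)
    then show ?thesis by (simp add: algebra_simps)
  qed
  have a0: "a 0 k = fourier u0 k" for k using eq[of 0 k] T0 by simp
  \<comment> \<open>By continuity at least half of the initial modulus persists for a short time;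
    \<open>low\<close> asks for the square.\<close>
  define m0 where "m0 = (cmod (fourier u0 j0) / 2)\<^sup>2"
  have m0: "0 < m0" using j0 by (simp add: m0_def)
  have "0 \<in> {0..T0}" using T0 by simp
  with ca[of j0, unfolded continuous_on_iff] obtain d' where d': "d' > 0"
    "\<And>t. t \<in> {0..T0} \<Longrightarrow> dist t 0 < d' \<Longrightarrow> dist (a t j0) (a 0 j0) < cmod (fourier u0 j0) / 2"
    using j0 by (meson half_gt_zero zero_less_norm_iff)
  define t0 where "t0 = min T0 (d' / 2)"
  have t0: "0 < t0" "t0 \<le> T0" "t0 < d'" using d'(1) T0 by (auto simp: t0_def)
  have sub: "{0..t0} \<subseteq> {0..T0}" using t0 by auto
  have low: "m0 \<le> (cmod (a t j0))\<^sup>2" if t: "t \<in> {0..t0}" for t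
  proof -
    have "cmod (a t j0 - fourier u0 j0) < cmod (fourier u0 j0) / 2"
      using d'(2)[of t] t t0 by (auto simp: a0 dist_norm)
    then have "cmod (fourier u0 j0) / 2 \<le> cmod (a t j0)"
      using norm_triangle_ineq2[of "fourier u0 j0" "a t j0"] by (simp add: norm_minus_commute)
    then show ?thesis unfolding m0_def by (intro power_mono) auto
  qed
  have cont0: "h1_continuous_on {0..t0} a" using cont sub unfolding h1_continuous_on_def by blast
  have ode: "((\<lambda>\<tau>. a \<tau> k) has_vector_derivative ?f k t) (at t within {0..t0})" if t: "t \<in> {0..t0}" for t k
  proof -
    have "((\<lambda>t. fourier u0 k + integral {0..t} (?f k)) has_vector_derivative 0 + ?f k t) (at t within {0..T0})"
      by (intro has_vector_derivative_add has_vector_derivative_const integral_has_vector_derivative cf)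
         (use t sub in auto)
    then have "((\<lambda>t. fourier u0 k + integral {0..t} (?f k)) has_vector_derivative ?f k t) (at t within {0..t0})"
      by (auto intro: has_vector_derivative_within_subset[OF _ sub])
    then show ?thesis
      by (rule has_vector_derivative_transform[OF t, rotated]) (use eq sub in auto)
  qed
  show ?thesis
  proof (cases "\<sigma> = 1")
    case True
    have "fourier_system \<alpha>1 \<alpha>2 \<gamma>1 \<gamma>2 \<Gamma> s R t0 m0 j0 a"
      using par s t0 m0 bound low cont0 ode sub True by unfold_locales auto
    then interpret fourier_system \<alpha>1 \<alpha>2 \<gamma>1 \<gamma>2 \<Gamma> s R t0 m0 j0 a .
    show ?thesis using initial_decay that True by (auto simp: a0) 
  next
    case False
    then have \<sigma>: "\<sigma> = - 1" using \<sigma> by simp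
    define b where "b = (\<lambda>\<tau>. refl_cnj (a \<tau>))"
    have odeb: "((\<lambda>\<tau>. b \<tau> k) has_vector_derivative
       \<i> * of_real (dispersion (- \<alpha>1) \<alpha>2 k) * b t k + cubic \<gamma>1 (- \<gamma>2) \<Gamma> (b t) k) (at t within {0..t0})"
      if t: "t \<in> {0..t0}" for t k
    proof -
      have "cnj (?f (- k) t) = \<i> * of_real (dispersion (- \<alpha>1) \<alpha>2 k) * b t k + cubic \<gamma>1 (- \<gamma>2) \<Gamma> (b t) k"
        by (simp add: \<sigma> cnj_cubic dispersion_reflect b_def) (simp add: refl_cnj_def)
      then show ?thesis
        using has_vector_derivative_cnj[OF ode[OF t, of "- k"]] by (simp add: b_def refl_cnj_def)
    qed
    have "2 * \<alpha>2 / (3 * - \<alpha>1) = - (2 * \<alpha>2 / (3 * \<alpha>1))" by simp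
    then have nonres: "2 * \<alpha>2 / (3 * - \<alpha>1) \<notin> \<int>" using par(3) by (simp only: minus_in_Ints_iff) simp
    have boundb: "sob_le s (b t) R" if "t \<in> {0..t0}" for t
      unfolding b_def using that sub by (intro sob_le_refl_cnj bound) auto
    have lowb: "m0 \<le> (cmod (b t (- j0)))\<^sup>2" if "t \<in> {0..t0}" for t
      using low[OF that] by (simp add: b_def refl_cnj_def)
    have contb: "h1_continuous_on {0..t0} b"
      unfolding b_def by (rule h1_continuous_on_refl_cnj[OF cont0])
    \<comment> \<open>Decay of \<open>b\<close> at large positive k is decay of \<open>u0\<close> at
      large negative k; the nonzero coefficient moves to \<open>- j0\<close>.\<close>
    have "fourier_system (- \<alpha>1) \<alpha>2 \<gamma>1 (- \<gamma>2) \<Gamma> s R t0 m0 (- j0) b"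
      using par(1,2) nonres s t0 m0 lowb odeb boundb contb by unfold_locales auto
    then interpret fourier_system "- \<alpha>1" \<alpha>2 \<gamma>1 "- \<gamma>2" \<Gamma> s R t0 m0 "- j0" b .
    obtain C k0 where "\<And>k. k0 \<le> k \<Longrightarrow> cmod (b 0 k) \<le> C * jp k powr (- s - 1)"
      using initial_decay by metis
    then have "\<And>k. k0 \<le> k \<Longrightarrow> cmod (fourier u0 (if \<sigma> = 1 then k else - k)) \<le> C * jp k powr (- s - 1)"
      by (simp add: b_def refl_cnj_def a0 \<sigma>)
    then show ?thesis by (rule that)
  qed
qed

text \<open>Along k = 2^j the assumed bound would give
  \<open>jp k powr (q - \<rho>) \<le> C\<close>, and the left side is unbounded.\<close>

lemma lacunary_not_decaying:
  assumes "\<rho> < q" and decay: "\<And>k. k0 \<le> k \<Longrightarrow> cmod (lacunary \<rho> k) \<le> C * jp k powr - q"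
  shows False
proof -
  define \<delta> where "\<delta> = q - \<rho>"
  have \<delta>: "0 < \<delta>" using assms(1) by (simp add: \<delta>_def)
  have "(1 :: real) < 2" by simp
  from real_arch_pow[OF this] obtain j where j: "max (real_of_int k0) (\<bar>C\<bar> powr (1 / \<delta>)) < 2 ^ j"
    by blast
  define k :: int where "k = 2 ^ j"
  have rk: "real_of_int k = 2 ^ j" by (simp add: k_def)
  then have "real_of_int k0 \<le> real_of_int k" using j by simp
  then have "k0 \<le> k" by (simp only: of_int_le_iff)
  from decay[OF this] have "jp k powr - \<rho> \<le> C * jp k powr - q"
    by (simp add: lacunary_def k_def)
  then have "jp k powr - \<rho> * jp k powr q \<le> C * jp k powr - q * jp k powr q"
    by (intro mult_right_mono) auto
  then have "jp k powr \<delta> \<le> C" by (simp add: \<delta>_def mult.assoc flip: powr_add)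
  moreover have "\<bar>C\<bar> < jp k powr \<delta>"
  proof -
    have "\<bar>C\<bar> powr (1 / \<delta>) < jp k" using j rk by (simp add: jp_def japanese_def)
    then have "(\<bar>C\<bar> powr (1 / \<delta>)) powr \<delta> < jp k powr \<delta>" using \<delta> by (intro powr_less_mono2) auto
    then show ?thesis using \<delta> by (simp add: powr_powr)
  qed
  ultimately show False by linarith
qed

theorem theorem2p1:
  fixes \<alpha>1 \<alpha>2 \<gamma>1 \<gamma>2 \<Gamma> s s1 :: real
  assumes "\<Gamma> > 0" and "\<alpha>1 \<noteq> 0" and "2 * \<alpha>2 / (3 * \<alpha>1) \<notin> \<int>"
    and "1 \<le> s1" and "s1 \<le> s" and "s < s1 + 1"
  shows "\<exists>u0 \<in> sobolev s.
    (\<forall>T>0. \<not> (\<exists>u. u \<in> C_sobolev {0..T} s1 \<and> forward_solution \<alpha>1 \<alpha>2 \<gamma>1 \<gamma>2 \<Gamma> T u0 u)) \<and>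
    (\<forall>T>0. \<not> (\<exists>u. u \<in> C_sobolev {-T..0} s1 \<and> backward_solution \<alpha>1 \<alpha>2 \<gamma>1 \<gamma>2 \<Gamma> T u0 u))"
proof -
  \<comment> \<open>The midpoint of s and s1 + 1: above s the data belong to \<open>H^s\<close>,
    below s1 + 1 they violate the decay.\<close>
  define \<rho> where "\<rho> = (s + s1 + 1) / 2"
  have \<rho>: "s < \<rho>" "\<rho> < s1 + 1" using assms(6) by (auto simp: \<rho>_def)
  obtain X where X: "sob_le s (lacunary \<rho>) X" by (rule lacunary_sobolev[OF \<rho>(1)])
  then have "sob_le 1 (lacunary \<rho>) X" using assms(4,5) by (auto intro: sob_le_mono)
  note l1 = sob_le_l1[OF this]
  define u0 where "u0 = series (lacunary \<rho>)"
  have cont: "continuous_on A u0" for A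
    unfolding u0_def series_def by (rule continuous_trig[OF series_coeffs_summable[OF l1]])
  have fu0: "fourier u0 = lacunary \<rho>"
    using fourier_series[OF l1] by (auto simp: u0_def)
  have "set_integrable lborel torus (\<lambda>x. (cmod (u0 x))\<^sup>2)"
    by (intro borel_integrable_atLeastAtMost' continuous_intros cont)
  moreover have "u0 \<in> borel_measurable borel" by (rule borel_measurable_continuous_onI[OF cont])
  moreover have "periodic u0" unfolding u0_def series_def by (rule trig_periodic)
  ultimately have u0: "u0 \<in> sobolev s"
    using sob_le_sobolev_seq[OF X] by (simp add: sobolev_def fu0)
  \<comment> \<open>1 = 2^0 is a lacunary frequency and serves as the coefficient that is bounded
    below.\<close>
  have j0: "fourier u0 1 \<noteq> 0"
    unfolding fu0 by (auto simp: lacunary_def intro: exI[of _ 0])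
  have no: False if \<sigma>: "\<sigma> = 1 \<or> \<sigma> = - 1" and T: "0 < T" and u: "u \<in> C_sobolev ((\<lambda>\<tau>. \<sigma> * \<tau>) ` {0..T}) s1"
    and weak: "\<And>\<phi>. \<phi> \<in> test_functions (half_interval \<sigma> T) \<Longrightarrow>
       weak_identity \<alpha>1 \<alpha>2 \<gamma>1 \<gamma>2 \<Gamma> (half_interval \<sigma> T) (- \<sigma>) u0 u \<phi>" for \<sigma> T u
  proof -
    obtain C k0 where D: "\<And>k. k0 \<le> k \<Longrightarrow> cmod (fourier u0 (if \<sigma> = 1 then k else - k)) \<le> C * jp k powr (- s1 - 1)"
      using solution_coefficient_decay[OF assms(1-4) T \<sigma> u weak j0] by metis
    \<comment> \<open>The data are even in frequency, so the backward bound at - k is also a bound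
      at k.\<close>
    have "lacunary \<rho> (- k) = lacunary \<rho> k" for k by (simp add: lacunary_def)
    then have "cmod (lacunary \<rho> k) \<le> C * jp k powr - (s1 + 1)" if "k0 \<le> k" for k
      using D[OF that] by (cases "\<sigma> = 1") (simp_all add: fu0)
    then show False by (rule lacunary_not_decaying[OF \<rho>(2)])
  qed
  have "half_interval 1 T = {0..<T}" "half_interval (- 1) T = {-T<..0}" for T
    by (auto simp: half_interval_def)
  moreover have "(\<lambda>\<tau>. 1 * \<tau>) ` {0..T} = {0..T}" "(\<lambda>\<tau>. - 1 * \<tau>) ` {0..T} = {-T..0}" for T :: real
    by (simp_all flip: image_uminus_atLeastAtMost[of 0 T, simplified])
  ultimately have "\<not> (u \<in> C_sobolev {0..T} s1 \<and> forward_solution \<alpha>1 \<alpha>2 \<gamma>1 \<gamma>2 \<Gamma> T u0 u)"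
    "\<not> (u \<in> C_sobolev {-T..0} s1 \<and> backward_solution \<alpha>1 \<alpha>2 \<gamma>1 \<gamma>2 \<Gamma> T u0 u)" if "0 < T" for u T
    using no[of 1 T u] no[of "- 1" T u] that
    unfolding forward_solution_def backward_solution_def solution_on_def by auto
  with u0 show ?thesis by blast
qed

end
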